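(* Let $\{V(\mathbf t):\mathbf t\in\mathbb Z^2\}$ be a stationary random field with mean $\mu$, and let $T=\{(t_1,t_2)\in\mathbb Z^2:1\le t_k\le d_k,\ k=1,2\}$. Assume: (1) there exist $0<\xi\le 1/2$ and $c_1,c_2>0$ such that, for all sufficiently large $|T|$, $d_1>c_1|T|^{\xi}$ and $d_2>c_2|T|^{\xi}$; (2) $\sum_{\mathbf j\in\mathbb Z^2}|\gamma(\mathbf j)|<\infty$, where $\gamma(\mathbf j)=\mathrm{Cov}(V(\mathbf 0),V(\mathbf j))$; (3) the spectral density $f(\lambda)=\frac1{4\pi^2}\sum_{\mathbf j\in\mathbb Z^2}e^{-i\lambda'\mathbf j}\gamma(\mathbf j)$ satisfies $f(\lambda)\ge c$ for some $c>0$ and all $\lambda\in[0,2\pi]^2$; (4) $V$ is $p$-stable for some $p\ge2$. For $\mathbf j\in N$ put $\widetilde s_T(\mathbf j,1)=\dfrac{x(\mathbf j)}{\sqrt{2\pi^2f(\lambda_{\mathbf j})}}$ and $\widetilde s_T(\mathbf j,2)=\dfrac{y(\mathbf j)}{\sqrt{2\pi^2f(\lambda_{\mathbf j})}}$, and let $F_N=\{(\mathbf j,k):\mathbf j\in N,\ k=1,2\}$. Then, for each fixed $q\in\mathbb N$, as $T\to\infty$, $$\sup\Big|\mathbb P\big((\widetilde s_T(\mathbf a_1),\dots,\widetilde s_T(\mathbf a_q))'\mathbf c\le z\big)-\Phi(z)\Big|=o(1),$$ where the supremum is over all pairwise distinct $\mathbf a_1,\dots,\mathbf a_q\in F_N$,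 all $\mathbf c\in\mathbb R^q$ with $\|\mathbf c\|_2=1$, and all $z\in\mathbb R$, and $\Phi$ is the standard normal cumulative distribution function.
   Context: Notation: $|T|=d_1d_2$; $T\to\infty$ means $d_1\to\infty$ and $d_2\to\infty$; $\mathbf a'\mathbf b$ is the dot product; $\|\mathbf c\|_2$ is the Euclidean norm; $\|X\|_p=(\mathbb E|X|^p)^{1/p}$. Fourier coefficients: for $\mathbf j=(j_1,j_2)$ let $\lambda_{\mathbf j}=(2\pi j_1/d_1,2\pi j_2/d_2)$ and $$x(\mathbf j)=\frac1{\sqrt{|T|}}\sum_{\mathbf t\in T}V(\mathbf t)\cos(-\lambda_{\mathbf j}'\mathbf t),\qquad y(\mathbf j)=\frac1{\sqrt{|T|}}\sum_{\mathbf t\in T}V(\mathbf t)\sin(-\lambda_{\mathbf j}'\mathbf t).$$ The index set $N\subset T$: if $d_1,d_2$ are both odd, $N=\{1\le t_1\le d_1,\ 1\le t_2\le\frac{d_2-1}2\}\cup\{1\le t_1\le\frac{d_1-1}2,\ t_2=d_2\}$. If $d_1$ is odd and $d_2$ even, $N=\{1\le t_1\le d_1,\ 1\le t_2\le\frac{d_2}2-1\}\cup\{1\le t_1\le\frac{d_1-1}2,\ t_2\in\{\frac{d_2}2,d_2\}\}$; if $d_1$ is even and $d_2$ odd, the same with the roles of the two coordinates interchanged. If both are even, $N=\{1\le t_1\le d_1,\ 1\le t_2\le\frac{d_2}2-1\}\cup\{1\le t_1\le\frac{d_1}2-1,\ t_2\in\{\frac{d_2}2,d_2\}\}$. $p$-stability: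 $V$ is $p$-stable if $V(\mathbf j)-\mu=G(\varepsilon_{\mathbf j-\mathbf s}:\mathbf s\in\mathbb Z^2)$ for all $\mathbf j\in\mathbb Z^2$, where $G$ is measurable and $\{\varepsilon_{\mathbf i}\}_{\mathbf i\in\mathbb Z^2}$ is an i.i.d. random field, $V(\mathbf j)\in\mathbb L^p$, and $\sum_{\mathbf j\in\mathbb Z^2}\|V(\mathbf j)-\widetilde V(\mathbf j)\|_p<\infty$. Here $\{\widetilde\varepsilon_{\mathbf i}\}$ is an i.i.d. (independent) copy of $\{\varepsilon_{\mathbf i}\}$ and $\widetilde V(\mathbf j)-\mu=G(\varepsilon^*_{\mathbf j-\mathbf s}:\mathbf s\in\mathbb Z^2)$ with $\varepsilon^*_{\mathbf i}=\varepsilon_{\mathbf i}$ for $\mathbf i\ne\mathbf 0$ and $\varepsilon^*_{\mathbf 0}=\widetilde\varepsilon_{\mathbf 0}$. *)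

theory Defs
  imports "HOL-Probability.Probability"
begin

type_synonym site = "int \<times> int"

text \<open>A random field on \<open>\<int>\<^sup>2\<close> is a family of real random variables
  \<open>V t\<close> on a probability space \<open>M\<close>; \<open>V t \<omega>\<close> is its value at the site \<open>t\<close>.
  Stationarity is strict: the finite-dimensional laws are invariant under shifts.\<close>

definition stationary_field :: "'a measure \<Rightarrow> (site \<Rightarrow> 'a \<Rightarrow> real) \<Rightarrow> bool" where
  "stationary_field M V \<longleftrightarrow>
     (\<forall>t. V t \<in> borel_measurable M) \<and>
     (\<forall>J h. finite J \<longrightarrow>
        distr M (Pi\<^sub>M J (\<lambda>_. borel)) (\<lambda>\<omega>. \<lambda>t\<in>J. V (t + h) \<omega>) =
        distr M (Pi\<^sub>M J (\<lambda>_. borel)) (\<lambda>\<omega>. \<lambda>t\<in>J. V t \<omega>))"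

definition has_mean :: "'a measure \<Rightarrow> (site \<Rightarrow> 'a \<Rightarrow> real) \<Rightarrow> real \<Rightarrow> bool" where
  "has_mean M V \<mu> \<longleftrightarrow> (\<forall>t. integrable M (V t) \<and> integral\<^sup>L M (V t) = \<mu>)"

definition covariance :: "'a measure \<Rightarrow> ('a \<Rightarrow> real) \<Rightarrow> ('a \<Rightarrow> real) \<Rightarrow> real" where
  "covariance M X Y =
     integral\<^sup>L M (\<lambda>\<omega>. (X \<omega> - integral\<^sup>L M X) * (Y \<omega> - integral\<^sup>L M Y))"

definition autocov :: "'a measure \<Rightarrow> (site \<Rightarrow> 'a \<Rightarrow> real) \<Rightarrow> site \<Rightarrow> real" where
  "autocov M V j = covariance M (V 0) (V j)"

definition site_vec :: "site \<Rightarrow> real \<times> real" where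
  "site_vec j = (of_int (fst j), of_int (snd j))"

text \<open>The series is real for a stationary field, because the autocovariance is then even;
  \<open>Re\<close> only changes the type.\<close>

definition spectral_density ::
    "'a measure \<Rightarrow> (site \<Rightarrow> 'a \<Rightarrow> real) \<Rightarrow> real \<times> real \<Rightarrow> real" where
  "spectral_density M V \<theta> =
     Re (1 / (4 * of_real pi ^ 2) *
         (\<Sum>\<^sub>\<infinity>j\<in>UNIV. exp (- \<i> * of_real (\<theta> \<bullet> site_vec j)) * of_real (autocov M V j)))"

definition Lp_norm :: "'a measure \<Rightarrow> real \<Rightarrow> ('a \<Rightarrow> real) \<Rightarrow> real" where
  "Lp_norm M p X = (integral\<^sup>L M (\<lambda>\<omega>. \<bar>X \<omega>\<bar> powr p)) powr (1 / p)"

definition in_Lp :: "'a measure \<Rightarrow> real \<Rightarrow> ('a \<Rightarrow> real) \<Rightarrow> bool" where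
  "in_Lp M p X \<longleftrightarrow> X \<in> borel_measurable M \<and> integrable M (\<lambda>\<omega>. \<bar>X \<omega>\<bar> powr p)"

definition iid_field :: "'a measure \<Rightarrow> (site \<Rightarrow> 'a \<Rightarrow> real) \<Rightarrow> bool" where
  "iid_field M \<epsilon> \<longleftrightarrow>
     prob_space.indep_vars M (\<lambda>_. borel) \<epsilon> UNIV \<and>
     (\<forall>i. distr M borel (\<epsilon> i) = distr M borel (\<epsilon> 0))"

text \<open>The independent copy of the noise is realised on the product space \<open>M \<Otimes>\<^sub>M M\<close>: the
  original noise is read off the first component and its copy off the second, so that
  no richness of \<open>M\<close> is required. Every other independent copy gives the same joint law
  of \<open>\<epsilon>\<close> and its copy. In the result only the noise at the origin is replaced.\<close>

definition coupled_noise :: "(site \<Rightarrow> 'a \<Rightarrow> real) \<Rightarrow> site \<Rightarrow> 'a \<times> 'a \<Rightarrow> real" where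
  "coupled_noise \<epsilon> i w = (if i = 0 then \<epsilon> i (snd w) else \<epsilon> i (fst w))"

text \<open>The coupled noise has the law of \<open>\<epsilon>\<close>, so the coupled field is in \<open>L\<^sup>p\<close> as soon
  as \<open>V\<close> is, and the norms below are those of integrable functions, not default values of
  the Bochner integral.\<close>

definition p_stable ::
    "'a measure \<Rightarrow> real \<Rightarrow> real \<Rightarrow> (site \<Rightarrow> 'a \<Rightarrow> real) \<Rightarrow> bool" where
  "p_stable M \<mu> p V \<longleftrightarrow>
     (\<forall>j. in_Lp M p (V j)) \<and>
     (\<exists>\<epsilon> G. iid_field M \<epsilon> \<and>
        G \<in> borel_measurable (Pi\<^sub>M UNIV (\<lambda>_. borel)) \<and>
        (\<forall>j. AE \<omega> in M. V j \<omega> - \<mu> = G (\<lambda>s. \<epsilon> (j - s) \<omega>)) \<and>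
        (\<lambda>j. Lp_norm (M \<Otimes>\<^sub>M M) p
               (\<lambda>w. V j (fst w) - (\<mu> + G (\<lambda>s. coupled_noise \<epsilon> (j - s) w))))
          summable_on UNIV)"

definition grid :: "nat \<Rightarrow> nat \<Rightarrow> site set" where
  "grid d1 d2 = {1..int d1} \<times> {1..int d2}"

definition fourier_freq :: "nat \<Rightarrow> nat \<Rightarrow> site \<Rightarrow> real \<times> real" where
  "fourier_freq d1 d2 j =
     (2 * pi * of_int (fst j) / of_nat d1, 2 * pi * of_int (snd j) / of_nat d2)"

definition fourier_cos ::
    "nat \<Rightarrow> nat \<Rightarrow> (site \<Rightarrow> 'a \<Rightarrow> real) \<Rightarrow> site \<Rightarrow> 'a \<Rightarrow> real" where
  "fourier_cos d1 d2 V j \<omega> =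
     1 / sqrt (real (d1 * d2)) *
     (\<Sum>t\<in>grid d1 d2. V t \<omega> * cos (- (fourier_freq d1 d2 j \<bullet> site_vec t)))"

definition fourier_sin ::
    "nat \<Rightarrow> nat \<Rightarrow> (site \<Rightarrow> 'a \<Rightarrow> real) \<Rightarrow> site \<Rightarrow> 'a \<Rightarrow> real" where
  "fourier_sin d1 d2 V j \<omega> =
     1 / sqrt (real (d1 * d2)) *
     (\<Sum>t\<in>grid d1 d2. V t \<omega> * sin (- (fourier_freq d1 d2 j \<bullet> site_vec t)))"

text \<open>All divisions by 2 below are exact in the branch where they occur.\<close>

definition freq_indices :: "nat \<Rightarrow> nat \<Rightarrow> site set" where
  "freq_indices m n =
    (let d1 = int m; d2 = int n in
     if odd m \<and> odd n then
       {1..d1} \<times> {1..(d2 - 1) div 2} \<union> {1..(d1 - 1) div 2} \<times> {d2}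
     else if odd m \<and> even n then
       {1..d1} \<times> {1..d2 div 2 - 1} \<union> {1..(d1 - 1) div 2} \<times> {d2 div 2, d2}
     else if even m \<and> odd n then
       {1..d1 div 2 - 1} \<times> {1..d2} \<union> {d1 div 2, d1} \<times> {1..(d2 - 1) div 2}
     else
       {1..d1} \<times> {1..d2 div 2 - 1} \<union> {1..d1 div 2 - 1} \<times> {d2 div 2, d2})"

definition coeff_indices :: "nat \<Rightarrow> nat \<Rightarrow> (site \<times> nat) set" where
  "coeff_indices d1 d2 = freq_indices d1 d2 \<times> {1, 2}"

text \<open>The second component of the index selects the cosine (1) or the sine (2) coefficient.\<close>

definition norm_coeff ::
    "'a measure \<Rightarrow> (site \<Rightarrow> 'a \<Rightarrow> real) \<Rightarrow> nat \<Rightarrow> nat \<Rightarrow> site \<times> nat \<Rightarrow> 'a \<Rightarrow> real" where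
  "norm_coeff M V d1 d2 a \<omega> =
     (if snd a = 1 then fourier_cos d1 d2 V (fst a) \<omega> else fourier_sin d1 d2 V (fst a) \<omega>) /
     sqrt (2 * pi ^ 2 * spectral_density M V (fourier_freq d1 d2 (fst a)))"

end

theory Submission
  imports Defs
begin

text \<open>A linear combination of normalised Fourier coefficients is a weighted sum
\<open>\<Sum>t\<in>T. w t * V t\<close> with \<open>\<bar>w t\<bar> \<le> C / sqrt \<bar>T\<bar>\<close>, where \<open>C\<close> depends only on the number of
coefficients and on the lower bound of the spectral density, and with \<open>(\<Sum>t\<in>T. w t) = 0\<close>, so that
\<open>V t\<close> may be replaced by \<open>V t - \<mu> = G (noise seen from t)\<close>. The theorem is a central limit theorem
for such sums, together with the fact that their variance tends to \<open>1\<close>.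

\<^bold>\<open>Central limit theorem.\<close> Resampling one noise variable changes the sum, in \<open>L\<^sup>2\<close>, by at most the
convolution of \<open>\<bar>w\<bar>\<close> with the influences \<open>\<delta> j\<close> of the noise variables on \<open>G\<close>; \<open>p\<close>-stability says
that \<open>\<Sum>j. \<delta> j\<close> is finite, since an \<open>L\<^sup>2\<close> norm is at most the \<open>L\<^sup>p\<close> norm. By the Efron--Stein
inequality the \<open>L\<^sup>2\<close> norm of the sum is at most \<open>C * (\<Sum>j. \<delta> j)\<close>, for every finite \<open>T\<close>
(\<open>l2norm_linear_statistic_le\<close>). Hence \<open>G\<close> may be replaced by any \<open>h\<close> for which the influences on
\<open>G - h\<close> have a small sum. Such an \<open>h\<close>, bounded and depending on finitely many noise variables, is
obtained by truncating \<open>G\<close> and averaging over all but finitely many variables: neither operation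
increases an influence, so dominated convergence applies to the sum (\<open>finite_range_approximation\<close>).
For this \<open>h\<close> the summands are bounded by a multiple of \<open>1 / sqrt \<bar>T\<bar>\<close> and each depends on a bounded
number of others, and the characteristic function \<open>\<phi>\<close> of the sum satisfies
\<open>\<phi>' u = - u * \<sigma>\<^sup>2 * \<phi> u + O(u\<^sup>2 / sqrt \<bar>T\<bar>)\<close>, which forces \<open>\<phi> u\<close> to be close to \<open>exp (- \<sigma>\<^sup>2 * u\<^sup>2 / 2)\<close>
(\<open>local_dependence_characteristic_function\<close>).

\<^bold>\<open>Variance.\<close> The index set is such that \<open>j + k\<close> is never zero modulo \<open>(d1, d2)\<close> for two of its
elements, and \<open>j - k\<close> is zero only if \<open>j = k\<close>. The discrete orthogonality relations therefore turn
the circular quadratic form \<open>\<Sum>h. \<gamma> h * (\<Sum>s\<in>T. w s * w (s + h))\<close> into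
\<open>\<Sum>i. (c i)\<^sup>2 / (4 * pi\<^sup>2 * f i) * (\<Sum>h. \<gamma> h * cos (\<lambda>\<^sub>i \<bullet> h))\<close>, and the inner sum is \<open>4 * pi\<^sup>2 * f i\<close>: the
form equals \<open>1\<close>. It differs from the variance by the pairs for which \<open>s + h\<close> leaves the grid, whose
contribution vanishes by summability of the autocovariances (\<open>quadratic_form_circular_limit\<close>).

\<^bold>\<open>Uniformity.\<close> All bounds depend on the coefficients and on the unit vector only through \<open>C\<close>, so the
central limit theorem holds along every sequence of choices, in particular along one that almost
attains the supremum. Pointwise convergence of distribution functions to a continuous one is
uniform, which takes care of \<open>z\<close>.\<close>

section \<open>Square-integrable functions\<close>

definition sqint :: "'a measure \<Rightarrow> ('a \<Rightarrow> real) \<Rightarrow> bool" where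
  "sqint N f \<longleftrightarrow> f \<in> borel_measurable N \<and> integrable N (\<lambda>x. (f x)\<^sup>2)"

definition l2norm :: "'a measure \<Rightarrow> ('a \<Rightarrow> real) \<Rightarrow> real" where
  "l2norm N f = sqrt (\<integral>x. (f x)\<^sup>2 \<partial>N)"

lemma sqint_measurable: "sqint N f \<Longrightarrow> f \<in> borel_measurable N"
  by (simp add: sqint_def)

lemma sqint_integrable_mult:
  assumes "sqint N f" "sqint N g"
  shows "integrable N (\<lambda>x. f x * g x)"
proof (rule Bochner_Integration.integrable_bound)
  show "integrable N (\<lambda>x. (f x)\<^sup>2 + (g x)\<^sup>2)"
    using assms by (auto simp: sqint_def)
  show "(\<lambda>x. f x * g x) \<in> borel_measurable N"
    using assms by (auto simp: sqint_def)
  have "\<bar>a * b\<bar> \<le> a\<^sup>2 + b\<^sup>2" for a b :: real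
  proof -
    have "2 * (\<bar>a\<bar> * \<bar>b\<bar>) \<le> a\<^sup>2 + b\<^sup>2" "0 \<le> \<bar>a\<bar> * \<bar>b\<bar>"
      using sum_squares_bound[of "\<bar>a\<bar>" "\<bar>b\<bar>"] by (auto simp: mult.assoc)
    then show ?thesis
      unfolding abs_mult by linarith
  qed
  then show "AE x in N. norm (f x * g x) \<le> norm ((f x)\<^sup>2 + (g x)\<^sup>2)"
    by (intro AE_I2) simp
qed

lemma sqint_add: "sqint N f \<Longrightarrow> sqint N g \<Longrightarrow> sqint N (\<lambda>x. f x + g x)"
  using sqint_integrable_mult[of N f g]
  by (auto simp: sqint_def power2_sum mult.assoc)

lemma sqint_scale: "sqint N f \<Longrightarrow> sqint N (\<lambda>x. c * f x)"
  by (auto simp: sqint_def power_mult_distrib)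

lemma sqint_diff: "sqint N f \<Longrightarrow> sqint N g \<Longrightarrow> sqint N (\<lambda>x. f x - g x)"
  using sqint_add[of N f "\<lambda>x. (-1) * g x"] sqint_scale[of N g "-1"] by simp

lemma sqint_zero: "sqint N (\<lambda>_. 0)"
  by (simp add: sqint_def)

lemma sqint_sum: "(\<And>t. t \<in> T \<Longrightarrow> sqint N (f t)) \<Longrightarrow> sqint N (\<lambda>x. \<Sum>t\<in>T. f t x)"
  by (induction T rule: infinite_finite_induct) (auto intro: sqint_add sqint_zero)

lemma (in finite_measure) sqint_bounded:
  assumes "f \<in> borel_measurable M" "\<And>x. x \<in> space M \<Longrightarrow> \<bar>f x\<bar> \<le> K"
  shows "sqint M f"
proof -
  have "\<bar>f x\<bar>\<^sup>2 \<le> K\<^sup>2" if "x \<in> space M" for x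
    using assms(2)[OF that] by (intro power_mono) auto
  then have "integrable M (\<lambda>x. (f x)\<^sup>2)"
    using assms(1) by (intro integrable_const_bound[where B = "K\<^sup>2"]) auto
  then show ?thesis
    using assms by (simp add: sqint_def)
qed

lemma (in finite_measure) sqint_integrable: "sqint M f \<Longrightarrow> integrable M f"
  using sqint_integrable_mult[of M f "\<lambda>_. 1"] sqint_bounded[of "\<lambda>_. 1" 1] by simp

lemma l2norm_nonneg: "0 \<le> l2norm N f"
  by (simp add: l2norm_def)

lemma l2norm_power2: "(l2norm N f)\<^sup>2 = (\<integral>x. (f x)\<^sup>2 \<partial>N)"
  by (simp add: l2norm_def)

lemma l2norm_scale: "l2norm N (\<lambda>x. c * f x) = \<bar>c\<bar> * l2norm N f"
  by (simp add: l2norm_def power_mult_distrib real_sqrt_mult)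

lemma l2norm_mono:
  assumes "sqint N g" "AE x in N. \<bar>f x\<bar> \<le> \<bar>g x\<bar>"
  shows "l2norm N f \<le> l2norm N g"
  unfolding l2norm_def
proof (intro real_sqrt_le_mono integral_mono_AE')
  show "integrable N (\<lambda>x. (g x)\<^sup>2)"
    using assms by (simp add: sqint_def)
  show "AE x in N. (f x)\<^sup>2 \<le> (g x)\<^sup>2"
    using assms(2) by eventually_elim (use abs_le_square_iff in blast)
qed simp

text \<open>The discriminant of the nonnegative quadratic \<open>s \<mapsto> \<parallel>f - s g\<parallel>\<^sup>2\<close> is at most \<open>0\<close>.\<close>

lemma l2norm_Cauchy_Schwarz:
  assumes f: "sqint N f" and g: "sqint N g"
  shows "\<bar>\<integral>x. f x * g x \<partial>N\<bar> \<le> l2norm N f * l2norm N g"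
proof -
  note fg = sqint_integrable_mult[OF f g]
  let ?A = "\<integral>x. (f x)\<^sup>2 \<partial>N" and ?B = "\<integral>x. f x * g x \<partial>N" and ?C = "\<integral>x. (g x)\<^sup>2 \<partial>N"
  have ge: "0 \<le> r\<^sup>2 * ?A - 2 * (r * s) * ?B + s\<^sup>2 * ?C" for r s
  proof -
    have "0 \<le> (\<integral>x. (r * f x - s * g x)\<^sup>2 \<partial>N)"
      by simp
    also have "(\<lambda>x. (r * f x - s * g x)\<^sup>2)
        = (\<lambda>x. r\<^sup>2 * (f x)\<^sup>2 - 2 * (r * s) * (f x * g x) + s\<^sup>2 * (g x)\<^sup>2)"
      by (auto simp: power2_eq_square algebra_simps)
    also have "(\<integral>x. \<dots> x \<partial>N) = r\<^sup>2 * ?A - 2 * (r * s) * ?B + s\<^sup>2 * ?C"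
      using f g fg by (simp add: sqint_def)
    finally show ?thesis .
  qed
  have A: "0 \<le> ?A" and C: "0 \<le> ?C"
    by auto
  have "?B\<^sup>2 \<le> ?A * ?C"
  proof (cases "?C = 0")
    case True
    have "?B = 0"
    proof (rule ccontr)
      assume B: "?B \<noteq> 0"
      show False
        using ge[of 1 "(?A + 1) / (2 * ?B)"] True B A by (simp add: field_simps)
    qed
    then show ?thesis using True by simp
  next
    case False
    then have "0 \<le> ?C * (?A * ?C - ?B\<^sup>2)"
      using ge[of ?C ?B] by (simp add: power2_eq_square algebra_simps)
    then show ?thesis
      using False C by (simp add: zero_le_mult_iff)
  qed
  then have "sqrt (?B\<^sup>2) \<le> sqrt (?A * ?C)"
    by (rule real_sqrt_le_mono)
  then show ?thesis
    by (simp add: l2norm_def real_sqrt_mult)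
qed

lemma l2norm_triangle:
  assumes f: "sqint N f" and g: "sqint N g"
  shows "l2norm N (\<lambda>x. f x + g x) \<le> l2norm N f + l2norm N g"
proof (rule power2_le_imp_le)
  note fg = sqint_integrable_mult[OF f g]
  have "(l2norm N (\<lambda>x. f x + g x))\<^sup>2 = (\<integral>x. (f x)\<^sup>2 + (g x)\<^sup>2 + 2 * (f x * g x) \<partial>N)"
    unfolding l2norm_power2 by (simp add: power2_sum mult.assoc)
  also have "\<dots> = (\<integral>x. (f x)\<^sup>2 \<partial>N) + (\<integral>x. (g x)\<^sup>2 \<partial>N) + 2 * (\<integral>x. f x * g x \<partial>N)"
    using f g fg by (simp add: sqint_def)
  also have "\<dots> \<le> (l2norm N f)\<^sup>2 + (l2norm N g)\<^sup>2 + 2 * (l2norm N f * l2norm N g)"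
    using l2norm_Cauchy_Schwarz[OF f g] by (simp add: l2norm_power2)
  finally show "(l2norm N (\<lambda>x. f x + g x))\<^sup>2 \<le> (l2norm N f + l2norm N g)\<^sup>2"
    by (simp add: power2_sum)
qed (simp add: l2norm_nonneg)

lemma l2norm_minus: "l2norm N (\<lambda>x. - f x) = l2norm N f"
  by (simp add: l2norm_def)

lemma l2norm_minus_commute: "l2norm N (\<lambda>x. f x - g x) = l2norm N (\<lambda>x. g x - f x)"
  by (simp add: l2norm_def power2_commute)

lemma l2norm_triangle_diff:
  assumes f: "sqint N f" and g: "sqint N g"
  shows "l2norm N (\<lambda>x. f x - g x) \<le> l2norm N f + l2norm N g"
  using l2norm_triangle[OF f sqint_scale[OF g, of "-1"]] by (simp add: l2norm_minus)

lemma l2norm_sum: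
  assumes "\<And>t. t \<in> T \<Longrightarrow> sqint N (f t)"
  shows "l2norm N (\<lambda>x. \<Sum>t\<in>T. f t x) \<le> (\<Sum>t\<in>T. l2norm N (f t))"
  using assms
proof (induction T rule: infinite_finite_induct)
  case (insert t T)
  then have "l2norm N (\<lambda>x. f t x + (\<Sum>t\<in>T. f t x)) \<le> l2norm N (f t) + l2norm N (\<lambda>x. \<Sum>t\<in>T. f t x)"
    by (intro l2norm_triangle sqint_sum) auto
  with insert show ?case by fastforce
qed (simp_all add: l2norm_def)

lemma (in prob_space) l2norm_integral_bound:
  assumes "sqint M f"
  shows "\<bar>expectation f\<bar> \<le> l2norm M f" "expectation (\<lambda>x. \<bar>f x\<bar>) \<le> l2norm M f"
proof -
  have one: "sqint M (\<lambda>_. 1)" "l2norm M (\<lambda>_. 1) = 1"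
    using sqint_bounded[of "\<lambda>_. 1" 1] by (auto simp: l2norm_def prob_space)
  show "\<bar>expectation f\<bar> \<le> l2norm M f"
    using l2norm_Cauchy_Schwarz[OF assms one(1)] one(2) by simp
  have "sqint M (\<lambda>x. \<bar>f x\<bar>)"
    using assms by (auto simp: sqint_def)
  from l2norm_Cauchy_Schwarz[OF this one(1)]
  show "expectation (\<lambda>x. \<bar>f x\<bar>) \<le> l2norm M f"
    using one(2) by (simp add: l2norm_def)
qed

text \<open>The form used throughout: \<open>\<phi>\<close> is a measure-preserving map, such as a shift of the noise or an
exchange of two copies of it.\<close>

lemma sqint_distr:
  assumes "\<phi> \<in> measurable N N'"  "sqint N' f" "distr N N' \<phi> = N'"
  shows "sqint N (\<lambda>x. f (\<phi> x))"
proof -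
  have "integrable (distr N N' \<phi>) (\<lambda>x. (f x)\<^sup>2)"
    using assms by (simp add: sqint_def)
  then have "integrable N (\<lambda>x. (f (\<phi> x))\<^sup>2)"
    by (rule integrable_distr[OF assms(1)])
  then show ?thesis
    using assms by (auto simp: sqint_def)
qed

lemma l2norm_distr:
  assumes "\<phi> \<in> measurable N N'"  "f \<in> borel_measurable N'" "distr N N' \<phi> = N'"
  shows "l2norm N (\<lambda>x. f (\<phi> x)) = l2norm N' f"
proof -
  have "(\<integral>x. (f x)\<^sup>2 \<partial>distr N N' \<phi>) = (\<integral>x. (f (\<phi> x))\<^sup>2 \<partial>N)"
    using assms by (intro integral_distr) auto
  then show ?thesis
    using assms by (simp add: l2norm_def)
qed

section \<open>Truncation\<close>

definition truncate :: "real \<Rightarrow> real \<Rightarrow> real" where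
  "truncate K r = max (- K) (min K r)"

lemma truncate_bound: "0 \<le> K \<Longrightarrow> \<bar>truncate K r\<bar> \<le> K"
  by (auto simp: truncate_def)

lemma truncate_contraction: "\<bar>truncate K r - truncate K s\<bar> \<le> \<bar>r - s\<bar>"
  unfolding truncate_def by linarith

lemma truncate_le: "0 \<le> K \<Longrightarrow> \<bar>truncate K r\<bar> \<le> \<bar>r\<bar>"
  unfolding truncate_def by linarith

lemma measurable_truncate: "f \<in> borel_measurable N \<Longrightarrow> (\<lambda>x. truncate K (f x)) \<in> borel_measurable N"
  unfolding truncate_def by (intro borel_measurable_max borel_measurable_min borel_measurable_const)

lemma sqint_truncate:
  assumes "sqint N f" "0 \<le> K"
  shows "sqint N (\<lambda>x. truncate K (f x))"
  unfolding sqint_def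
proof
  show meas: "(\<lambda>x. truncate K (f x)) \<in> borel_measurable N"
    using assms by (intro measurable_truncate) (simp add: sqint_def)
  show "integrable N (\<lambda>x. (truncate K (f x))\<^sup>2)"
  proof (rule Bochner_Integration.integrable_bound)
    show "integrable N (\<lambda>x. (f x)\<^sup>2)"
      using assms by (simp add: sqint_def)
    show "AE x in N. norm ((truncate K (f x))\<^sup>2) \<le> norm ((f x)\<^sup>2)"
      using truncate_le[OF assms(2)] by (intro AE_I2) (simp add: abs_le_square_iff)
  qed (intro borel_measurable_power meas)
qed

lemma truncate_tendsto_l2norm:
  assumes f: "sqint N f"
  shows "(\<lambda>n. l2norm N (\<lambda>x. f x - truncate (real n) (f x))) \<longlonglongrightarrow> 0"
proof -
  have meas: "f \<in> borel_measurable N"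
    using f by (simp add: sqint_def)
  have lim: "(\<lambda>n. \<integral>x. (f x - truncate (real n) (f x))\<^sup>2 \<partial>N) \<longlonglongrightarrow> (\<integral>x. 0 \<partial>N)"
  proof (rule integral_dominated_convergence)
    show "integrable N (\<lambda>x. (f x)\<^sup>2)"
      using f by (simp add: sqint_def)
    show "(\<lambda>x. (f x - truncate (real n) (f x))\<^sup>2) \<in> borel_measurable N" for n
      by (intro borel_measurable_power borel_measurable_diff measurable_truncate meas)
    have "(\<lambda>n. (r - truncate (real n) r)\<^sup>2) \<longlonglongrightarrow> 0" for r
    proof (rule tendsto_eventually)
      obtain m where "\<bar>r\<bar> \<le> real m"
        using real_arch_simple by blast
      then show "\<forall>\<^sub>F n in sequentially. (r - truncate (real n) r)\<^sup>2 = 0"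
        by (intro eventually_sequentiallyI[of m]) (auto simp: truncate_def max_def min_def)
    qed
    then show "AE x in N. (\<lambda>n. (f x - truncate (real n) (f x))\<^sup>2) \<longlonglongrightarrow> 0"
      by simp
    have "(r - truncate (real n) r)\<^sup>2 \<le> r\<^sup>2" for n r
      unfolding abs_le_square_iff[symmetric] truncate_def by linarith
    then show "AE x in N. norm ((f x - truncate (real n) (f x))\<^sup>2) \<le> (f x)\<^sup>2" for n
      by simp
  qed simp
  show ?thesis
    using tendsto_real_sqrt[OF lim] by (simp add: l2norm_def)
qed

section \<open>Independent noise and resampling\<close>

text \<open>The law \<open>\<nu>\<close> of one noise variable does not determine the set of sites; the second parameter
makes the type of sites part of the locale.\<close>

locale iid_noise = real_distribution \<nu> for \<nu> :: "real measure" +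
  fixes site_type :: "'i itself"
begin

abbreviation P :: "('i \<Rightarrow> real) measure" where
  "P \<equiv> Pi\<^sub>M UNIV (\<lambda>_. \<nu>)"

abbreviation PP :: "(('i \<Rightarrow> real) \<times> ('i \<Rightarrow> real)) measure" where
  "PP \<equiv> P \<Otimes>\<^sub>M P"

sublocale P: prob_space P
  by (rule prob_space_PiM) unfold_locales

sublocale PP: pair_prob_space P P ..

lemma space_P: "space P = UNIV"
  by (simp add: space_PiM)

lemma measurable_to_P:
  "(\<And>i. (\<lambda>w. f w i) \<in> borel_measurable N) \<Longrightarrow> f \<in> measurable N P"
  by (rule measurable_PiM_single') (auto simp: space_P)

lemma measurable_coordinate: "(\<lambda>x. x i) \<in> borel_measurable P"
  using measurable_component_singleton[of i UNIV "\<lambda>_. \<nu>"] by simp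

lemma measurable_override_on:
  assumes "f \<in> measurable N P" "g \<in> measurable N P"
  shows "(\<lambda>w. override_on (f w) (g w) A) \<in> measurable N P"
proof (rule measurable_to_P)
  fix i
  have "(\<lambda>w. f w i) \<in> borel_measurable N" "(\<lambda>w. g w i) \<in> borel_measurable N"
    by (rule measurable_compose[OF assms(1) measurable_coordinate],
        rule measurable_compose[OF assms(2) measurable_coordinate])
  then show "(\<lambda>w. override_on (f w) (g w) A i) \<in> borel_measurable N"
    by (cases "i \<in> A") (simp_all add: override_on_def)
qed

lemma measurable_reindex: "(\<lambda>x i. x (r i)) \<in> measurable P P"
  by (rule measurable_to_P) (rule measurable_coordinate)

lemma distr_reindex: "inj r \<Longrightarrow> distr P P (\<lambda>x i. x (r i)) = P"
  using distr_PiM_reindex[of UNIV "\<lambda>_. \<nu>" r UNIV] prob_space_axioms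
  by (simp add: restrict_UNIV)

text \<open>Two independent copies of the noise are the two halves of one family of independent
  variables indexed by \<open>UNIV :: (bool \<times> 'i) set\<close>, and exchanging the two copies at some of the
  sites is a permutation of that index set.\<close>

lemma distr_swap:
  "distr PP PP (\<lambda>w. (override_on (fst w) (snd w) A, override_on (snd w) (fst w) A)) = PP"
proof -
  let ?Q = "Pi\<^sub>M (UNIV :: (bool \<times> 'i) set) (\<lambda>_. \<nu>)"
  interpret Q: prob_space ?Q
    by (rule prob_space_PiM) unfold_locales
  have coord: "(\<lambda>z. z k) \<in> measurable ?Q \<nu>" for k
    using measurable_component_singleton[of k UNIV "\<lambda>_. \<nu>"] by simp
  have "distr ?Q \<nu> (\<lambda>z. z k) = \<nu>" for k
    by (rule distr_PiM_component) (auto intro: prob_space_axioms)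
  then have "Q.indep_vars (\<lambda>_. \<nu>) (\<lambda>k z. z k) UNIV"
    by (subst Q.indep_vars_iff_distr_eq_PiM) (simp_all add: coord restrict_UNIV)
  then have ind: "Q.indep_var (Pi\<^sub>M ({True} \<times> UNIV) (\<lambda>_. \<nu>)) (\<lambda>z. restrict (\<lambda>k. z k) ({True} \<times> UNIV))
      (Pi\<^sub>M ({False} \<times> UNIV) (\<lambda>_. \<nu>)) (\<lambda>z. restrict (\<lambda>k. z k) ({False} \<times> UNIV))"
    by (intro Q.indep_var_restrict[where X = "\<lambda>k z. z k" and I = UNIV]) blast+
  have re: "(\<lambda>z i. z (b, i)) \<in> measurable (Pi\<^sub>M ({b} \<times> UNIV) (\<lambda>_. \<nu>)) P" for b
  proof (rule measurable_to_P)
    show "(\<lambda>w. w (b, i)) \<in> borel_measurable (Pi\<^sub>M ({b} \<times> UNIV) (\<lambda>_. \<nu>))" for i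
      using measurable_component_singleton[of "(b, i)" "{b} \<times> UNIV" "\<lambda>_. \<nu>"] by simp
  qed
  have ind2: "Q.indep_var P (\<lambda>z i. z (True, i)) P (\<lambda>z i. z (False, i))"
    using Q.indep_var_compose[OF ind re re] by (simp add: comp_def)
  have law: "distr ?Q P (\<lambda>z i. z (b, i)) = P" for b
    using distr_PiM_reindex[of UNIV "\<lambda>_. \<nu>" "\<lambda>i. (b, i)" UNIV] prob_space_axioms
    by (simp add: inj_on_def restrict_UNIV)
  define \<Theta> :: "(bool \<times> 'i \<Rightarrow> real) \<Rightarrow> ('i \<Rightarrow> real) \<times> ('i \<Rightarrow> real)"
    where "\<Theta> z = (\<lambda>i. z (True, i), \<lambda>i. z (False, i))" for z
  have \<Theta>_law: "distr ?Q PP \<Theta> = PP"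
    using ind2 by (simp add: Q.indep_var_distribution_eq law \<Theta>_def[abs_def])
  have \<Theta>_meas: "\<Theta> \<in> measurable ?Q PP"
    unfolding \<Theta>_def[abs_def] by (intro measurable_Pair measurable_to_P) (use coord in auto)
  \<comment> \<open>The permutation of the joint index set that flips the copy at the sites in \<open>A\<close>.\<close>
  define r :: "bool \<times> 'i \<Rightarrow> bool \<times> 'i" where "r k = (fst k \<noteq> (snd k \<in> A), snd k)" for k
  have "inj r"
    by (auto simp: inj_on_def r_def)
  then have r_law: "distr ?Q ?Q (\<lambda>z k. z (r k)) = ?Q"
    using distr_PiM_reindex[of UNIV "\<lambda>_. \<nu>" r UNIV] prob_space_axioms by (simp add: restrict_UNIV)
  have r_meas: "(\<lambda>z k. z (r k)) \<in> measurable ?Q ?Q"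
    by (rule measurable_PiM_single') (auto simp: coord space_PiM)
  define \<sigma> where "\<sigma> w = (override_on (fst w) (snd w) A, override_on (snd w) (fst w) A)"
    for w :: "('i \<Rightarrow> real) \<times> ('i \<Rightarrow> real)"
  have \<sigma>_meas: "\<sigma> \<in> measurable PP PP"
    unfolding \<sigma>_def[abs_def] by (intro measurable_Pair measurable_override_on measurable_fst measurable_snd)
  have "distr PP PP \<sigma> = distr ?Q PP (\<sigma> \<circ> \<Theta>)"
    using distr_distr[OF \<sigma>_meas \<Theta>_meas] unfolding \<Theta>_law .
  also have "\<sigma> \<circ> \<Theta> = \<Theta> \<circ> (\<lambda>z k. z (r k))"
    by (auto simp: fun_eq_iff \<sigma>_def \<Theta>_def r_def override_on_def)
  also have "distr ?Q PP (\<Theta> \<circ> (\<lambda>z k. z (r k))) = PP"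
    using distr_distr[OF \<Theta>_meas r_meas] unfolding r_law \<Theta>_law by (rule sym)
  finally show ?thesis
    by (simp add: \<sigma>_def[abs_def])
qed

lemma distr_fst_PP: "distr PP P fst = P"
  by (rule P.distr_pair_fst)

lemma distr_override_on: "distr PP P (\<lambda>w. override_on (fst w) (snd w) A) = P"
proof -
  have "distr PP P (fst \<circ> (\<lambda>w. (override_on (fst w) (snd w) A, override_on (snd w) (fst w) A)))
      = distr (distr PP PP (\<lambda>w. (override_on (fst w) (snd w) A, override_on (snd w) (fst w) A))) P fst"
    by (intro distr_distr[symmetric] measurable_fst measurable_Pair measurable_override_on measurable_snd)
  then show ?thesis
    by (simp add: distr_swap distr_fst_PP comp_def)
qed

abbreviation mixed :: "(('i \<Rightarrow> real) \<Rightarrow> 'c) \<Rightarrow> 'i set \<Rightarrow> ('i \<Rightarrow> real) \<times> ('i \<Rightarrow> real) \<Rightarrow> 'c" where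
  "mixed f A \<equiv> (\<lambda>w. f (override_on (fst w) (snd w) A))"

abbreviation change :: "(('i \<Rightarrow> real) \<Rightarrow> real) \<Rightarrow> 'i set \<Rightarrow> ('i \<Rightarrow> real) \<times> ('i \<Rightarrow> real) \<Rightarrow> real" where
  "change f A \<equiv> (\<lambda>w. mixed f {} w - mixed f A w)"

definition influence :: "(('i \<Rightarrow> real) \<Rightarrow> real) \<Rightarrow> 'i \<Rightarrow> real" where
  "influence f i = l2norm PP (change f {i})"

lemma influence_nonneg: "0 \<le> influence f i"
  by (simp add: influence_def l2norm_nonneg)

lemma measurable_override_on_PP: "(\<lambda>w. override_on (fst w) (snd w) A) \<in> measurable PP P"
  by (intro measurable_override_on measurable_fst measurable_snd)

lemma measurable_mixed: "f \<in> measurable P N \<Longrightarrow> mixed f A \<in> measurable PP N"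
  using measurable_compose[OF measurable_override_on_PP] .

lemma integrable_mixed:
  fixes f :: "('i \<Rightarrow> real) \<Rightarrow> 'c::{banach, second_countable_topology}"
  shows "integrable P f \<Longrightarrow> integrable PP (mixed f A)"
  by (rule integrable_distr[OF measurable_override_on_PP]) (simp add: distr_override_on)

lemma integral_mixed:
  fixes f :: "('i \<Rightarrow> real) \<Rightarrow> 'c::{banach, second_countable_topology}"
  assumes "f \<in> borel_measurable P"
  shows "(\<integral>w. mixed f A w \<partial>PP) = (\<integral>x. f x \<partial>P)"
  using integral_distr[OF measurable_override_on_PP, of f A] assms by (simp add: distr_override_on)

lemma sqint_mixed: "sqint P f \<Longrightarrow> sqint PP (mixed f A)"
  by (rule sqint_distr[OF measurable_override_on_PP _ distr_override_on])

lemma l2norm_mixed: "f \<in> borel_measurable P \<Longrightarrow> l2norm PP (mixed f A) = l2norm P f"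
  by (rule l2norm_distr[OF measurable_override_on_PP _ distr_override_on])

section \<open>Approximation by finitely many coordinates\<close>

abbreviation deviation :: "(('i \<Rightarrow> real) \<Rightarrow> real) \<Rightarrow> 'i set \<Rightarrow> real" where
  "deviation f K \<equiv> (\<integral>w. \<bar>change f (- K) w\<bar> \<partial>PP)"

text \<open>A way to say that \<open>f\<close> is nearly a function of finitely many coordinates without naming such
a function.\<close>

definition finitely_approximable :: "(('i \<Rightarrow> real) \<Rightarrow> real) \<Rightarrow> bool" where
  "finitely_approximable f \<longleftrightarrow>
     (\<forall>e>0. \<exists>J. finite J \<and> (\<forall>K. J \<subseteq> K \<longrightarrow> deviation f K < e))"

lemma finitely_approximable_add:
  assumes f: "integrable P f" "finitely_approximable f"
    and g: "integrable P g" "finitely_approximable g"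
  shows "finitely_approximable (\<lambda>x. f x + g x)"
  unfolding finitely_approximable_def
proof (intro allI impI)
  fix e :: real assume "0 < e"
  then have "0 < e / 2" by simp
  with f g obtain J1 J2 where
    J1: "finite J1" "\<And>K. J1 \<subseteq> K \<Longrightarrow> deviation f K < e / 2" and
    J2: "finite J2" "\<And>K. J2 \<subseteq> K \<Longrightarrow> deviation g K < e / 2"
    unfolding finitely_approximable_def by meson
  show "\<exists>J. finite J \<and> (\<forall>K. J \<subseteq> K \<longrightarrow>
      deviation (\<lambda>x. f x + g x) K < e)"
  proof (intro exI[of _ "J1 \<union> J2"] conjI allI impI)
    fix K assume K: "J1 \<union> J2 \<subseteq> K"
    note int = integrable_mixed[OF f(1)] integrable_mixed[OF g(1)]
    have "deviation (\<lambda>x. f x + g x) K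
        \<le> (\<integral>w. \<bar>change f (- K) w\<bar> + \<bar>change g (- K) w\<bar> \<partial>PP)"
      by (intro integral_mono Bochner_Integration.integrable_add integrable_abs Bochner_Integration.integrable_diff int) linarith
    also have "\<dots> = deviation f K
        + deviation g K"
      by (intro Bochner_Integration.integral_add integrable_abs Bochner_Integration.integrable_diff int)
    also have "\<dots> < e"
      using J1(2)[of K] J2(2)[of K] K by auto
    finally show "deviation (\<lambda>x. f x + g x) K < e" .
  qed (use J1 J2 in auto)
qed

lemma finitely_approximable_scale:
  assumes "finitely_approximable f"
  shows "finitely_approximable (\<lambda>x. f x * c)"
  unfolding finitely_approximable_def
proof (intro allI impI)
  fix e :: real assume "0 < e"
  then have "0 < e / (\<bar>c\<bar> + 1)" by simp
  with assms obtain J where J: "finite J"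
    "\<And>K. J \<subseteq> K \<Longrightarrow> deviation f K < e / (\<bar>c\<bar> + 1)"
    unfolding finitely_approximable_def by meson
  have "deviation (\<lambda>x. f x * c) K < e" if "J \<subseteq> K" for K
  proof -
    have "deviation (\<lambda>x. f x * c) K
        = deviation f K * \<bar>c\<bar>"
      by (simp add: left_diff_distrib[symmetric] abs_mult)
    also have "\<dots> \<le> deviation f K * (\<bar>c\<bar> + 1)"
      by (intro mult_left_mono) auto
    also have "\<dots> < e"
      using J(2)[OF that] by (simp add: pos_less_divide_eq add_nonneg_pos)
    finally show ?thesis .
  qed
  then show "\<exists>J. finite J \<and> (\<forall>K. J \<subseteq> K \<longrightarrow>
      deviation (\<lambda>x. f x * c) K < e)"
    using J(1) by blast
qed

text \<open>An \<open>\<epsilon>/3\<close> argument: the resampled noise has the same law, so replacing \<open>f\<close> by \<open>s n\<close> costs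
\<open>\<integral>\<bar>f - s n\<bar>\<close> twice, whatever the set of resampled coordinates.\<close>

lemma finitely_approximable_dominated_limit:
  assumes s: "\<And>n::nat. integrable P (s n)" "\<And>n. finitely_approximable (s n)"
    and f: "f \<in> borel_measurable P" "\<And>x. (\<lambda>n. s n x) \<longlonglongrightarrow> f x"
    and h: "integrable P h" "\<And>n x. \<bar>s n x\<bar> \<le> h x"
  shows "integrable P f" "finitely_approximable f"
proof -
  show f_int: "integrable P f"
    by (rule integrable_dominated_convergence[OF _ _ h(1), where s = s])
       (use s f h in \<open>auto intro!: AE_I2\<close>)
  have "(\<lambda>n. \<integral>x. \<bar>f x - s n x\<bar> \<partial>P) \<longlonglongrightarrow> (\<integral>x. 0 \<partial>P)"
  proof (rule integral_dominated_convergence)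
    show "integrable P (\<lambda>x. 2 * h x)"
      using h by simp
    have "(\<lambda>n. \<bar>f x - s n x\<bar>) \<longlonglongrightarrow> \<bar>f x - f x\<bar>" for x
      by (intro tendsto_intros f)
    then show "AE x in P. (\<lambda>n. \<bar>f x - s n x\<bar>) \<longlonglongrightarrow> 0"
      by simp
    have f_le: "\<bar>f x\<bar> \<le> h x" for x
      by (rule Lim_bounded[OF tendsto_rabs[OF f(2)]]) (use h(2) in auto)
    have "\<bar>f x - s n x\<bar> \<le> 2 * h x" for n x
      proof -
      have "\<bar>f x - s n x\<bar> \<le> \<bar>f x\<bar> + \<bar>s n x\<bar>"
        by (rule abs_triangle_ineq4)
      with h(2)[of n x] f_le[of x] show ?thesis by linarith
    qed
    then show "AE x in P. norm \<bar>f x - s n x\<bar> \<le> 2 * h x" for n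
      by simp
    show "(\<lambda>x. \<bar>f x - s n x\<bar>) \<in> borel_measurable P" for n
      using f(1) s(1)[of n] by auto
  qed simp
  then have lim: "(\<lambda>n. \<integral>x. \<bar>f x - s n x\<bar> \<partial>P) \<longlonglongrightarrow> 0"
    by simp
  show "finitely_approximable f"
    unfolding finitely_approximable_def
  proof (intro allI impI)
    fix e :: real assume "0 < e"
    then have e3: "0 < e / 3" by simp
    then obtain n where n: "\<bar>\<integral>x. \<bar>f x - s n x\<bar> \<partial>P\<bar> < e / 3"
      using LIMSEQ_D[OF lim e3] by auto
    obtain J where J: "finite J"
      "\<And>K. J \<subseteq> K \<Longrightarrow> deviation (s n) K < e / 3"
      using s(2)[of n] e3 unfolding finitely_approximable_def by meson
    let ?g = "\<lambda>x. \<bar>f x - s n x\<bar>"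
    have g_int: "integrable P ?g"
      using f_int s(1) by auto
    have "deviation f K < e" if "J \<subseteq> K" for K
    proof -
      note int = integrable_mixed[OF f_int] integrable_mixed[OF s(1)] integrable_mixed[OF g_int]
      have "deviation f K
          \<le> (\<integral>w. mixed ?g {} w + mixed ?g (- K) w + \<bar>change (s n) (- K) w\<bar> \<partial>PP)"
        by (intro integral_mono Bochner_Integration.integrable_add integrable_abs Bochner_Integration.integrable_diff int) linarith
      also have "\<dots> = (\<integral>w. mixed ?g {} w \<partial>PP) + (\<integral>w. mixed ?g (- K) w \<partial>PP)
          + deviation (s n) K"
        by (subst Bochner_Integration.integral_add
            | intro Bochner_Integration.integrable_add integrable_abs Bochner_Integration.integrable_diff int refl)+
      also have "\<dots> = 2 * (\<integral>x. ?g x \<partial>P) + deviation (s n) K"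
        using integral_mixed[of ?g "{}"] integral_mixed[of ?g "- K"] borel_measurable_integrable[OF g_int]
        by simp
      also have "\<dots> < e"
        using J(2)[OF that] n by linarith
      finally show ?thesis .
    qed
    then show "\<exists>J. finite J \<and> (\<forall>K. J \<subseteq> K \<longrightarrow> deviation f K < e)"
      using J(1) by blast
  qed
qed

text \<open>Dynkin's lemma on the cylinder sets, for which resampling outside the base of the cylinder
changes nothing at all. The limit lemma handles countable disjoint unions.\<close>

lemma finitely_approximable_indicator:
  assumes "B \<in> sets P"
  shows "finitely_approximable (indicator B)"
proof -
  note generator = Int_stable_prod_algebra[of UNIV "\<lambda>_::'i. \<nu>"]
    prod_algebra_sets_into_space[of UNIV "\<lambda>_::'i. \<nu>"]
  have "B \<in> sigma_sets (\<Pi>\<^sub>E i\<in>UNIV. space \<nu>) (prod_algebra UNIV (\<lambda>_::'i. \<nu>))"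
    using assms by (simp add: sets_PiM)
  with generator have "B \<in> sets P \<and> finitely_approximable (indicator B)"
  proof (induction rule: sigma_sets_induct_disjoint)
    case (basic B)
    then obtain J E where B: "B = prod_emb UNIV (\<lambda>_::'i. \<nu>) J (Pi\<^sub>E J E)" and "finite J"
      by (force elim!: prod_algebraE)
    have "mixed (indicator B :: _ \<Rightarrow> real) {} w = mixed (indicator B) (- K) w" if "J \<subseteq> K" for K w
      using that by (auto simp: B prod_emb_def indicator_def override_on_def space_PiM PiE_iff)
    then have "finitely_approximable (indicator B)"
      unfolding finitely_approximable_def using \<open>finite J\<close> by (intro allI impI exI[of _ J]) auto
    moreover have "B \<in> sets P"
      using basic by (simp add: sets_PiM)
    ultimately show ?case by simp
  next
    case empty
    have "finitely_approximable (\<lambda>_. 0)"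
      by (auto simp: finitely_approximable_def intro!: exI[of _ "{}"])
    then show ?case by simp
  next
    case (compl B)
    have "\<bar>change (indicator (UNIV - B)) (- K) w\<bar>
        = \<bar>change (indicator B) (- K) w :: real\<bar>" for K w
      by (auto simp: indicator_def)
    with compl show ?case
      using sets.compl_sets[of B P] by (simp add: finitely_approximable_def space_P)
  next
    case (union B)
    define U where "U n = (\<Union>i<n. B i)" for n :: nat
    have U: "U n \<in> sets P \<and> finitely_approximable (indicator (U n))" for n
    proof (induction n)
      case 0
      show ?case
        by (auto simp: U_def finitely_approximable_def intro!: exI[of _ "{}"])
    next
      case (Suc n)
      have "B m \<inter> B n = {}" if "m < n" for m
        by (rule disjoint_family_onD[OF union(1)]) (use that in auto)
      then have "U n \<inter> B n = {}"
        unfolding U_def by blast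
      then have "indicator (U (Suc n)) = (\<lambda>x. indicator (U n) x + indicator (B n) x :: real)"
        by (auto simp: fun_eq_iff U_def lessThan_Suc indicator_def)
      moreover have "integrable P (indicator (U n) :: _ \<Rightarrow> real)" "integrable P (indicator (B n) :: _ \<Rightarrow> real)"
        using Suc union(3)[of n] by (auto intro!: integrable_real_indicator simp: P.emeasure_eq_measure)
      ultimately show ?case
        using finitely_approximable_add[of "indicator (U n)" "indicator (B n)"] Suc union(3)
        by (auto simp: U_def lessThan_Suc)
    qed
    have "finitely_approximable (indicator (\<Union>i. B i))"
    proof (rule finitely_approximable_dominated_limit(2)[where s = "\<lambda>n. indicator (U n)" and h = "\<lambda>_. 1"])
      show "(\<lambda>n. indicator (U n) x) \<longlonglongrightarrow> (indicator (\<Union>i. B i) x :: real)" for x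
      proof -
        have "incseq U"
          by (auto simp: incseq_def U_def intro: less_le_trans)
        moreover have "(\<Union>n. U n) = (\<Union>i. B i)"
          by (auto simp: U_def)
        ultimately show ?thesis
          using LIMSEQ_indicator_incseq[of U x] by simp
      qed
      show "indicator (\<Union>i. B i) \<in> borel_measurable P"
        using union(3) by (intro borel_measurable_indicator) auto
      show "integrable P (indicator (U n) :: _ \<Rightarrow> real)" for n
        using U[of n] by (auto intro!: integrable_real_indicator simp: P.emeasure_eq_measure)
    qed (use U in \<open>auto simp: indicator_def\<close>)
    then show ?case
      using union(3) by auto
  qed
  then show ?thesis by simp
qed

lemma finitely_approximable_integrable:
  fixes f :: "('i \<Rightarrow> real) \<Rightarrow> real"
  assumes "integrable P f"
  shows "finitely_approximable f"
  using assms
proof (induction rule: integrable_induct)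
  case (base A c)
  then show ?case
    using finitely_approximable_scale[OF finitely_approximable_indicator[of A], of c] by simp
next
  case (add f g)
  then show ?case by (intro finitely_approximable_add)
next
  case (lim f s)
  show ?case
    by (rule finitely_approximable_dominated_limit(2)[where s = s and h = "\<lambda>x. 2 * \<bar>f x\<bar>"])
       (use lim in \<open>auto simp: space_P\<close>)
qed

text \<open>Truncation turns the \<open>L\<^sup>1\<close> approximation into one in \<open>L\<^sup>2\<close>: for a function bounded by \<open>n\<close>, the
square of a difference is at most \<open>2 * n\<close> times its absolute value.\<close>

lemma finitely_approximable_l2norm:
  assumes f: "sqint P f" and "0 < e"
  shows "\<exists>J. finite J \<and> (\<forall>K. J \<subseteq> K \<longrightarrow> l2norm PP (change f (- K)) < e)"
proof -
  have "0 < e / 3"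
    using \<open>0 < e\<close> by simp
  then obtain n where n: "\<bar>l2norm P (\<lambda>x. f x - truncate (real n) (f x))\<bar> < e / 3"
    using LIMSEQ_D[OF truncate_tendsto_l2norm[OF f], of "e / 3"] by auto
  define g where "g x = truncate (real n) (f x)" for x
  have g: "sqint P g"
    unfolding g_def by (intro sqint_truncate f) simp
  have fg: "sqint P (\<lambda>x. f x - g x)"
    by (rule sqint_diff[OF f g])
  have "0 < (e / 3)\<^sup>2 / (2 * real n + 1)"
    using \<open>0 < e\<close> by simp
  then obtain J where J: "finite J" and small: "\<And>K. J \<subseteq> K \<Longrightarrow>
      deviation g K < (e / 3)\<^sup>2 / (2 * real n + 1)"
    using finitely_approximable_integrable[OF P.sqint_integrable[OF g]]
    unfolding finitely_approximable_def by meson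
  have "l2norm PP (change f (- K)) < e" if K: "J \<subseteq> K" for K
  proof -
    note int = integrable_mixed[OF P.sqint_integrable[OF g]]
    have int': "integrable PP (\<lambda>w. \<bar>change g (- K) w\<bar>)"
      by (intro integrable_abs Bochner_Integration.integrable_diff int)
    have gg: "sqint PP (change g (- K))"
      by (intro sqint_diff sqint_mixed g)
    have "(l2norm PP (change g (- K)))\<^sup>2
        \<le> (\<integral>w. (2 * real n + 1) * \<bar>change g (- K) w\<bar> \<partial>PP)"
      unfolding l2norm_power2
    proof (rule integral_mono)
      fix w
      have "\<bar>change g (- K) w\<bar> \<le> 2 * real n + 1"
        using truncate_bound[of "real n" "mixed f {} w"] truncate_bound[of "real n" "mixed f (- K) w"]
        unfolding g_def by linarith
      then have "\<bar>change g (- K) w\<bar> * \<bar>change g (- K) w\<bar>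
          \<le> (2 * real n + 1) * \<bar>change g (- K) w\<bar>"
        by (intro mult_right_mono) auto
      then show "(change g (- K) w)\<^sup>2
          \<le> (2 * real n + 1) * \<bar>change g (- K) w\<bar>"
        by (simp add: power2_eq_square flip: abs_mult)
    qed (use gg int' in \<open>auto simp: sqint_def\<close>)
    also have "\<dots> = (2 * real n + 1) * deviation g K"
      by simp
    also have "\<dots> < (e / 3)\<^sup>2"
      using small[OF K] by (simp add: pos_less_divide_eq mult.commute)
    finally have "l2norm PP (change g (- K)) < e / 3"
      by (rule power2_less_imp_less) (use \<open>0 < e\<close> in simp)
    moreover have "l2norm PP (\<lambda>w. (change (\<lambda>x. f x - g x) (- K) w)
          + (change g (- K) w))
        \<le> l2norm PP (change (\<lambda>x. f x - g x) (- K))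
          + l2norm PP (change g (- K))"
      by (intro l2norm_triangle gg sqint_diff[OF sqint_mixed[OF fg] sqint_mixed[OF fg]])
    moreover have "l2norm PP (change (\<lambda>x. f x - g x) (- K))
        \<le> l2norm P (\<lambda>x. f x - g x) + l2norm P (\<lambda>x. f x - g x)"
      using l2norm_triangle_diff[OF sqint_mixed[OF fg] sqint_mixed[OF fg], of "{}" "- K"]
        l2norm_mixed[OF sqint_measurable[OF fg], of "{}"] l2norm_mixed[OF sqint_measurable[OF fg], of "- K"]
      by simp
    ultimately show ?thesis
      using n by (simp add: g_def)
  qed
  with J show ?thesis by blast
qed

section \<open>The Efron--Stein inequality\<close>

lemma measurable_swap:
  "(\<lambda>w. (override_on (fst w) (snd w) A, override_on (snd w) (fst w) A)) \<in> measurable PP PP"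
  by (intro measurable_Pair measurable_override_on measurable_fst measurable_snd)

lemma integral_swap:
  fixes h :: "_ \<Rightarrow> real"
  assumes "h \<in> borel_measurable PP"
  shows "(\<integral>w. h w \<partial>PP)
    = (\<integral>w. h (override_on (fst w) (snd w) A, override_on (snd w) (fst w) A) \<partial>PP)"
  using integral_distr[OF measurable_swap, of h A] assms by (simp add: distr_swap)

lemma l2norm_swap:
  assumes "h \<in> borel_measurable PP"
  shows "l2norm PP (\<lambda>w. h (override_on (fst w) (snd w) A, override_on (snd w) (fst w) A))
    = l2norm PP h"
  by (rule l2norm_distr[OF measurable_swap assms distr_swap])

text \<open>With \<open>c A = E (f x * f (x resampled on A))\<close> the left-hand side is \<open>2 * (c {} - c A)\<close>. Passing
from \<open>A\<close> to \<open>insert i A\<close> and symmetrising over the exchange of the two copies at \<open>i\<close> writes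
\<open>2 * (c A - c (insert i A))\<close> as a product moment of two differences, each of \<open>L\<^sup>2\<close> norm
\<open>influence f i\<close>; Cauchy--Schwarz bounds it.\<close>

lemma l2norm_resample_le_influences:
  assumes f: "sqint P f" and "finite A"
  shows "(l2norm PP (change f A))\<^sup>2 \<le> (\<Sum>i\<in>A. (influence f i)\<^sup>2)"
proof -
  define c where "c A = (\<integral>w. mixed f {} w * mixed f A w \<partial>PP)" for A
  note int = sqint_integrable_mult[OF sqint_mixed[OF f] sqint_mixed[OF f]]
  have square: "(\<integral>w. mixed f B w * mixed f B w \<partial>PP) = (l2norm P f)\<^sup>2" for B
    using l2norm_mixed[OF sqint_measurable[OF f], of B, THEN arg_cong[where f = "\<lambda>x. x\<^sup>2"]]
    unfolding l2norm_power2 by (simp add: power2_eq_square)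
  have expand: "(l2norm PP (change f A))\<^sup>2 = 2 * ((l2norm P f)\<^sup>2 - c A)" for A
  proof -
    have "(l2norm PP (change f A))\<^sup>2
        = (\<integral>w. mixed f {} w * mixed f {} w + mixed f A w * mixed f A w
             - 2 * (mixed f {} w * mixed f A w) \<partial>PP)"
      unfolding l2norm_power2 by (simp add: power2_eq_square algebra_simps)
    also have "\<dots> = (\<integral>w. mixed f {} w * mixed f {} w \<partial>PP) + (\<integral>w. mixed f A w * mixed f A w \<partial>PP) - 2 * c A"
      unfolding c_def
      using int[of "{}" "{}"] int[of "{}" A] int[of A A] by simp
    also have "\<dots> = (l2norm P f)\<^sup>2 + (l2norm P f)\<^sup>2 - 2 * c A"
      unfolding square ..
    finally show ?thesis by simp
  qed
  have step: "2 * (c A - c (insert i A)) \<le> (influence f i)\<^sup>2" if "i \<notin> A" for A i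
  proof -
    let ?d = "\<lambda>w. mixed f A w - mixed f (insert i A) w"
    have d: "sqint PP ?d"
      by (intro sqint_diff sqint_mixed f)
    have d': "sqint PP (change f {i})"
      by (intro sqint_diff sqint_mixed f)
    note fd = sqint_integrable_mult[OF sqint_mixed[OF f] d]
    have "c A - c (insert i A) = (\<integral>w. mixed f {} w * ?d w \<partial>PP)"
      unfolding c_def right_diff_distrib by (rule Bochner_Integration.integral_diff[symmetric]) (rule int)+
    moreover have "(\<integral>w. mixed f {} w * ?d w \<partial>PP) = (\<integral>w. - (mixed f {i} w * ?d w) \<partial>PP)"
    proof (subst integral_swap[where A = "{i}"])
      show "(\<lambda>w. mixed f {} w * ?d w) \<in> borel_measurable PP"
        using fd by (rule borel_measurable_integrable)
      have "override_on (override_on x y {i}) (override_on y x {i}) A = override_on x y (insert i A)"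
        "override_on (override_on x y {i}) (override_on y x {i}) (insert i A) = override_on x y A"
        for x y :: "'i \<Rightarrow> real"
        using that by (auto simp: override_on_def fun_eq_iff)
      then show "(\<integral>w. mixed f {} (override_on (fst w) (snd w) {i}, override_on (snd w) (fst w) {i})
            * ?d (override_on (fst w) (snd w) {i}, override_on (snd w) (fst w) {i}) \<partial>PP)
          = (\<integral>w. - (mixed f {i} w * ?d w) \<partial>PP)"
        by (simp add: algebra_simps)
    qed
    ultimately have "2 * (c A - c (insert i A))
        = (\<integral>w. mixed f {} w * ?d w \<partial>PP) + (\<integral>w. - (mixed f {i} w * ?d w) \<partial>PP)"
      by simp
    also have "\<dots> = (\<integral>w. mixed f {} w * ?d w + - (mixed f {i} w * ?d w) \<partial>PP)"
      by (intro Bochner_Integration.integral_add[symmetric] integrable_minus fd)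
    also have "\<dots> = (\<integral>w. (change f {i} w) * ?d w \<partial>PP)"
      by (simp add: algebra_simps)
    also have "\<dots> \<le> influence f i * l2norm PP ?d"
      using l2norm_Cauchy_Schwarz[OF d' d] unfolding influence_def by linarith
    also have "l2norm PP ?d = influence f i"
    proof -
      have "override_on (override_on x y A) (override_on y x A) {i} = override_on x y (insert i A)"
        for x y :: "'i \<Rightarrow> real"
        using that by (auto simp: override_on_def fun_eq_iff)
      then show ?thesis
        using l2norm_swap[OF sqint_measurable[OF d'], of A] by (simp add: influence_def)
    qed
    finally show ?thesis
      by (simp add: power2_eq_square)
  qed
  from \<open>finite A\<close> show ?thesis
  proof (induction A rule: finite_induct)
    case empty
    then show ?case by (simp add: l2norm_def)
  next
    case (insert i A)
    then show ?case
      using step[of i A] unfolding expand by simp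
  qed
qed

text \<open>For a centred \<open>f\<close>, replacing the whole noise by an independent copy changes \<open>f\<close> by
\<open>2 \<parallel>f\<parallel>\<^sup>2\<close> in mean square; up to a small error it suffices to replace finitely many
coordinates.\<close>

lemma Efron_Stein:
  assumes f: "sqint P f" and mean: "P.expectation f = 0"
    and B: "\<And>A. finite A \<Longrightarrow> (\<Sum>i\<in>A. (influence f i)\<^sup>2) \<le> B"
  shows "2 * (l2norm P f)\<^sup>2 \<le> B"
proof -
  have B0: "0 \<le> B"
    using B[of "{}"] by simp
  have meas: "f \<in> borel_measurable P"
    using f by (rule sqint_measurable)
  note F = sqint_mixed[OF f]
  have "(\<integral>w. mixed f {} w * mixed f UNIV w \<partial>PP) = (\<integral>x. (\<integral>y. f x * f y \<partial>P) \<partial>P)"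
    using PP.integral_fst'[OF sqint_integrable_mult[OF F F, of "{}" UNIV]]
    by (simp add: override_on_def)
  also have "\<dots> = 0"
    by (simp add: mean)
  finally have "(l2norm PP (change f UNIV))\<^sup>2
      = (\<integral>w. (mixed f {} w)\<^sup>2 + (mixed f UNIV w)\<^sup>2 \<partial>PP)"
    using sqint_integrable_mult[OF F F, of "{}" UNIV] F[of "{}"] F[of UNIV]
    unfolding l2norm_power2 power2_diff by (simp add: sqint_def mult.assoc)
  also have "\<dots> = (l2norm PP (mixed f {}))\<^sup>2 + (l2norm PP (mixed f UNIV))\<^sup>2"
    using F[of "{}"] F[of UNIV] unfolding l2norm_power2 by (simp add: sqint_def)
  also have "\<dots> = 2 * (l2norm P f)\<^sup>2"
    by (simp only: l2norm_mixed[OF meas])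
  finally have eq: "(l2norm PP (change f UNIV))\<^sup>2 = 2 * (l2norm P f)\<^sup>2" .
  have "l2norm PP (change f UNIV) \<le> sqrt B + e" if "0 < e" for e
  proof -
    obtain J where J: "finite J" "l2norm PP (change f (- J)) < e"
      using finitely_approximable_l2norm[OF f \<open>0 < e\<close>] by blast
    have "l2norm PP (\<lambda>w. (change f J w) + (mixed f J w - mixed f UNIV w))
        \<le> l2norm PP (change f J) + l2norm PP (\<lambda>w. mixed f J w - mixed f UNIV w)"
      by (intro l2norm_triangle sqint_diff F)
    moreover have "l2norm PP (change f J) \<le> sqrt B"
      by (rule real_le_rsqrt) (use l2norm_resample_le_influences[OF f J(1)] B[OF J(1)] in linarith)
    moreover have "l2norm PP (\<lambda>w. mixed f J w - mixed f UNIV w) < e"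
    proof -
      let ?k = "\<lambda>w. mixed f (- J) w - mixed f {} w"
      have "override_on y x (- J) = override_on x y J" for x y :: "'i \<Rightarrow> real"
        by (auto simp: override_on_def fun_eq_iff)
      moreover have "override_on x y UNIV = y" for x y :: "'i \<Rightarrow> real"
        by (simp add: override_on_def)
      ultimately have "(\<lambda>w. mixed f J w - mixed f UNIV w)
          = (\<lambda>w. ?k (override_on (fst w) (snd w) UNIV, override_on (snd w) (fst w) UNIV))"
        by simp
      then have "l2norm PP (\<lambda>w. mixed f J w - mixed f UNIV w) = l2norm PP ?k"
        by (simp only: l2norm_swap[OF sqint_measurable[OF sqint_diff[OF F F]]])
      then show ?thesis
        using J(2) l2norm_minus_commute[of PP "mixed f {}" "mixed f (- J)"] by simp
    qed
    ultimately show ?thesis by simp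
  qed
  then have "l2norm PP (change f UNIV) \<le> sqrt B"
    by (rule field_le_epsilon)
  then have "(l2norm PP (change f UNIV))\<^sup>2 \<le> (sqrt B)\<^sup>2"
    by (intro power_mono l2norm_nonneg)
  then show ?thesis
    unfolding eq using B0 by simp
qed

end

section \<open>Locally dependent bounded variables\<close>

lemma norm_iexp_minus_1: "norm (iexp r - 1) \<le> \<bar>r\<bar>"
  using iexp_approx1[of r 0] by simp

lemma norm_iexp_minus_linear: "norm (iexp r - 1 - \<i> * of_real r) \<le> r\<^sup>2 / 2"
proof -
  have "(\<Sum>k\<le>1. (\<i> * complex_of_real r) ^ k / fact k) = 1 + \<i> * of_real r"
    by simp
  then show ?thesis
    using iexp_approx1[of r 1] by (simp add: algebra_simps eval_nat_numeral)
qed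

lemma norm_iexp_diff: "norm (iexp r - iexp s) \<le> \<bar>r - s\<bar>"
proof -
  have "iexp r - iexp s = iexp s * (iexp (r - s) - 1)"
    by (simp add: algebra_simps exp_diff)
  then show ?thesis
    using norm_iexp_minus_1[of "r - s"] by (simp add: norm_mult)
qed

lemma (in prob_space) integrable_bounded:
  fixes f :: "'a \<Rightarrow> 'b::{banach, second_countable_topology}"
  assumes "f \<in> borel_measurable M" "\<And>x. x \<in> space M \<Longrightarrow> norm (f x) \<le> B"
  shows "integrable M f"
  using assms by (intro integrable_const_bound[where B = B]) auto

lemma (in prob_space) norm_expectation_bounded:
  fixes f :: "'a \<Rightarrow> 'b::{banach, second_countable_topology}"
  assumes "f \<in> borel_measurable M" "\<And>x. x \<in> space M \<Longrightarrow> norm (f x) \<le> B"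
  shows "norm (expectation f) \<le> B"
proof -
  have int: "integrable M f"
    by (rule integrable_bounded) (use assms in auto)
  have "norm (expectation f) \<le> expectation (\<lambda>x. norm (f x))"
    by (rule integral_norm_bound)
  also have "\<dots> \<le> expectation (\<lambda>_. B)"
    by (intro integral_mono integrable_norm int) (use assms in auto)
  finally show ?thesis
    by (simp add: prob_space)
qed

lemma (in prob_space) iexp_measurable:
  "S \<in> borel_measurable M \<Longrightarrow> (\<lambda>x. iexp (u * S x)) \<in> borel_measurable M"
  by measurable

text \<open>The quadratic remainder of \<open>iexp\<close> is integrable because \<open>S\<close> is bounded, and gives the derivative
of the characteristic function directly, without an interchange of limits.\<close>

lemma (in prob_space) iexp_has_vector_derivative:
  assumes S: "S \<in> borel_measurable M" "\<And>x. x \<in> space M \<Longrightarrow> \<bar>S x\<bar> \<le> B"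
  shows "((\<lambda>u. expectation (\<lambda>x. iexp (u * S x)))
    has_vector_derivative (\<i> * expectation (\<lambda>x. of_real (S x) * iexp (u * S x)))) (at u)"
proof -
  define \<phi> where "\<phi> u = expectation (\<lambda>x. iexp (u * S x))" for u
  define D where "D = \<i> * expectation (\<lambda>x. of_real (S x) * iexp (u * S x))"
  have int: "integrable M (\<lambda>x. iexp (v * S x))" for v
    by (rule integrable_bounded[where B = 1]) (use S(1) in auto)
  have int': "integrable M (\<lambda>x. of_real (S x) * iexp (u * S x))"
    by (rule integrable_bounded[where B = B]) (use S in \<open>auto simp: norm_mult\<close>)
  have B0: "0 \<le> B"
    using S(2) subprob_not_empty by (meson abs_ge_zero ex_in_conv order_trans)
  have approx: "norm (\<phi> v - \<phi> u - (v - u) *\<^sub>R D) \<le> (v - u)\<^sup>2 * B\<^sup>2" for v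
  proof -
    have "\<phi> v - \<phi> u - (v - u) *\<^sub>R D
        = expectation (\<lambda>x. iexp (v * S x) - iexp (u * S x)
            - of_real (v - u) * \<i> * (of_real (S x) * iexp (u * S x)))"
      unfolding \<phi>_def D_def scaleR_conv_of_real using int int' by simp
    also have "norm \<dots> \<le> (v - u)\<^sup>2 * B\<^sup>2"
    proof (rule norm_expectation_bounded)
      show "(\<lambda>x. iexp (v * S x) - iexp (u * S x)
          - of_real (v - u) * \<i> * (of_real (S x) * iexp (u * S x))) \<in> borel_measurable M"
        using S(1) by measurable
      fix x assume x: "x \<in> space M"
      have "iexp (v * S x) - iexp (u * S x) - of_real (v - u) * \<i> * (of_real (S x) * iexp (u * S x))
          = iexp (u * S x) * (iexp ((v - u) * S x) - 1 - \<i> * of_real ((v - u) * S x))"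
        by (simp add: algebra_simps exp_add[symmetric])
      then have "norm (iexp (v * S x) - iexp (u * S x)
          - of_real (v - u) * \<i> * (of_real (S x) * iexp (u * S x))) \<le> ((v - u) * S x)\<^sup>2 / 2"
        using norm_iexp_minus_linear[of "(v - u) * S x"] by (simp add: norm_mult)
      also have "\<dots> \<le> ((v - u) * S x)\<^sup>2"
        by simp
      also have "\<dots> \<le> (v - u)\<^sup>2 * B\<^sup>2"
        using power_mono[OF S(2)[OF x], of 2] by (simp add: power_mult_distrib mult_left_mono)
      finally show "norm (iexp (v * S x) - iexp (u * S x)
          - of_real (v - u) * \<i> * (of_real (S x) * iexp (u * S x))) \<le> (v - u)\<^sup>2 * B\<^sup>2" .
    qed
    finally show ?thesis .
  qed
  have "(\<phi> has_vector_derivative D) (at u)"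
    unfolding has_vector_derivative_def has_derivative_at_alt
  proof (intro conjI allI impI bounded_linear_scaleR_left)
    fix e :: real assume "0 < e"
    have "norm (\<phi> v - \<phi> u - (v - u) *\<^sub>R D) \<le> e * norm (v - u)"
      if "norm (v - u) < e / (B\<^sup>2 + 1)" for v
    proof -
      have "norm (v - u) * (B\<^sup>2 + 1) \<le> e"
        using that by (simp add: pos_less_divide_eq add_nonneg_pos)
      have "(v - u)\<^sup>2 * B\<^sup>2 \<le> (v - u)\<^sup>2 * (B\<^sup>2 + 1)"
        by (intro mult_left_mono) auto
      also have "\<dots> = norm (v - u) * (norm (v - u) * (B\<^sup>2 + 1))"
        using abs_mult_self_eq[of "v - u"] by (simp only: power2_eq_square real_norm_def flip: mult.assoc)
      also have "\<dots> \<le> norm (v - u) * e"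
        using \<open>norm (v - u) * (B\<^sup>2 + 1) \<le> e\<close> by (intro mult_left_mono) auto
      finally show ?thesis
        using approx[of v] by (simp add: mult.commute)
    qed
    moreover have "0 < e / (B\<^sup>2 + 1)"
      using \<open>0 < e\<close> by (simp add: add_nonneg_pos)
    ultimately show "\<exists>d>0. \<forall>v. norm (v - u) < d \<longrightarrow> norm (\<phi> v - \<phi> u - (v - u) *\<^sub>R D) \<le> e * norm (v - u)"
      by blast
  qed
  then show ?thesis
    by (simp add: \<phi>_def[abs_def] D_def)
qed

text \<open>Multiplying by the integrating factor \<open>exp (s * v\<^sup>2 / 2)\<close> leaves a function whose derivative is
at most \<open>\<eta> * u\<^sup>2 * exp (s * u\<^sup>2 / 2)\<close> between \<open>0\<close> and \<open>u\<close>; the mean value inequality does the rest.\<close>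

lemma exp_square_perturbation_bound:
  fixes \<phi> :: "real \<Rightarrow> complex"
  assumes der: "\<And>v. (\<phi> has_vector_derivative \<phi>' v) (at v)"
    and small: "\<And>v. norm (\<phi>' v + of_real (v * s) * \<phi> v) \<le> \<eta> * v\<^sup>2"
    and "\<phi> 0 = 1" "0 \<le> s"
  shows "norm (\<phi> u - of_real (exp (- s * u\<^sup>2 / 2))) \<le> \<eta> * \<bar>u\<bar> ^ 3"
proof -
  define E where "E v = exp (s * v\<^sup>2 / 2)" for v
  define \<psi> where "\<psi> v = E v *\<^sub>R \<phi> v" for v
  define \<psi>' where "\<psi>' v = E v *\<^sub>R (\<phi>' v + of_real (v * s) * \<phi> v)" for v
  have \<eta>: "0 \<le> \<eta>"
    using order_trans[OF norm_ge_zero small[of 1]] by simp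
  have E: "(E has_real_derivative v * s * E v) (at v)" for v
    unfolding E_def by (auto intro!: derivative_eq_intros)
  have "(\<psi> has_vector_derivative \<psi>' v) (at v)" for v
    unfolding \<psi>_def[abs_def] \<psi>'_def
    by (rule has_vector_derivative_eq_rhs[OF has_vector_derivative_scaleR[OF E der]])
       (simp add: scaleR_conv_of_real algebra_simps)
  then have "norm (\<psi> u - \<psi> 0) \<le> norm (u - 0) * (\<eta> * u\<^sup>2 * E u)"
  proof (intro differentiable_bound[where f' = "\<lambda>v h. h *\<^sub>R \<psi>' v" and S = "closed_segment 0 u", THEN order_trans])
    fix v assume v: "v \<in> closed_segment 0 u"
    show "(\<psi> has_derivative (\<lambda>h. h *\<^sub>R \<psi>' v)) (at v within closed_segment 0 u)"
      using \<open>\<And>v. (\<psi> has_vector_derivative \<psi>' v) (at v)\<close>[of v]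
      by (auto simp: has_vector_derivative_def intro: has_derivative_at_withinI)
    have "\<bar>v\<bar> \<le> \<bar>u\<bar>"
      using v by (auto simp: closed_segment_eq_real_ivl split: if_splits)
    then have v2: "v\<^sup>2 \<le> u\<^sup>2"
      by (simp add: abs_le_square_iff)
    have "E v \<le> E u"
      unfolding E_def using v2 \<open>0 \<le> s\<close> by (simp add: mult_left_mono)
    have "norm (\<psi>' v) \<le> E v * (\<eta> * v\<^sup>2)"
      unfolding \<psi>'_def using small[of v] by (simp add: E_def)
    also have "\<dots> \<le> E u * (\<eta> * u\<^sup>2)"
      using \<open>E v \<le> E u\<close> v2 \<eta> by (intro mult_mono mult_left_mono) (auto simp: E_def)
    finally have "norm (h *\<^sub>R \<psi>' v) \<le> (\<eta> * u\<^sup>2 * E u) * norm h" for h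
      by (simp add: mult.commute mult_left_mono)
    then show "onorm (\<lambda>h. h *\<^sub>R \<psi>' v) \<le> \<eta> * u\<^sup>2 * E u"
      by (intro onorm_le) simp
  qed (auto simp: mult.commute)
  then have "norm (\<psi> u - 1) \<le> \<bar>u\<bar> * (\<eta> * u\<^sup>2) * E u"
    using \<open>\<phi> 0 = 1\<close> by (simp add: \<psi>_def E_def mult.assoc)
  moreover have "\<phi> u - of_real (exp (- s * u\<^sup>2 / 2)) = (1 / E u) *\<^sub>R (\<psi> u - 1)"
  proof -
    have inv: "exp (- s * u\<^sup>2 / 2) = 1 / E u"
      by (simp add: E_def exp_minus inverse_eq_divide)
    have "E u \<noteq> 0"
      by (simp add: E_def)
    then show ?thesis
      unfolding inv \<psi>_def by (simp add: scaleR_diff_right scaleR_conv_of_real field_simps)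
  qed
  ultimately have "norm (\<phi> u - of_real (exp (- s * u\<^sup>2 / 2))) \<le> \<bar>u\<bar> * (\<eta> * u\<^sup>2)"
    by (simp add: E_def pos_divide_le_eq)
  then show ?thesis
    by (simp add: power2_eq_square power3_eq_cube algebra_simps)
qed

text \<open>A form of Stein's method in terms of characteristic functions. Here \<open>N1 t\<close> contains the indices
that \<open>X t\<close> depends on, and \<open>N2 t\<close> those that the product of \<open>X t\<close> with the sum over \<open>N1 t\<close> depends on;
the three independence statements are stated as moment identities, which is all that enters.
With \<open>R\<close> the sum over \<open>N1 t\<close>, \<open>S1 = S - R\<close> and \<open>S2\<close> the sum outside \<open>N2 t\<close>,
\<open>X t * iexp (v * S) \<approx> X t * iexp (v * S1) + \<i> * v * X t * R * iexp (v * S2)\<close>. The first term has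
mean zero, the second has mean \<open>\<i> * v * E (X t * R) * \<phi> v\<close> up to replacing \<open>S2\<close> by \<open>S\<close>, and the
\<open>E (X t * R)\<close> add up to the variance. Every error is a product of one variable and two
sums of at most \<open>L\<close> variables.\<close>

lemma (in prob_space) local_dependence_characteristic_function:
  fixes X :: "'t \<Rightarrow> 'a \<Rightarrow> real" and L b :: real
  assumes T: "finite T" and meas: "\<And>t. t \<in> T \<Longrightarrow> X t \<in> borel_measurable M"
    and bnd: "\<And>t x. t \<in> T \<Longrightarrow> x \<in> space M \<Longrightarrow> \<bar>X t x\<bar> \<le> b" and b: "0 \<le> b"
    and N: "\<And>t. t \<in> T \<Longrightarrow> N1 t \<subseteq> N2 t" "\<And>t. t \<in> T \<Longrightarrow> N2 t \<subseteq> T"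
      "\<And>t. t \<in> T \<Longrightarrow> real (card (N2 t)) \<le> L"
    and uncorrelated: "\<And>t. t \<in> T \<Longrightarrow> expectation (\<lambda>x. X t x * (\<Sum>s\<in>T - N1 t. X s x)) = 0"
    and centred: "\<And>t u. t \<in> T \<Longrightarrow>
      expectation (\<lambda>x. of_real (X t x) * iexp (u * (\<Sum>s\<in>T - N1 t. X s x))) = 0"
    and product: "\<And>t u. t \<in> T \<Longrightarrow>
      expectation (\<lambda>x. of_real (X t x * (\<Sum>s\<in>N1 t. X s x)) * iexp (u * (\<Sum>s\<in>T - N2 t. X s x)))
      = expectation (\<lambda>x. of_real (X t x * (\<Sum>s\<in>N1 t. X s x)))
        * expectation (\<lambda>x. iexp (u * (\<Sum>s\<in>T - N2 t. X s x)))"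
  shows "norm (expectation (\<lambda>x. iexp (u * (\<Sum>t\<in>T. X t x)))
      - of_real (exp (- expectation (\<lambda>x. (\<Sum>t\<in>T. X t x)\<^sup>2) * u\<^sup>2 / 2)))
    \<le> 3 * L\<^sup>2 * real (card T) * b ^ 3 * \<bar>u\<bar> ^ 3"
proof -
  define S where "S x = (\<Sum>t\<in>T. X t x)" for x
  define R where "R t x = (\<Sum>s\<in>N1 t. X s x)" for t x
  define S1 where "S1 t x = (\<Sum>s\<in>T - N1 t. X s x)" for t x
  define S2 where "S2 t x = (\<Sum>s\<in>T - N2 t. X s x)" for t x
  have sub: "N1 t \<subseteq> T" "N2 t - N1 t \<subseteq> T" if "t \<in> T" for t
    using N[OF that] by auto
  have fin: "finite (N1 t)" "finite (N2 t)" if "t \<in> T" for t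
    using N(1,2)[OF that] T by (auto intro: finite_subset)
  have sum_meas: "(\<lambda>x. \<Sum>s\<in>J. X s x) \<in> borel_measurable M" if "J \<subseteq> T" for J
    using that meas by (intro borel_measurable_sum) auto
  have sum_bnd: "\<bar>\<Sum>s\<in>J. X s x\<bar> \<le> real (card J) * b" if "J \<subseteq> T" "x \<in> space M" for J x
    using sum_norm_bound[of J "\<lambda>s. X s x" b] bnd that by (auto simp: subset_eq)
  have sum_L: "\<bar>\<Sum>s\<in>J. X s x\<bar> \<le> L * b" if "J \<subseteq> N2 t" "t \<in> T" "x \<in> space M" for J t x
  proof -
    have "real (card J) \<le> L"
      using card_mono[OF fin(2)[OF that(2)] that(1)] N(3)[OF that(2)] by simp
    then have "real (card J) * b \<le> L * b"
      using b by (intro mult_right_mono)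
    then show ?thesis
      using sum_bnd[of J x] that N(2)[of t] by fastforce
  qed
  have S_meas: "S \<in> borel_measurable M"
    unfolding S_def[abs_def] by (rule sum_meas) simp
  have S_bnd: "\<bar>S x\<bar> \<le> real (card T) * b" if "x \<in> space M" for x
    unfolding S_def using sum_bnd[OF _ that] by simp
  define \<phi> where "\<phi> v = expectation (\<lambda>x. iexp (v * S x))" for v
  define \<phi>' where "\<phi>' v = \<i> * expectation (\<lambda>x. of_real (S x) * iexp (v * S x))" for v
  define s where "s = expectation (\<lambda>x. (S x)\<^sup>2)"
  define \<eta> where "\<eta> = 3 * L\<^sup>2 * real (card T) * b ^ 3"
  have key: "norm (expectation (\<lambda>x. of_real (X t x) * iexp (v * S x))
      - \<i> * of_real v * of_real (expectation (\<lambda>x. X t x * R t x)) * \<phi> v) \<le> 3 * L\<^sup>2 * b ^ 3 * v\<^sup>2"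
    if t: "t \<in> T" for t v
  proof -
    have mX: "X t \<in> borel_measurable M" and mR: "R t \<in> borel_measurable M"
      and mS1: "S1 t \<in> borel_measurable M" and mS2: "S2 t \<in> borel_measurable M"
      unfolding R_def[abs_def] S1_def[abs_def] S2_def[abs_def]
      using t meas sub[OF t] by (auto intro!: sum_meas)
    note ms = S_meas mX mR mS1 mS2
    have L0: "0 \<le> L"
      using N(3)[OF t] by (meson of_nat_0_le_iff order_trans)
    have X_le: "\<bar>X t x\<bar> \<le> b" and R_le: "\<bar>R t x\<bar> \<le> L * b" and S12: "\<bar>S1 t x - S2 t x\<bar> \<le> L * b"
      and S2: "\<bar>S2 t x - S x\<bar> \<le> L * b" and SR: "S x = S1 t x + R t x" if x: "x \<in> space M" for x
    proof -
      show "\<bar>X t x\<bar> \<le> b"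
        using bnd t x .
      show "\<bar>R t x\<bar> \<le> L * b"
        unfolding R_def using sum_L[OF N(1)[OF t] t x] .
      have "(T - N1 t) - (T - N2 t) = N2 t - N1 t" "T - N2 t \<subseteq> T - N1 t"
        using N(1,2)[OF t] by auto
      then have "S1 t x = S2 t x + (\<Sum>s\<in>N2 t - N1 t. X s x)"
        unfolding S1_def S2_def using T sum.subset_diff[of "T - N2 t" "T - N1 t" "\<lambda>s. X s x"] by simp
      then show "\<bar>S1 t x - S2 t x\<bar> \<le> L * b"
        using sum_L[of "N2 t - N1 t" t x] t x by auto
      have "S x = S2 t x + (\<Sum>s\<in>N2 t. X s x)"
        unfolding S_def S2_def using sum.subset_diff[OF N(2)[OF t] T] .
      then show "\<bar>S2 t x - S x\<bar> \<le> L * b"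
        using sum_L[of "N2 t" t x] t x by auto
      show "S x = S1 t x + R t x"
        unfolding S_def S1_def R_def using sum.subset_diff[OF sub(1)[OF t] T] .
    qed
    have XR_le: "\<bar>X t x * R t x\<bar> \<le> b * (L * b)" if "x \<in> space M" for x
      unfolding abs_mult using X_le[OF that] R_le[OF that] b by (intro mult_mono) auto
    let ?A = "\<lambda>x. of_real (X t x) * iexp (v * S1 t x)"
    let ?B = "\<lambda>x. of_real (X t x * R t x) * iexp (v * S2 t x)"
    let ?err = "\<lambda>x. of_real (X t x) * iexp (v * S x) - ?A x - \<i> * of_real v * ?B x"
    have int: "integrable M (\<lambda>x. of_real (X t x) * iexp (v * S x))" "integrable M ?A"
      by (rule integrable_bounded[where B = b]; use ms X_le in \<open>auto simp: norm_mult\<close>)+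
    have intB: "integrable M ?B"
      by (rule integrable_bounded[where B = "b * (L * b)"]) (use ms XR_le in \<open>auto simp: norm_mult abs_mult\<close>)
    have err: "norm (expectation ?err) \<le> 2 * L\<^sup>2 * b ^ 3 * v\<^sup>2"
    proof (rule norm_expectation_bounded)
      show "?err \<in> borel_measurable M"
        using ms by measurable
      fix x assume x: "x \<in> space M"
      have "iexp (v * S x) = iexp (v * S1 t x) * iexp (v * R t x)"
        unfolding SR[OF x] by (simp add: algebra_simps exp_add)
      then have "?err x = of_real (X t x) * iexp (v * S1 t x) * (iexp (v * R t x) - 1 - \<i> * of_real (v * R t x))
          + \<i> * of_real v * of_real (X t x * R t x) * (iexp (v * S1 t x) - iexp (v * S2 t x))"
        by (simp add: algebra_simps)
      also have "norm \<dots> \<le> \<bar>X t x\<bar> * ((v * R t x)\<^sup>2 / 2) + \<bar>v\<bar> * \<bar>X t x * R t x\<bar> * \<bar>v * S1 t x - v * S2 t x\<bar>"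
      proof (rule order_trans[OF norm_triangle_ineq add_mono])
        show "norm (of_real (X t x) * iexp (v * S1 t x) * (iexp (v * R t x) - 1 - \<i> * of_real (v * R t x)))
            \<le> \<bar>X t x\<bar> * ((v * R t x)\<^sup>2 / 2)"
          unfolding norm_mult norm_of_real norm_exp_i_times mult_1_right
          by (intro mult_left_mono norm_iexp_minus_linear abs_ge_zero)
        show "norm (\<i> * of_real v * of_real (X t x * R t x) * (iexp (v * S1 t x) - iexp (v * S2 t x)))
            \<le> \<bar>v\<bar> * \<bar>X t x * R t x\<bar> * \<bar>v * S1 t x - v * S2 t x\<bar>"
          unfolding norm_mult norm_of_real norm_ii mult_1
          by (intro mult_left_mono norm_iexp_diff mult_nonneg_nonneg abs_ge_zero)
      qed
      also have "\<dots> = \<bar>X t x\<bar> * (\<bar>R t x\<bar>\<^sup>2 / 2) * v\<^sup>2 + \<bar>X t x * R t x\<bar> * \<bar>S1 t x - S2 t x\<bar> * v\<^sup>2"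
      proof -
        have v2: "v\<^sup>2 = \<bar>v\<bar> * \<bar>v\<bar>"
          by (simp add: power2_eq_square)
        show ?thesis
          unfolding right_diff_distrib[symmetric] abs_mult power_mult_distrib power2_abs v2
          by (simp add: ac_simps del: abs_mult_self_eq)
      qed
      also have "\<dots> \<le> b * ((L * b)\<^sup>2 / 2) * v\<^sup>2 + b * (L * b) * (L * b) * v\<^sup>2"
        using X_le[OF x] R_le[OF x] S12[OF x] XR_le[OF x] b L0
        by (intro add_mono mult_right_mono mult_mono divide_right_mono power_mono) auto
      also have "\<dots> = (3 / 2) * (L\<^sup>2 * b ^ 3 * v\<^sup>2)"
        by (simp add: power2_eq_square power3_eq_cube algebra_simps)
      also have "\<dots> \<le> 2 * (L\<^sup>2 * b ^ 3 * v\<^sup>2)"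
        using b by (intro mult_right_mono) auto
      finally show "norm (?err x) \<le> 2 * L\<^sup>2 * b ^ 3 * v\<^sup>2"
        by (simp add: mult.assoc)
    qed
    have S2_\<phi>: "norm (expectation (\<lambda>x. iexp (v * S2 t x)) - \<phi> v) \<le> \<bar>v\<bar> * (L * b)"
    proof -
      have "integrable M (\<lambda>x. iexp (v * S2 t x))" "integrable M (\<lambda>x. iexp (v * S x))"
        by (rule integrable_bounded[where B = 1]; use ms in auto)+
      then have "expectation (\<lambda>x. iexp (v * S2 t x)) - \<phi> v = expectation (\<lambda>x. iexp (v * S2 t x) - iexp (v * S x))"
        unfolding \<phi>_def by simp
      also have "norm \<dots> \<le> \<bar>v\<bar> * (L * b)"
      proof (rule norm_expectation_bounded)
        fix x assume x: "x \<in> space M"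
        have "norm (iexp (v * S2 t x) - iexp (v * S x)) \<le> \<bar>v\<bar> * \<bar>S2 t x - S x\<bar>"
          using norm_iexp_diff[of "v * S2 t x" "v * S x"] unfolding right_diff_distrib[symmetric] abs_mult .
        also have "\<dots> \<le> \<bar>v\<bar> * (L * b)"
          using S2[OF x] by (intro mult_left_mono) auto
        finally show "norm (iexp (v * S2 t x) - iexp (v * S x)) \<le> \<bar>v\<bar> * (L * b)" .
      qed (use ms in measurable)
      finally show ?thesis .
    qed
    have XR_E: "\<bar>expectation (\<lambda>x. X t x * R t x)\<bar> \<le> b * (L * b)"
      using norm_expectation_bounded[of "\<lambda>x. X t x * R t x" "b * (L * b)"] ms XR_le by auto
    have "expectation ?err = expectation (\<lambda>x. of_real (X t x) * iexp (v * S x)) - expectation ?A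
        - \<i> * of_real v * expectation ?B"
      using int intB by simp
    also have "expectation ?A = 0"
      unfolding S1_def by (rule centred[OF t])
    also have "expectation ?B = of_real (expectation (\<lambda>x. X t x * R t x)) * expectation (\<lambda>x. iexp (v * S2 t x))"
      unfolding S2_def R_def product[OF t] by (simp only: integral_complex_of_real)
    finally have "expectation (\<lambda>x. of_real (X t x) * iexp (v * S x))
        - \<i> * of_real v * of_real (expectation (\<lambda>x. X t x * R t x)) * \<phi> v
        = expectation ?err + \<i> * of_real v * of_real (expectation (\<lambda>x. X t x * R t x))
          * (expectation (\<lambda>x. iexp (v * S2 t x)) - \<phi> v)" (is "?lhs = ?e1 + ?e2")
      by (simp add: algebra_simps)
    moreover have "norm (?e1 + ?e2) \<le> norm ?e1 + norm ?e2"
      by (rule norm_triangle_ineq)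
    moreover have "norm ?e2 \<le> L\<^sup>2 * b ^ 3 * v\<^sup>2"
    proof -
      have "norm ?e2 = \<bar>v\<bar> * \<bar>expectation (\<lambda>x. X t x * R t x)\<bar>
          * norm (expectation (\<lambda>x. iexp (v * S2 t x)) - \<phi> v)"
        unfolding norm_mult norm_of_real norm_ii mult_1 ..
      also have "\<dots> \<le> \<bar>v\<bar> * (b * (L * b)) * (\<bar>v\<bar> * (L * b))"
      proof (rule mult_mono[OF mult_left_mono[OF XR_E abs_ge_zero] S2_\<phi>])
        show "0 \<le> \<bar>v\<bar> * (b * (L * b))"
          by (intro mult_nonneg_nonneg abs_ge_zero b L0)
      qed (rule norm_ge_zero)
      also have "\<dots> = L\<^sup>2 * b ^ 3 * (\<bar>v\<bar> * \<bar>v\<bar>)"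
        by (simp add: power2_eq_square power3_eq_cube ac_simps del: abs_mult_self_eq)
      also have "\<bar>v\<bar> * \<bar>v\<bar> = v\<^sup>2"
        by (simp add: power2_eq_square)
      finally show ?thesis .
    qed
    ultimately have "norm ?lhs \<le> 2 * L\<^sup>2 * b ^ 3 * v\<^sup>2 + L\<^sup>2 * b ^ 3 * v\<^sup>2"
      using err by (simp only:)
    then show ?thesis
      by simp
  qed
  have s_eq: "s = (\<Sum>t\<in>T. expectation (\<lambda>x. X t x * R t x))"
  proof -
    have intR: "integrable M (\<lambda>x. X t x * (\<Sum>s\<in>J. X s x))" if "t \<in> T" "J \<subseteq> T" for t J
    proof (rule integrable_bounded[where B = "b * (real (card J) * b)"])
      show "(\<lambda>x. X t x * (\<Sum>s\<in>J. X s x)) \<in> borel_measurable M"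
        using meas[OF that(1)] sum_meas[OF that(2)] by measurable
      show "norm (X t x * (\<Sum>s\<in>J. X s x)) \<le> b * (real (card J) * b)" if "x \<in> space M" for x
        using bnd[OF \<open>t \<in> T\<close> that] sum_bnd[OF \<open>J \<subseteq> T\<close> that] b
        by (auto simp: abs_mult intro!: mult_mono)
    qed
    have "s = expectation (\<lambda>x. \<Sum>t\<in>T. X t x * S x)"
      unfolding s_def by (simp add: S_def power2_eq_square sum_distrib_right)
    also have "\<dots> = (\<Sum>t\<in>T. expectation (\<lambda>x. X t x * S x))"
      unfolding S_def by (intro Bochner_Integration.integral_sum intR) auto
    also have "\<dots> = (\<Sum>t\<in>T. expectation (\<lambda>x. X t x * R t x))"
    proof (rule sum.cong[OF refl])
      fix t assume t: "t \<in> T"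
      have "expectation (\<lambda>x. X t x * S x) = expectation (\<lambda>x. X t x * S1 t x + X t x * R t x)"
        unfolding S_def S1_def R_def sum.subset_diff[OF sub(1)[OF t] T] distrib_left ..
      also have "\<dots> = expectation (\<lambda>x. X t x * S1 t x) + expectation (\<lambda>x. X t x * R t x)"
        unfolding S1_def R_def by (intro Bochner_Integration.integral_add intR t sub(1)) auto
      finally show "expectation (\<lambda>x. X t x * S x) = expectation (\<lambda>x. X t x * R t x)"
        unfolding S1_def uncorrelated[OF t] by simp
    qed
    finally show ?thesis .
  qed
  have "norm (\<phi>' v + of_real (v * s) * \<phi> v) \<le> \<eta> * v\<^sup>2" for v
  proof -
    have int: "integrable M (\<lambda>x. of_real (X t x) * iexp (v * S x))" if "t \<in> T" for t
      by (rule integrable_bounded[where B = b]) (use S_meas meas[OF that] bnd[OF that] in \<open>auto simp: norm_mult\<close>)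
    have "\<phi>' v = \<i> * expectation (\<lambda>x. \<Sum>t\<in>T. of_real (X t x) * iexp (v * S x))"
      unfolding \<phi>'_def by (simp add: S_def[of x for x] sum_distrib_right)
    also have "\<dots> = \<i> * (\<Sum>t\<in>T. expectation (\<lambda>x. of_real (X t x) * iexp (v * S x)))"
      using int by (subst Bochner_Integration.integral_sum) auto
    finally have "\<phi>' v = \<i> * (\<Sum>t\<in>T. expectation (\<lambda>x. of_real (X t x) * iexp (v * S x)))" .
    moreover have "(\<Sum>t\<in>T. expectation (\<lambda>x. of_real (X t x) * iexp (v * S x))
          - \<i> * of_real v * of_real (expectation (\<lambda>x. X t x * R t x)) * \<phi> v)
        = (\<Sum>t\<in>T. expectation (\<lambda>x. of_real (X t x) * iexp (v * S x))) - \<i> * of_real v * of_real s * \<phi> v"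
      unfolding s_eq by (simp add: sum_subtractf sum_distrib_left sum_distrib_right)
    ultimately have "\<phi>' v + of_real (v * s) * \<phi> v
        = \<i> * (\<Sum>t\<in>T. expectation (\<lambda>x. of_real (X t x) * iexp (v * S x))
          - \<i> * of_real v * of_real (expectation (\<lambda>x. X t x * R t x)) * \<phi> v)"
      by (simp only:) (simp add: algebra_simps)
    also have "norm \<dots> \<le> (\<Sum>t\<in>T. 3 * L\<^sup>2 * b ^ 3 * v\<^sup>2)"
      unfolding norm_mult norm_ii mult_1 by (rule sum_norm_le) (rule key)
    also have "\<dots> = \<eta> * v\<^sup>2"
      by (simp add: \<eta>_def)
    finally show ?thesis .
  qed
  moreover have "(\<phi> has_vector_derivative \<phi>' v) (at v)" for v
    unfolding \<phi>_def[abs_def] \<phi>'_def by (rule iexp_has_vector_derivative[OF S_meas S_bnd])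
  moreover have "\<phi> 0 = 1"
    by (simp add: \<phi>_def prob_space)
  moreover have "0 \<le> s"
    by (simp add: s_def)
  ultimately have "norm (\<phi> u - of_real (exp (- s * u\<^sup>2 / 2))) \<le> \<eta> * \<bar>u\<bar> ^ 3"
    by (intro exp_square_perturbation_bound)
  then show ?thesis
    by (simp add: \<phi>_def s_def \<eta>_def S_def)
qed

section \<open>Functions of disjoint sets of noise variables\<close>

definition depends_on :: "(('i \<Rightarrow> 'b) \<Rightarrow> 'c) \<Rightarrow> 'i set \<Rightarrow> bool" where
  "depends_on f A \<longleftrightarrow> (\<forall>x y. (\<forall>i\<in>A. x i = y i) \<longrightarrow> f x = f y)"

lemma depends_onD: "depends_on f A \<Longrightarrow> (\<And>i. i \<in> A \<Longrightarrow> x i = y i) \<Longrightarrow> f x = f y"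
  by (simp add: depends_on_def)

lemma depends_on_mono: "depends_on f A \<Longrightarrow> A \<subseteq> B \<Longrightarrow> depends_on f B"
  unfolding depends_on_def by blast

lemma depends_on_comp: "depends_on f A \<Longrightarrow> depends_on (\<lambda>x. k (f x)) A"
  unfolding depends_on_def by metis

lemma depends_on_mult: "depends_on f A \<Longrightarrow> depends_on g A \<Longrightarrow> depends_on (\<lambda>x. f x * g x) A"
  unfolding depends_on_def by metis

lemma depends_on_sum:
  assumes "\<And>t. t \<in> T \<Longrightarrow> depends_on (f t) (A t)"
  shows "depends_on (\<lambda>x. \<Sum>t\<in>T. f t x) (\<Union>t\<in>T. A t)"
  unfolding depends_on_def
proof (intro allI impI sum.cong refl)
  fix x y :: "'b \<Rightarrow> 'c" and t
  assume "\<forall>i\<in>\<Union>t\<in>T. A t. x i = y i" "t \<in> T"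
  then show "f t x = f t y"
    by (intro depends_onD[OF assms]) auto
qed

lemma measurable_complex_of_real:
  "f \<in> borel_measurable N \<Longrightarrow> (\<lambda>x. complex_of_real (f x)) \<in> borel_measurable N"
  by measurable

context iid_noise
begin

text \<open>Resampling the coordinates in \<open>B\<close> preserves the law, leaves \<open>f\<close> as a function of the first copy
and makes \<open>g\<close> a function of the second, so Fubini's theorem gives the product.\<close>

lemma expectation_mult_disjoint:
  fixes f g :: "('i \<Rightarrow> real) \<Rightarrow> 'c::{real_normed_field, banach, second_countable_topology}"
  assumes f: "f \<in> borel_measurable P" "depends_on f A" "\<And>x. norm (f x) \<le> K"
    and g: "g \<in> borel_measurable P" "depends_on g B" "\<And>x. norm (g x) \<le> K'"
    and "A \<inter> B = {}"
  shows "P.expectation (\<lambda>x. f x * g x) = P.expectation f * P.expectation g"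
proof -
  have K: "0 \<le> K"
    using order_trans[OF norm_ge_zero f(3)] .
  have meas: "(\<lambda>w. f (fst w) * g (snd w)) \<in> borel_measurable PP"
    by (intro borel_measurable_times measurable_compose[OF measurable_fst f(1)]
        measurable_compose[OF measurable_snd g(1)])
  have int: "integrable PP (\<lambda>w. f (fst w) * g (snd w))"
  proof (rule PP.integrable_bounded[OF meas])
    show "norm (f (fst w) * g (snd w)) \<le> K * K'" for w
      unfolding norm_mult by (intro mult_mono f g K norm_ge_zero)
  qed
  have "P.expectation (\<lambda>x. f x * g x) = (\<integral>w. mixed (\<lambda>x. f x * g x) B w \<partial>PP)"
    by (rule integral_mixed[symmetric]) (intro borel_measurable_times f g)
  also have "mixed (\<lambda>x. f x * g x) B = (\<lambda>w. f (fst w) * g (snd w))"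
  proof (intro ext arg_cong2[where f = "(*)"])
    fix w :: "('i \<Rightarrow> real) \<times> ('i \<Rightarrow> real)"
    show "mixed f B w = f (fst w)"
      by (rule depends_onD[OF f(2)]) (use \<open>A \<inter> B = {}\<close> in \<open>auto simp: override_on_def\<close>)
    show "mixed g B w = g (snd w)"
      by (rule depends_onD[OF g(2)]) (auto simp: override_on_def)
  qed
  also have "(\<integral>w. f (fst w) * g (snd w) \<partial>PP) = (\<integral>x. (\<integral>y. f x * g y \<partial>P) \<partial>P)"
    using PP.integral_fst'[OF int] by simp
  also have "\<dots> = P.expectation f * P.expectation g"
    by simp
  finally show ?thesis .
qed

end

section \<open>Linear statistics of a moving average of the noise\<close>

text \<open>In \<open>V t = G (\<epsilon> (t - s) : s)\<close> the noise is shifted and reflected; the reflection makes the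
coordinate \<open>t - i\<close> of the argument of \<open>G\<close> correspond to the site \<open>i\<close>.\<close>

definition reflect_shift :: "'i::ab_group_add \<Rightarrow> ('i \<Rightarrow> 'b) \<Rightarrow> 'i \<Rightarrow> 'b" where
  "reflect_shift t x = (\<lambda>s. x (t - s))"

definition linear_statistic ::
    "('i::ab_group_add \<Rightarrow> real) \<Rightarrow> 'i set \<Rightarrow> (('i \<Rightarrow> 'b) \<Rightarrow> real) \<Rightarrow> ('i \<Rightarrow> 'b) \<Rightarrow> real" where
  "linear_statistic w T f x = (\<Sum>t\<in>T. w t * f (reflect_shift t x))"

lemma depends_on_reflect_shift:
  fixes t :: "'i::ab_group_add"
  assumes "depends_on f B"
  shows "depends_on (\<lambda>x. f (reflect_shift t x)) ((\<lambda>s. t - s) ` B)"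
  unfolding depends_on_def reflect_shift_def
  by (intro allI impI depends_onD[OF assms]) auto

lemma reflect_shift_override_on:
  "reflect_shift t (override_on x y {i}) = override_on (reflect_shift t x) (reflect_shift t y) {t - i}"
  by (auto simp: reflect_shift_def override_on_def fun_eq_iff algebra_simps)

locale lattice_noise = iid_noise \<nu> site_type
  for \<nu> :: "real measure" and site_type :: "'i::ab_group_add itself"
begin

lemma measurable_reflect_shift: "reflect_shift t \<in> measurable P P"
  unfolding reflect_shift_def[abs_def] by (rule measurable_reindex)

lemma distr_reflect_shift: "distr P P (reflect_shift t) = P"
  unfolding reflect_shift_def[abs_def] by (rule distr_reindex) (simp add: inj_on_def)

lemma expectation_reflect_shift:
  fixes f :: "('i \<Rightarrow> real) \<Rightarrow> 'c::{banach, second_countable_topology}"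
  assumes "f \<in> borel_measurable P"
  shows "P.expectation (\<lambda>x. f (reflect_shift t x)) = P.expectation f"
  using integral_distr[OF measurable_reflect_shift assms, of t] by (simp add: distr_reflect_shift)

lemma sqint_reflect_shift: "sqint P f \<Longrightarrow> sqint P (\<lambda>x. f (reflect_shift t x))"
  by (rule sqint_distr[OF measurable_reflect_shift _ distr_reflect_shift])

lemma influence_reflect_shift:
  assumes f: "f \<in> borel_measurable P"
  shows "influence (\<lambda>x. f (reflect_shift t x)) i = influence f (t - i)"
proof -
  let ?\<tau> = "\<lambda>(x, y). (reflect_shift t x, reflect_shift t y) :: ('i \<Rightarrow> real) \<times> ('i \<Rightarrow> real)"
  have "sigma_finite_measure (distr P P (reflect_shift t))"
    unfolding distr_reflect_shift by unfold_locales
  from pair_measure_distr[OF measurable_reflect_shift measurable_reflect_shift this, of t]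
  have law: "distr PP PP ?\<tau> = PP"
    unfolding distr_reflect_shift by simp
  have "?\<tau> \<in> measurable PP PP"
    unfolding case_prod_beta
    by (intro measurable_Pair measurable_compose[OF measurable_fst measurable_reflect_shift]
        measurable_compose[OF measurable_snd measurable_reflect_shift])
  from l2norm_distr[OF this _ law, of "\<lambda>w. change f {t - i} w"]
  show ?thesis
    unfolding influence_def
    by (simp add: borel_measurable_diff measurable_mixed f case_prod_beta reflect_shift_override_on
        measurable_compose[OF measurable_fst f])
qed

lemma measurable_linear_statistic:
  "f \<in> borel_measurable P \<Longrightarrow> linear_statistic w T f \<in> borel_measurable P"
  unfolding linear_statistic_def[abs_def]
  by (intro borel_measurable_sum borel_measurable_times borel_measurable_const
      measurable_compose[OF measurable_reflect_shift])

lemma sqint_linear_statistic: "sqint P f \<Longrightarrow> sqint P (linear_statistic w T f)"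
  unfolding linear_statistic_def[abs_def] by (intro sqint_sum sqint_scale sqint_reflect_shift)

lemma expectation_linear_statistic:
  assumes "integrable P f"
  shows "P.expectation (linear_statistic w T f) = (\<Sum>t\<in>T. w t) * P.expectation f"
proof -
  have "integrable P (\<lambda>x. f (reflect_shift t x))" for t
    by (rule integrable_distr[OF measurable_reflect_shift]) (simp add: distr_reflect_shift assms)
  then show ?thesis
    unfolding linear_statistic_def[abs_def] using assms
    by (simp add: expectation_reflect_shift borel_measurable_integrable sum_distrib_right)
qed

lemma influence_linear_statistic_le:
  assumes f: "sqint P f"
  shows "influence (linear_statistic w T f) i \<le> (\<Sum>t\<in>T. \<bar>w t\<bar> * influence f (t - i))"
proof -
  let ?d = "\<lambda>t w'. change (\<lambda>x. f (reflect_shift t x)) {i} w'"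
  have d: "sqint PP (?d t)" for t
    by (intro sqint_diff sqint_mixed sqint_reflect_shift f)
  have "influence (linear_statistic w T f) i = l2norm PP (\<lambda>w'. \<Sum>t\<in>T. w t * ?d t w')"
    unfolding influence_def linear_statistic_def by (simp add: sum_subtractf right_diff_distrib)
  also have "\<dots> \<le> (\<Sum>t\<in>T. l2norm PP (\<lambda>w'. w t * ?d t w'))"
    by (intro l2norm_sum sqint_scale d)
  also have "\<dots> = (\<Sum>t\<in>T. \<bar>w t\<bar> * influence f (t - i))"
  proof -
    have "l2norm PP (?d t) = influence f (t - i)" for t
      using influence_reflect_shift[OF sqint_measurable[OF f], of t i]
      unfolding influence_def[of "\<lambda>x. f (reflect_shift t x)"] .
    then show ?thesis
      by (simp only: l2norm_scale)
  qed
  finally show ?thesis .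
qed

text \<open>The Efron--Stein inequality, with Young's inequality for the convolution of the weights with
the influences: the influences on the sum are at most \<open>c * \<Delta>\<close>, and they add up to at most
\<open>c * \<bar>T\<bar> * \<Delta>\<close>.\<close>

lemma l2norm_linear_statistic_le:
  assumes f: "sqint P f" and mean: "P.expectation f = 0" and "finite T"
    and w: "\<And>t. t \<in> T \<Longrightarrow> \<bar>w t\<bar> \<le> c" and c: "0 \<le> c"
    and \<Delta>: "\<And>A. finite A \<Longrightarrow> (\<Sum>j\<in>A. influence f j) \<le> \<Delta>"
  shows "l2norm P (linear_statistic w T f) \<le> c * sqrt (real (card T)) * \<Delta>"
proof -
  have \<Delta>0: "0 \<le> \<Delta>"
    using \<Delta>[of "{}"] by simp
  let ?I = "\<lambda>i. influence (linear_statistic w T f) i"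
  have le: "?I i \<le> c * (\<Sum>t\<in>T. influence f (t - i))" for i
    unfolding sum_distrib_left
    by (rule order_trans[OF influence_linear_statistic_le[OF f]])
       (intro sum_mono mult_right_mono w influence_nonneg)
  have "(\<Sum>i\<in>A. (?I i)\<^sup>2) \<le> c\<^sup>2 * real (card T) * \<Delta>\<^sup>2" if "finite A" for A
  proof -
    have "?I i \<le> c * \<Delta>" for i
    proof -
      have "(\<Sum>t\<in>T. influence f (t - i)) = (\<Sum>j\<in>(\<lambda>t. t - i) ` T. influence f j)"
        by (subst sum.reindex) (auto simp: inj_on_def)
      also have "\<dots> \<le> \<Delta>"
        using \<open>finite T\<close> by (intro \<Delta>) simp
      finally show ?thesis
        using le[of i] c by (meson mult_left_mono order_trans)
    qed
    then have "(\<Sum>i\<in>A. (?I i)\<^sup>2) \<le> (\<Sum>i\<in>A. (c * \<Delta>) * ?I i)"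
      unfolding power2_eq_square by (intro sum_mono mult_right_mono influence_nonneg)
    also have "\<dots> \<le> (\<Sum>i\<in>A. (c * \<Delta>) * (c * (\<Sum>t\<in>T. influence f (t - i))))"
      using c \<Delta>0 by (intro sum_mono mult_left_mono le) simp
    also have "\<dots> = c\<^sup>2 * \<Delta> * (\<Sum>t\<in>T. \<Sum>i\<in>A. influence f (t - i))"
      by (subst sum.swap) (simp add: sum_distrib_left power2_eq_square ac_simps)
    also have "\<dots> \<le> c\<^sup>2 * \<Delta> * (\<Sum>t\<in>T. \<Delta>)"
    proof (intro mult_left_mono sum_mono)
      fix t
      have "(\<Sum>i\<in>A. influence f (t - i)) = (\<Sum>j\<in>(\<lambda>i. t - i) ` A. influence f j)"
        by (subst sum.reindex) (auto simp: inj_on_def)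
      also have "\<dots> \<le> \<Delta>"
        using \<open>finite A\<close> by (intro \<Delta>) simp
      finally show "(\<Sum>i\<in>A. influence f (t - i)) \<le> \<Delta>" .
    qed (use \<Delta>0 in simp)
    finally show ?thesis
      by (simp add: power2_eq_square ac_simps)
  qed
  moreover have "P.expectation (linear_statistic w T f) = 0"
    using expectation_linear_statistic[OF P.sqint_integrable[OF f]] mean by simp
  ultimately have "2 * (l2norm P (linear_statistic w T f))\<^sup>2 \<le> c\<^sup>2 * real (card T) * \<Delta>\<^sup>2"
    by (intro Efron_Stein[OF sqint_linear_statistic[OF f]])
  then have "(l2norm P (linear_statistic w T f))\<^sup>2 \<le> c\<^sup>2 * real (card T) * \<Delta>\<^sup>2"
    using zero_le_power2[of "l2norm P (linear_statistic w T f)"] by linarith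
  also have "\<dots> = (c * sqrt (real (card T)) * \<Delta>)\<^sup>2"
    by (simp add: power_mult_distrib)
  finally show ?thesis
    by (rule power2_le_imp_le) (use c \<Delta>0 in simp)
qed

text \<open>Two summands are independent unless the translates of \<open>B\<close> that they depend on meet, which for
given \<open>t\<close> happens for at most \<open>card B ^ 2\<close> sites; the neighbours of neighbours number at most
\<open>card B ^ 4\<close>.\<close>

lemma linear_statistic_characteristic_function:
  assumes h: "h \<in> borel_measurable P" "depends_on h B" "\<And>x. \<bar>h x\<bar> \<le> K"
    and mean: "P.expectation h = 0" and B: "finite B" and T: "finite T"
    and w: "\<And>t. t \<in> T \<Longrightarrow> \<bar>w t\<bar> \<le> c" and c: "0 \<le> c"
  shows "norm (P.expectation (\<lambda>x. iexp (u * linear_statistic w T h x))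
      - of_real (exp (- (l2norm P (linear_statistic w T h))\<^sup>2 * u\<^sup>2 / 2)))
    \<le> 3 * (real (card B) ^ 4)\<^sup>2 * real (card T) * (c * K) ^ 3 * \<bar>u\<bar> ^ 3"
proof -
  define X where "X t x = w t * h (reflect_shift t x)" for t x
  define near where "near t = {s\<in>T. \<exists>i\<in>B. \<exists>j\<in>B. s - i = t - j}" for t
  define N1 where "N1 t = near t" for t
  define N2 where "N2 t = (\<Union>r\<in>near t. near r)" for t
  have K: "0 \<le> K"
    using order_trans[OF abs_ge_zero h(3)] .
  have near_sub: "near t \<subseteq> (\<lambda>(i, j). t - j + i) ` (B \<times> B)" for t
    by (force simp: near_def algebra_simps)
  have near_card: "card (near t) \<le> card B * card B" for t
    using surj_card_le[OF _ near_sub[of t]] B by simp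
  have near_fin: "finite (near t)" for t
    using T by (simp add: near_def)
  have X_dep: "depends_on (X t) ((\<lambda>s. t - s) ` B)" for t
    unfolding X_def[abs_def]
    by (rule depends_on_comp[OF depends_on_reflect_shift[OF h(2)], of "\<lambda>r. w t * r"])
  have X_meas: "X t \<in> borel_measurable P" for t
    unfolding X_def[abs_def]
    by (intro borel_measurable_times borel_measurable_const measurable_compose[OF measurable_reflect_shift h(1)])
  have X_bnd: "\<bar>X t x\<bar> \<le> c * K" if "t \<in> T" for t x
    unfolding X_def abs_mult using w[OF that] h(3) c by (intro mult_mono) auto
  have X_mean: "P.expectation (X t) = 0" for t
    unfolding X_def[abs_def] using expectation_reflect_shift[OF h(1), of t] mean by simp
  have sum_dep: "depends_on (\<lambda>x. \<Sum>s\<in>J. X s x) (\<Union>s\<in>J. (\<lambda>r. s - r) ` B)" for J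
    by (intro depends_on_sum X_dep)
  have sum_meas: "(\<lambda>x. \<Sum>s\<in>J. X s x) \<in> borel_measurable P" for J
    by (intro borel_measurable_sum X_meas)
  have sum_bnd: "\<bar>\<Sum>s\<in>J. X s x\<bar> \<le> real (card J) * (c * K)" if "J \<subseteq> T" for J x
    using sum_norm_bound[of J "\<lambda>s. X s x" "c * K"] X_bnd that by (auto simp: subset_eq)
  have far: "(\<Union>s\<in>J. (\<lambda>r. s - r) ` B) \<inter> (\<Union>s\<in>T - J'. (\<lambda>r. s - r) ` B) = {}"
    if "\<And>s. s \<in> J \<Longrightarrow> near s \<subseteq> J'" for J J'
  proof (rule equals0I)
    fix k assume "k \<in> (\<Union>s\<in>J. (\<lambda>r. s - r) ` B) \<inter> (\<Union>s\<in>T - J'. (\<lambda>r. s - r) ` B)"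
    then obtain s i s' j where "s \<in> J" "i \<in> B" "k = s - i" "s' \<in> T" "s' \<notin> J'" "j \<in> B" "k = s' - j"
      by auto
    moreover from this have "s' \<in> near s"
      unfolding near_def by auto
    ultimately show False
      using that by blast
  qed
  have "N1 t \<subseteq> N2 t" if "t \<in> T" for t
  proof (cases "B = {}")
    case True
    then show ?thesis by (simp add: N1_def near_def)
  next
    case False
    then have "t \<in> near t"
      using that by (auto simp: near_def)
    then show ?thesis
      by (auto simp: N1_def N2_def)
  qed
  moreover have "N2 t \<subseteq> T" for t
    by (auto simp: N2_def near_def)
  moreover have "real (card (N2 t)) \<le> real (card B) ^ 4" for t
  proof -
    have "card (N2 t) \<le> (\<Sum>r\<in>near t. card (near r))"
      unfolding N2_def by (rule card_UN_le[OF near_fin])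
    also have "\<dots> \<le> (\<Sum>r\<in>near t. card B * card B)"
      by (intro sum_mono near_card)
    also have "\<dots> \<le> (card B * card B) * (card B * card B)"
      using near_card[of t] by simp
    finally have "card (N2 t) \<le> card B ^ 4"
      by (simp add: eval_nat_numeral ac_simps)
    then show ?thesis
      by (metis of_nat_le_iff of_nat_power)
  qed
  moreover have "P.expectation (\<lambda>x. X t x * (\<Sum>s\<in>T - N1 t. X s x)) = 0" if "t \<in> T" for t
  proof (subst expectation_mult_disjoint[OF X_meas X_dep _ sum_meas sum_dep])
    show "(\<lambda>s. t - s) ` B \<inter> (\<Union>s\<in>T - N1 t. (\<lambda>r. s - r) ` B) = {}"
      using far[of "{t}" "N1 t"] by (simp add: N1_def)
    show "norm (X t x) \<le> c * K" for x
      using X_bnd[OF that] by simp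
    show "norm (\<Sum>s\<in>T - N1 t. X s x) \<le> real (card (T - N1 t)) * (c * K)" for x
      using sum_bnd[of "T - N1 t" x] by auto
  qed (simp add: X_mean)
  moreover have "P.expectation (\<lambda>x. of_real (X t x) * iexp (v * (\<Sum>s\<in>T - N1 t. X s x))) = 0"
    if "t \<in> T" for t v
  proof (subst expectation_mult_disjoint[where K = "c * K" and K' = 1])
    show "(\<lambda>s. t - s) ` B \<inter> (\<Union>s\<in>T - N1 t. (\<lambda>r. s - r) ` B) = {}"
      using far[of "{t}" "N1 t"] by (simp add: N1_def)
    show "norm (complex_of_real (X t x)) \<le> c * K" for x
      using X_bnd[OF that] by simp
    show "depends_on (\<lambda>x. complex_of_real (X t x)) ((\<lambda>s. t - s) ` B)"
      by (rule depends_on_comp[OF X_dep])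
    show "depends_on (\<lambda>x. iexp (v * (\<Sum>s\<in>T - N1 t. X s x))) (\<Union>s\<in>T - N1 t. (\<lambda>r. s - r) ` B)"
      by (rule depends_on_comp[OF sum_dep])
    show "(\<lambda>x. complex_of_real (X t x)) \<in> borel_measurable P"
      by (intro measurable_complex_of_real X_meas)
    show "(\<lambda>x. iexp (v * (\<Sum>s\<in>T - N1 t. X s x))) \<in> borel_measurable P"
      by (rule P.iexp_measurable[OF sum_meas])
    show "norm (iexp (v * (\<Sum>s\<in>T - N1 t. X s x))) \<le> 1" for x
      by simp
  qed (simp add: X_mean)
  moreover have "P.expectation (\<lambda>x. of_real (X t x * (\<Sum>s\<in>N1 t. X s x)) * iexp (v * (\<Sum>s\<in>T - N2 t. X s x)))
      = P.expectation (\<lambda>x. of_real (X t x * (\<Sum>s\<in>N1 t. X s x)))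
        * P.expectation (\<lambda>x. iexp (v * (\<Sum>s\<in>T - N2 t. X s x)))"
    if "t \<in> T" for t v
  proof (rule expectation_mult_disjoint[where K = "c * K * (real (card (N1 t)) * (c * K))" and K' = 1])
    let ?A = "\<Union>s\<in>insert t (N1 t). (\<lambda>r. s - r) ` B"
    show "?A \<inter> (\<Union>s\<in>T - N2 t. (\<lambda>r. s - r) ` B) = {}"
    proof (rule far)
      fix s assume "s \<in> insert t (N1 t)"
      then show "near s \<subseteq> N2 t"
        using \<open>\<And>t. t \<in> T \<Longrightarrow> N1 t \<subseteq> N2 t\<close>[OF that] by (auto simp: N1_def N2_def)
    qed
    have "depends_on (X t) ?A" "depends_on (\<lambda>x. \<Sum>s\<in>N1 t. X s x) ?A"
      by (rule depends_on_mono[OF X_dep], blast) (rule depends_on_mono[OF sum_dep], blast)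
    then show "depends_on (\<lambda>x. complex_of_real (X t x * (\<Sum>s\<in>N1 t. X s x))) ?A"
      by (intro depends_on_comp[where k = complex_of_real] depends_on_mult)
    show "norm (complex_of_real (X t x * (\<Sum>s\<in>N1 t. X s x))) \<le> c * K * (real (card (N1 t)) * (c * K))" for x
      unfolding norm_of_real abs_mult
      by (intro mult_mono X_bnd that sum_bnd) (auto simp: N1_def near_def c K)
    show "depends_on (\<lambda>x. iexp (v * (\<Sum>s\<in>T - N2 t. X s x))) (\<Union>s\<in>T - N2 t. (\<lambda>r. s - r) ` B)"
      by (rule depends_on_comp[OF sum_dep])
    show "(\<lambda>x. complex_of_real (X t x * (\<Sum>s\<in>N1 t. X s x))) \<in> borel_measurable P"
      by (intro measurable_complex_of_real borel_measurable_times X_meas sum_meas)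
    show "(\<lambda>x. iexp (v * (\<Sum>s\<in>T - N2 t. X s x))) \<in> borel_measurable P"
      by (rule P.iexp_measurable[OF sum_meas])
    show "norm (iexp (v * (\<Sum>s\<in>T - N2 t. X s x))) \<le> 1" for x
      by simp
  qed
  ultimately have "norm (P.expectation (\<lambda>x. iexp (u * (\<Sum>t\<in>T. X t x)))
        - of_real (exp (- P.expectation (\<lambda>x. (\<Sum>t\<in>T. X t x)\<^sup>2) * u\<^sup>2 / 2)))
      \<le> 3 * (real (card B) ^ 4)\<^sup>2 * real (card T) * (c * K) ^ 3 * \<bar>u\<bar> ^ 3"
    by (intro P.local_dependence_characteristic_function[where ?N1.0 = N1 and ?N2.0 = N2] T X_meas X_bnd)
       (auto simp: c K)
  then show ?thesis
    unfolding linear_statistic_def l2norm_power2 X_def .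
qed

end

section \<open>Approximation by bounded functions of finitely many noise variables\<close>

lemma ennreal_l2norm_power2:
  "sqint N f \<Longrightarrow> ennreal ((l2norm N f)\<^sup>2) = (\<integral>\<^sup>+x. ennreal ((f x)\<^sup>2) \<partial>N)"
  unfolding l2norm_power2 sqint_def by (intro nn_integral_eq_integral[symmetric]) auto

lemma l2norm_le_nn_integral:
  assumes "sqint N f" "sqint N' g" "(\<integral>\<^sup>+x. ennreal ((f x)\<^sup>2) \<partial>N) \<le> (\<integral>\<^sup>+x. ennreal ((g x)\<^sup>2) \<partial>N')"
  shows "l2norm N f \<le> l2norm N' g"
proof -
  have "ennreal ((l2norm N f)\<^sup>2) \<le> ennreal ((l2norm N' g)\<^sup>2)"
    unfolding ennreal_l2norm_power2[OF assms(1)] ennreal_l2norm_power2[OF assms(2)] by (rule assms(3))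
  then have "(l2norm N f)\<^sup>2 \<le> (l2norm N' g)\<^sup>2"
    by (subst (asm) ennreal_le_iff) (rule zero_le_power2)
  then show ?thesis
    by (rule power2_le_imp_le) (rule l2norm_nonneg)
qed

lemma (in prob_space) square_expectation_le:
  assumes "f \<in> borel_measurable M" "\<And>x. x \<in> space M \<Longrightarrow> \<bar>f x\<bar> \<le> K"
  shows "ennreal ((expectation f)\<^sup>2) \<le> (\<integral>\<^sup>+x. ennreal ((f x)\<^sup>2) \<partial>M)"
proof -
  have f: "sqint M f"
    by (rule sqint_bounded) (use assms in auto)
  have "(expectation f)\<^sup>2 \<le> (l2norm M f)\<^sup>2"
    using l2norm_integral_bound(1)[OF f] power_mono[of "\<bar>expectation f\<bar>" _ 2] by simp
  then show ?thesis
    unfolding ennreal_l2norm_power2[OF f, symmetric] by (rule ennreal_leI)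
qed

context iid_noise
begin

text \<open>The conditional expectation of \<open>g\<close> given the coordinates in \<open>B\<close>, as an explicit integral.\<close>

definition average_out :: "(('i \<Rightarrow> real) \<Rightarrow> real) \<Rightarrow> 'i set \<Rightarrow> ('i \<Rightarrow> real) \<Rightarrow> real" where
  "average_out g B x = (\<integral>y. g (override_on x y (- B)) \<partial>P)"

lemma depends_on_average_out: "depends_on (average_out g B) B"
  unfolding depends_on_def
proof (intro allI impI)
  fix x y :: "'i \<Rightarrow> real" assume "\<forall>i\<in>B. x i = y i"
  then have "override_on x z (- B) = override_on y z (- B)" for z
    by (auto simp: override_on_def fun_eq_iff)
  then show "average_out g B x = average_out g B y"
    by (simp add: average_out_def)
qed

lemma measurable_section:
  assumes "g \<in> borel_measurable P"
  shows "(\<lambda>y. g (override_on x y A)) \<in> borel_measurable P"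
proof -
  have "(\<lambda>y. override_on x y A) \<in> measurable P P"
  proof (rule measurable_to_P)
    show "(\<lambda>y. override_on x y A i) \<in> borel_measurable P" for i
      by (cases "i \<in> A") (simp_all add: override_on_def measurable_coordinate)
  qed
  then show ?thesis
    using assms by (rule measurable_compose)
qed

lemma measurable_average_out:
  assumes "g \<in> borel_measurable P"
  shows "average_out g B \<in> borel_measurable P"
  unfolding average_out_def[abs_def]
  by (rule P.borel_measurable_lebesgue_integral) (use measurable_mixed[OF assms, of "- B"] in \<open>simp add: case_prod_beta\<close>)

lemma average_out_bounded:
  assumes "g \<in> borel_measurable P" "\<And>x. \<bar>g x\<bar> \<le> K"
  shows "\<bar>average_out g B x\<bar> \<le> K"
  using P.norm_expectation_bounded[OF measurable_section[OF assms(1)], of x "- B" K] assms(2)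
  by (simp add: average_out_def)

lemma sqint_average_out:
  assumes "g \<in> borel_measurable P" "\<And>x. \<bar>g x\<bar> \<le> K"
  shows "sqint P (average_out g B)"
  by (rule P.sqint_bounded) (use measurable_average_out[OF assms(1)] average_out_bounded[OF assms] in auto)

text \<open>Jensen's inequality under the integral over the resampled coordinates.\<close>

lemma l2norm_diff_average_out_le:
  assumes f: "sqint P f" and g: "g \<in> borel_measurable P" "\<And>x. \<bar>g x\<bar> \<le> K"
  shows "l2norm P (\<lambda>x. f x - average_out g B x) \<le> l2norm PP (\<lambda>w. mixed f {} w - mixed g (- B) w)"
proof (rule l2norm_le_nn_integral)
  have sg: "sqint P g"
    by (rule P.sqint_bounded) (use g in auto)
  show "sqint P (\<lambda>x. f x - average_out g B x)"
    by (intro sqint_diff f sqint_average_out[OF g])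
  show sfg: "sqint PP (\<lambda>w. mixed f {} w - mixed g (- B) w)"
    by (intro sqint_diff sqint_mixed f sg)
  have "(f x - average_out g B x)\<^sup>2 = (\<integral>y. f x - g (override_on x y (- B)) \<partial>P)\<^sup>2" for x
    using P.integrable_bounded[OF measurable_section[OF g(1)], of x "- B" K] g(2)
    by (simp add: average_out_def P.prob_space)
  then have "(\<integral>\<^sup>+x. ennreal ((f x - average_out g B x)\<^sup>2) \<partial>P)
      \<le> (\<integral>\<^sup>+x. \<integral>\<^sup>+y. ennreal ((f x - g (override_on x y (- B)))\<^sup>2) \<partial>P \<partial>P)"
  proof (intro nn_integral_mono, simp only:)
    fix x
    show "ennreal ((\<integral>y. f x - g (override_on x y (- B)) \<partial>P)\<^sup>2)
        \<le> (\<integral>\<^sup>+y. ennreal ((f x - g (override_on x y (- B)))\<^sup>2) \<partial>P)"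
    proof (rule P.square_expectation_le)
      show "(\<lambda>y. f x - g (override_on x y (- B))) \<in> borel_measurable P"
        by (intro borel_measurable_diff borel_measurable_const measurable_section g)
      show "\<bar>f x - g (override_on x y (- B))\<bar> \<le> \<bar>f x\<bar> + K" for y
        using g(2)[of "override_on x y (- B)"] abs_triangle_ineq4[of "f x" "g (override_on x y (- B))"] by linarith
    qed
  qed
  also have "\<dots> = (\<integral>\<^sup>+w. ennreal ((mixed f {} w - mixed g (- B) w)\<^sup>2) \<partial>PP)"
    using P.nn_integral_fst[of "\<lambda>w. ennreal ((mixed f {} w - mixed g (- B) w)\<^sup>2)" P]
      sqint_measurable[OF sfg] by simp
  finally show "(\<integral>\<^sup>+x. ennreal ((f x - average_out g B x)\<^sup>2) \<partial>P)
      \<le> (\<integral>\<^sup>+w. ennreal ((mixed f {} w - mixed g (- B) w)\<^sup>2) \<partial>PP)" .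
qed

text \<open>If \<open>j\<close> is not in \<open>B\<close>, the left-hand side vanishes. Otherwise resampling \<open>j\<close> commutes with
resampling the complement of \<open>B\<close>, so the difference is an average of the differences for \<open>g\<close>, taken
at a point that again has the law of the noise; Jensen's and Tonelli's theorems give the bound.\<close>

lemma influence_average_out_le:
  assumes g: "g \<in> borel_measurable P" "\<And>x. \<bar>g x\<bar> \<le> K"
  shows "influence (average_out g B) j \<le> influence g j"
proof (cases "j \<in> B")
  case False
  then have "mixed (average_out g B) {} w = mixed (average_out g B) {j} w" for w
    by (intro depends_onD[OF depends_on_average_out]) (auto simp: override_on_def)
  then have "influence (average_out g B) j = 0"
    by (simp add: influence_def l2norm_def)
  then show ?thesis
    by (simp add: influence_def l2norm_nonneg)
next
  case True
  have sg: "sqint P g"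
    by (rule P.sqint_bounded) (use g in auto)
  let ?k = "\<lambda>z x'. g z - g (override_on z x' {j})"
  let ?m = "\<lambda>x y. override_on x y (- B)"
  have k_meas: "(\<lambda>w. ?k (fst w) (snd w)) \<in> borel_measurable PP"
    using measurable_mixed[OF g(1), of "{j}"]
    by (intro borel_measurable_diff measurable_compose[OF measurable_fst g(1)]) simp_all
  then have kk_meas: "(\<lambda>w. ennreal ((?k (fst w) (snd w))\<^sup>2)) \<in> borel_measurable PP"
    by measurable
  have inner: "average_out g B x - average_out g B (override_on x x' {j}) = (\<integral>y. ?k (?m x y) x' \<partial>P)" for x x'
  proof -
    have "override_on (override_on x x' {j}) y (- B) = override_on (?m x y) x' {j}" for y
      using True by (auto simp: override_on_def fun_eq_iff)
    then have "average_out g B (override_on x x' {j}) = (\<integral>y. g (override_on (?m x y) x' {j}) \<partial>P)"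
      and "(\<lambda>y. g (override_on (?m x y) x' {j})) = (\<lambda>y. g (override_on (override_on x x' {j}) y (- B)))"
      by (simp_all add: average_out_def)
    moreover have "integrable P (\<lambda>y. g (override_on z y (- B)))" for z
      using P.integrable_bounded[OF measurable_section[OF g(1)], of z "- B" K] g(2) by simp
    ultimately show ?thesis
      unfolding average_out_def[of g B x] by simp
  qed
  show ?thesis
    unfolding influence_def
  proof (rule l2norm_le_nn_integral)
    show "sqint PP (change (average_out g B) {j})"
      by (intro sqint_diff sqint_mixed sqint_average_out[OF g])
    show "sqint PP (change g {j})"
      by (intro sqint_diff sqint_mixed sg)
    have meas3: "(\<lambda>(x', y). ennreal ((?k (?m x y) x')\<^sup>2)) \<in> borel_measurable PP" for x
    proof -
      have "(\<lambda>w. (?m x (snd w), fst w)) \<in> measurable PP PP"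
        by (intro measurable_Pair measurable_override_on measurable_fst measurable_snd measurable_const)
           (simp add: space_P)
      from measurable_compose[OF this kk_meas] show ?thesis
        by (simp add: case_prod_beta)
    qed
    have "(\<integral>\<^sup>+w. ennreal ((change (average_out g B) {j} w)\<^sup>2) \<partial>PP)
        = (\<integral>\<^sup>+w. ennreal ((\<integral>y. ?k (?m (fst w) y) (snd w) \<partial>P)\<^sup>2) \<partial>PP)"
      by (simp add: inner)
    also have "\<dots> \<le> (\<integral>\<^sup>+w. \<integral>\<^sup>+y. ennreal ((?k (?m (fst w) y) (snd w))\<^sup>2) \<partial>P \<partial>PP)"
    proof (intro nn_integral_mono P.square_expectation_le[where K = "2 * K"])
      fix w :: "('i \<Rightarrow> real) \<times> ('i \<Rightarrow> real)"
      have "(\<lambda>y. (?m (fst w) y, snd w)) \<in> measurable P PP"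
        by (intro measurable_Pair measurable_override_on measurable_ident measurable_const) (simp_all add: space_P)
      from measurable_compose[OF this k_meas]
      show "(\<lambda>y. ?k (?m (fst w) y) (snd w)) \<in> borel_measurable P"
        by simp
      show "\<bar>?k (?m (fst w) y) (snd w)\<bar> \<le> 2 * K" for y
        using g(2)[of "?m (fst w) y"] g(2)[of "override_on (?m (fst w) y) (snd w) {j}"]
          abs_triangle_ineq4[of "g (?m (fst w) y)" "g (override_on (?m (fst w) y) (snd w) {j})"]
        by linarith
    qed
    also have "\<dots> = (\<integral>\<^sup>+x. \<integral>\<^sup>+x'. \<integral>\<^sup>+y. ennreal ((?k (?m x y) x')\<^sup>2) \<partial>P \<partial>P \<partial>P)"
    proof -
      have "(\<lambda>(w, y). ennreal ((?k (?m (fst w) y) (snd w))\<^sup>2)) \<in> borel_measurable (PP \<Otimes>\<^sub>M P)"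
      proof -
        have "(\<lambda>v. (?m (fst (fst v)) (snd v), snd (fst v))) \<in> measurable (PP \<Otimes>\<^sub>M P) PP"
          by (intro measurable_Pair measurable_override_on measurable_snd
              measurable_compose[OF measurable_fst] measurable_fst)
        from measurable_compose[OF this kk_meas] show ?thesis
          by (simp add: case_prod_beta)
      qed
      then have "(\<lambda>w. \<integral>\<^sup>+y. ennreal ((?k (?m (fst w) y) (snd w))\<^sup>2) \<partial>P) \<in> borel_measurable PP"
        by (rule P.borel_measurable_nn_integral)
      from P.nn_integral_fst[OF this] show ?thesis by simp
    qed
    also have "\<dots> = (\<integral>\<^sup>+x. \<integral>\<^sup>+y. \<integral>\<^sup>+x'. ennreal ((?k (?m x y) x')\<^sup>2) \<partial>P \<partial>P \<partial>P)"
      by (rule nn_integral_cong) (rule PP.Fubini'[OF meas3, symmetric])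
    also have "\<dots> = (\<integral>\<^sup>+w. \<integral>\<^sup>+x'. ennreal ((?k (?m (fst w) (snd w)) x')\<^sup>2) \<partial>P \<partial>PP)"
    proof -
      have "(\<lambda>z. \<integral>\<^sup>+x'. ennreal ((?k z x')\<^sup>2) \<partial>P) \<in> borel_measurable P"
        using P.borel_measurable_nn_integral_fst[OF kk_meas] by simp
      from measurable_compose[OF measurable_override_on_PP this, of "- B"]
      show ?thesis
        using P.nn_integral_fst[of "\<lambda>w. \<integral>\<^sup>+x'. ennreal ((?k (?m (fst w) (snd w)) x')\<^sup>2) \<partial>P" P] by simp
    qed
    also have "\<dots> = (\<integral>\<^sup>+z. \<integral>\<^sup>+x'. ennreal ((?k z x')\<^sup>2) \<partial>P \<partial>P)"
    proof -
      have "(\<lambda>z. \<integral>\<^sup>+x'. ennreal ((?k z x')\<^sup>2) \<partial>P) \<in> borel_measurable P"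
        using P.borel_measurable_nn_integral_fst[OF kk_meas] by simp
      from nn_integral_distr[OF measurable_override_on_PP, of "\<lambda>z. \<integral>\<^sup>+x'. ennreal ((?k z x')\<^sup>2) \<partial>P" "- B"] this
      show ?thesis
        by (simp add: distr_override_on)
    qed
    also have "\<dots> = (\<integral>\<^sup>+w. ennreal ((change g {j} w)\<^sup>2) \<partial>PP)"
      using P.nn_integral_fst[OF kk_meas] by simp
    finally show "(\<integral>\<^sup>+w. ennreal ((change (average_out g B) {j} w)\<^sup>2) \<partial>PP)
        \<le> (\<integral>\<^sup>+w. ennreal ((change g {j} w)\<^sup>2) \<partial>PP)" .
  qed
qed

lemma influence_truncate_le:
  assumes "sqint P f"
  shows "influence (\<lambda>x. truncate K (f x)) i \<le> influence f i"
  unfolding influence_def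
  by (intro l2norm_mono sqint_diff sqint_mixed assms AE_I2 truncate_contraction)

lemma influence_diff_le:
  assumes "sqint P f" "sqint P g"
  shows "influence (\<lambda>x. f x - g x) i \<le> influence f i + influence g i"
  using l2norm_triangle_diff[OF sqint_diff[OF sqint_mixed[OF assms(1), of "{}"] sqint_mixed[OF assms(1), of "{i}"]]
      sqint_diff[OF sqint_mixed[OF assms(2), of "{}"] sqint_mixed[OF assms(2), of "{i}"]]]
  unfolding influence_def by (simp add: algebra_simps)

lemma influence_le_l2norm:
  assumes f: "sqint P f"
  shows "influence f i \<le> 2 * l2norm P f"
  using l2norm_triangle_diff[OF sqint_mixed[OF f] sqint_mixed[OF f], of "{}" "{i}"]
    l2norm_mixed[OF sqint_measurable[OF f], of "{}"] l2norm_mixed[OF sqint_measurable[OF f], of "{i}"]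
  unfolding influence_def by simp

lemma influence_minus_const: "influence (\<lambda>x. f x - c) i = influence f i"
  by (simp add: influence_def)

text \<open>Each influence on \<open>G - H\<close>, where \<open>H\<close> is the truncated and averaged function, is at most twice the
influence on \<open>G\<close> and also at most twice \<open>\<parallel>G - H\<parallel>\<close>. The first bound controls the sum outside a finite
set \<open>J\<close>, the second the sum over \<open>J\<close>. Subtracting the mean of \<open>H\<close> changes no influence.\<close>

lemma finite_range_approximation:
  assumes G: "sqint P G" and mean: "P.expectation G = 0"
    and summable: "\<And>A. finite A \<Longrightarrow> (\<Sum>j\<in>A. influence G j) \<le> \<Delta>" and "0 < e"
  obtains h B K where "finite B" "depends_on h B" "h \<in> borel_measurable P" "\<And>x. \<bar>h x\<bar> \<le> K"
    "P.expectation h = 0" "\<And>A. finite A \<Longrightarrow> (\<Sum>j\<in>A. influence (\<lambda>x. G x - h x) j) \<le> e"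
proof -
  have "(\<lambda>j. influence G j) summable_on UNIV"
    by (rule nonneg_bdd_above_summable_on) (use influence_nonneg summable in \<open>auto simp: bdd_above_def\<close>)
  then obtain J where J: "finite J" "\<And>A. finite A \<Longrightarrow> A \<inter> J = {} \<Longrightarrow> (\<Sum>j\<in>A. influence G j) \<le> e / 4"
  proof -
    assume *: "\<And>J. finite J \<Longrightarrow> (\<And>A. finite A \<Longrightarrow> A \<inter> J = {} \<Longrightarrow> (\<Sum>j\<in>A. influence G j) \<le> e / 4) \<Longrightarrow> thesis"
    define S where "S = (SUP A\<in>{A. finite A}. \<Sum>j\<in>A. influence G j)"
    have bdd: "bdd_above ((\<lambda>A. \<Sum>j\<in>A. influence G j) ` {A. finite A})"
      using summable by (auto simp: bdd_above_def)
    have "S - e / 4 < S"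
      using \<open>0 < e\<close> by simp
    then obtain J where J: "finite J" "S - e / 4 < (\<Sum>j\<in>J. influence G j)"
      unfolding S_def by (subst (asm) less_cSUP_iff[OF _ bdd]) auto
    have "(\<Sum>j\<in>A. influence G j) \<le> e / 4" if "finite A" "A \<inter> J = {}" for A
    proof -
      have "(\<Sum>j\<in>A. influence G j) + (\<Sum>j\<in>J. influence G j) = (\<Sum>j\<in>A \<union> J. influence G j)"
        using that J(1) by (simp add: sum.union_disjoint)
      also have "\<dots> \<le> S"
        unfolding S_def using that J(1) by (intro cSUP_upper bdd) simp
      finally show ?thesis
        using J(2) by linarith
    qed
    then show thesis
      using *[OF J(1)] by blast
  qed
  \<comment> \<open>Below, each influence on \<open>G - H\<close> is at most \<open>4 * \<eta> \<le> 8 * \<eta>\<close>; \<open>card J\<close> of them stay below \<open>e / 2\<close>.\<close>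
  define \<eta> where "\<eta> = e / (16 * (real (card J) + 1))"
  have \<eta>: "0 < \<eta>" "8 * \<eta> * real (card J) \<le> e / 2"
    using \<open>0 < e\<close> by (auto simp: \<eta>_def divide_simps)
  obtain n where n: "\<bar>l2norm P (\<lambda>x. G x - truncate (real n) (G x))\<bar> < \<eta>"
    using LIMSEQ_D[OF truncate_tendsto_l2norm[OF G] \<eta>(1)] by auto
  obtain B where B: "finite B" "l2norm PP (change G (- B)) < \<eta>"
    using finitely_approximable_l2norm[OF G \<eta>(1)] by blast
  define g where "g x = truncate (real n) (G x)" for x
  have g: "sqint P g" "g \<in> borel_measurable P" "\<bar>g x\<bar> \<le> real n" for x
    unfolding g_def[abs_def]
    by (auto intro!: sqint_truncate measurable_truncate truncate_bound G sqint_measurable[OF G])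
  define H where "H = average_out g B"
  have H: "sqint P H" "H \<in> borel_measurable P" "\<bar>H x\<bar> \<le> real n" for x
    unfolding H_def using sqint_average_out[OF g(2,3)] measurable_average_out[OF g(2)] average_out_bounded[OF g(2,3)] .
  define m where "m = P.expectation H"
  define h where "h x = H x - m" for x
  have Gg: "sqint P (\<lambda>x. G x - g x)"
    by (intro sqint_diff G g)
  have GH: "l2norm P (\<lambda>x. G x - H x) \<le> 2 * \<eta>"
  proof -
    have "l2norm P (\<lambda>x. G x - H x) \<le> l2norm PP (\<lambda>w. mixed G {} w - mixed g (- B) w)"
      unfolding H_def by (rule l2norm_diff_average_out_le[OF G g(2,3)])
    also have "(\<lambda>w. mixed G {} w - mixed g (- B) w)
        = (\<lambda>w. (change G (- B) w) + mixed (\<lambda>x. G x - g x) (- B) w)"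
      by simp
    also have "l2norm PP \<dots> \<le> l2norm PP (change G (- B)) + l2norm PP (mixed (\<lambda>x. G x - g x) (- B))"
      by (intro l2norm_triangle sqint_mixed[OF Gg] sqint_diff[OF sqint_mixed[OF G] sqint_mixed[OF G]])
    also have "\<dots> \<le> \<eta> + \<eta>"
      using B(2) n unfolding l2norm_mixed[OF sqint_measurable[OF Gg]] by (simp add: g_def)
    finally show ?thesis by simp
  qed
  have sGH: "sqint P (\<lambda>x. G x - H x)"
    by (intro sqint_diff G H)
  have m: "\<bar>m\<bar> \<le> 2 * \<eta>"
  proof -
    have "P.expectation (\<lambda>x. G x - H x) = - m"
      using P.sqint_integrable[OF G] P.sqint_integrable[OF H(1)] mean by (simp add: m_def)
    then show ?thesis
      using P.l2norm_integral_bound(1)[OF sGH] GH by simp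
  qed
  show thesis
  proof (rule that[of B h "real n + \<bar>m\<bar>"])
    show "depends_on h B"
      unfolding h_def[abs_def] H_def by (rule depends_on_comp[OF depends_on_average_out, of "\<lambda>r. r - m"])
    show "h \<in> borel_measurable P"
      unfolding h_def[abs_def] by (intro borel_measurable_diff H borel_measurable_const)
    show "\<bar>h x\<bar> \<le> real n + \<bar>m\<bar>" for x
      using H(3)[of x] abs_triangle_ineq4[of "H x" m] unfolding h_def by linarith
    show "P.expectation h = 0"
      using P.sqint_integrable[OF H(1)] by (simp add: h_def[abs_def] m_def P.prob_space)
    fix A :: "'i set" assume A: "finite A"
    have eq: "influence (\<lambda>x. G x - h x) j = influence (\<lambda>x. G x - H x) j" for j
      using influence_minus_const[of "\<lambda>x. G x - H x" "- m" j] by (simp add: h_def algebra_simps)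
    have "(\<Sum>j\<in>A. influence (\<lambda>x. G x - H x) j)
        = (\<Sum>j\<in>A \<inter> J. influence (\<lambda>x. G x - H x) j) + (\<Sum>j\<in>A - J. influence (\<lambda>x. G x - H x) j)"
      using A by (rule sum.Int_Diff)
    also have "(\<Sum>j\<in>A \<inter> J. influence (\<lambda>x. G x - H x) j) \<le> (\<Sum>j\<in>J. 8 * \<eta>)"
    proof -
      have "(\<Sum>j\<in>A \<inter> J. influence (\<lambda>x. G x - H x) j) \<le> (\<Sum>j\<in>J. influence (\<lambda>x. G x - H x) j)"
        using J(1) by (intro sum_mono2 influence_nonneg) auto
      also have "\<dots> \<le> (\<Sum>j\<in>J. 8 * \<eta>)"
      proof (rule sum_mono)
        show "influence (\<lambda>x. G x - H x) j \<le> 8 * \<eta>" for j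
          using influence_le_l2norm[OF sGH, of j] GH \<eta>(1) by linarith
      qed
      finally show ?thesis .
    qed
    also have "(\<Sum>j\<in>A - J. influence (\<lambda>x. G x - H x) j) \<le> (\<Sum>j\<in>A - J. 2 * influence G j)"
    proof (rule sum_mono)
      show "influence (\<lambda>x. G x - H x) j \<le> 2 * influence G j" for j
      proof -
        have "influence H j \<le> influence G j"
          unfolding H_def g_def[abs_def]
          using influence_average_out_le[OF g(2,3), of B j] influence_truncate_le[OF G, of "real n" j]
          unfolding g_def[abs_def] by (rule order_trans)
        then show ?thesis
          using influence_diff_le[OF G H(1), of j] by linarith
      qed
    qed
    finally have "(\<Sum>j\<in>A. influence (\<lambda>x. G x - H x) j) \<le> 8 * \<eta> * real (card J) + 2 * (\<Sum>j\<in>A - J. influence G j)"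
      by (simp add: sum_distrib_left ac_simps)
    also have "\<dots> \<le> e / 2 + 2 * (e / 4)"
    proof (intro add_mono \<eta>(2) mult_left_mono J(2))
      show "finite (A - J)" "(A - J) \<inter> J = {}"
        using A by auto
    qed simp
    finally show "(\<Sum>j\<in>A. influence (\<lambda>x. G x - h x) j) \<le> e"
      unfolding eq by simp
  qed (rule B)
qed

end

section \<open>The central limit theorem for linear statistics\<close>

lemma exp_minus_Lipschitz:
  fixes x y :: real
  assumes "0 \<le> x" "0 \<le> y"
  shows "\<bar>exp (- x) - exp (- y)\<bar> \<le> \<bar>x - y\<bar>"
proof -
  have *: "exp (- a) - exp (- b) \<le> b - a" if "0 \<le> a" "a \<le> b" for a b :: real
  proof -
    have "exp (- a) - exp (- b) = exp (- a) * (1 - exp (- (b - a)))"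
      by (simp add: algebra_simps flip: exp_add)
    also have "\<dots> \<le> 1 * (b - a)"
    proof (rule mult_mono)
      show "1 - exp (- (b - a)) \<le> b - a"
        using exp_ge_add_one_self[of "- (b - a)"] by linarith
    qed (use that in auto)
    finally show ?thesis by simp
  qed
  show ?thesis
    using *[of x y] *[of y x] assms by (cases "x \<le> y") (auto simp: abs_if)
qed

context lattice_noise
begin

text \<open>The three parts of the error are the replacement of \<open>G\<close> by \<open>h\<close>, which costs \<open>\<bar>u\<bar> * C * \<delta>\<close>, the
normal approximation for \<open>h\<close>, which tends to zero, and the difference between the variances of the
two sums, which is again of the order of \<open>\<delta>\<close>.\<close>

lemma linear_statistic_CLT:
  fixes w :: "nat \<Rightarrow> 'i \<Rightarrow> real" and T :: "nat \<Rightarrow> 'i set" and G :: "('i \<Rightarrow> real) \<Rightarrow> real"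
  assumes G: "sqint P G" and mean: "P.expectation G = 0"
    and summable: "\<And>A. finite A \<Longrightarrow> (\<Sum>j\<in>A. influence G j) \<le> \<Delta>"
    and T: "\<And>n. finite (T n)" "filterlim (\<lambda>n. card (T n)) at_top sequentially"
    and w: "\<forall>\<^sub>F n in sequentially. \<forall>t\<in>T n. \<bar>w n t\<bar> \<le> C / sqrt (real (card (T n)))" and C: "0 \<le> C"
    and var: "(\<lambda>n. l2norm P (linear_statistic (w n) (T n) G)) \<longlonglongrightarrow> 1"
  shows "(\<lambda>n. P.expectation (\<lambda>x. iexp (u * linear_statistic (w n) (T n) G x)))
    \<longlonglongrightarrow> of_real (exp (- (u\<^sup>2) / 2))"
proof (rule LIMSEQ_I)
  fix e :: real assume "0 < e"
  define D where "D = \<bar>u\<bar> * C + 2 * (C + 1) * u\<^sup>2 + 1"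
  have D: "0 < D"
    using C by (auto simp: D_def intro!: add_nonneg_pos add_nonneg_nonneg mult_nonneg_nonneg)
  \<comment> \<open>The first bound keeps the standard deviation of the approximating sum within \<open>1\<close> of \<open>1\<close>, the
        second makes the total error \<open>\<delta> * D\<close> smaller than \<open>e\<close>.\<close>
  define \<delta> where "\<delta> = min (1 / (C + 1)) (e / (2 * D))"
  have \<delta>: "0 < \<delta>" "(C + 1) * \<delta> \<le> 1" "\<delta> * D < e"
  proof -
    show "0 < \<delta>"
      using C D \<open>0 < e\<close> by (simp add: \<delta>_def)
    have "\<delta> \<le> 1 / (C + 1)"
      by (simp add: \<delta>_def)
    then show "(C + 1) * \<delta> \<le> 1"
      using C by (simp add: pos_le_divide_eq mult.commute)
    have "\<delta> \<le> e / (2 * D)"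
      by (simp add: \<delta>_def)
    then have "\<delta> * D \<le> e / 2"
      using D by (simp add: field_simps)
    then show "\<delta> * D < e"
      using \<open>0 < e\<close> by simp
  qed
  obtain h B K where B: "finite B" and h: "depends_on h B" "h \<in> borel_measurable P" "\<And>x. \<bar>h x\<bar> \<le> K"
    "P.expectation h = 0" and small: "\<And>A. finite A \<Longrightarrow> (\<Sum>j\<in>A. influence (\<lambda>x. G x - h x) j) \<le> \<delta>"
    by (rule finite_range_approximation[OF G mean summable \<delta>(1)]) (assumption, rule that)
  have sh: "sqint P h"
    by (rule P.sqint_bounded) (use h in auto)
  have sGh: "sqint P (\<lambda>x. G x - h x)"
    by (intro sqint_diff G sh)
  have mean': "P.expectation (\<lambda>x. G x - h x) = 0"
    using P.sqint_integrable[OF G] P.sqint_integrable[OF sh] mean h(4) by simp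
  have card_real: "filterlim (\<lambda>n. real (card (T n))) at_top sequentially"
    by (rule filterlim_compose[OF filterlim_real_sequentially T(2)])
  define rate where "rate r = 3 * (real (card B) ^ 4)\<^sup>2 * r * (C / sqrt r * K) ^ 3 * \<bar>u\<bar> ^ 3" for r
  have "(rate \<longlongrightarrow> 0) at_top"
  proof (rule Lim_transform_eventually)
    show "((\<lambda>r. (3 * (real (card B) ^ 4)\<^sup>2 * (C * K) ^ 3 * \<bar>u\<bar> ^ 3) / sqrt r) \<longlongrightarrow> 0) at_top"
      by (rule tendsto_divide_0[OF tendsto_const])
         (rule filterlim_at_top_imp_at_infinity[OF sqrt_at_top])
    show "\<forall>\<^sub>F r in at_top. (3 * (real (card B) ^ 4)\<^sup>2 * (C * K) ^ 3 * \<bar>u\<bar> ^ 3) / sqrt r = rate r"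
      using eventually_gt_at_top[of "0::real"]
    proof eventually_elim
      case (elim r)
      have "r = sqrt r * sqrt r"
        using elim by simp
      then show ?case
        using elim unfolding rate_def by (simp add: power_mult_distrib power_divide power3_eq_cube divide_simps)
    qed
  qed
  then have "(\<lambda>n. rate (real (card (T n)))) \<longlonglongrightarrow> 0"
    by (rule filterlim_compose[OF _ card_real])
  then have "\<forall>\<^sub>F n in sequentially. rate (real (card (T n))) < \<delta>"
    using \<delta>(1) by (rule order_tendstoD(2))
  moreover have "\<forall>\<^sub>F n in sequentially. \<bar>l2norm P (linear_statistic (w n) (T n) G) - 1\<bar> < \<delta>"
    using tendstoD[OF var \<delta>(1)] by (simp add: dist_real_def)
  moreover have "\<forall>\<^sub>F n in sequentially. 0 < real (card (T n))"
    using card_real unfolding filterlim_at_top_dense by blast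
  ultimately have "\<forall>\<^sub>F n in sequentially.
      norm (P.expectation (\<lambda>x. iexp (u * linear_statistic (w n) (T n) G x)) - of_real (exp (- (u\<^sup>2) / 2))) < e"
    using w
  proof eventually_elim
    case (elim n)
    let ?c = "C / sqrt (real (card (T n)))"
    let ?G = "linear_statistic (w n) (T n) G" and ?h = "linear_statistic (w n) (T n) h"
    let ?b = "l2norm P ?h"
    have c: "0 \<le> ?c" and wn: "\<And>t. t \<in> T n \<Longrightarrow> \<bar>w n t\<bar> \<le> ?c"
      using C elim by auto
    have diff: "(\<lambda>x. ?G x - ?h x) = linear_statistic (w n) (T n) (\<lambda>x. G x - h x)"
      by (simp add: linear_statistic_def fun_eq_iff sum_subtractf right_diff_distrib)
    have "l2norm P (\<lambda>x. ?G x - ?h x) \<le> ?c * sqrt (real (card (T n))) * \<delta>"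
      unfolding diff by (rule l2norm_linear_statistic_le[OF sGh mean' T(1) wn c small])
    then have l2: "l2norm P (\<lambda>x. ?G x - ?h x) \<le> C * \<delta>"
      using elim by simp
    have sG: "sqint P ?G" and sh': "sqint P ?h"
      by (intro sqint_linear_statistic G sh)+
    have d1: "norm (P.expectation (\<lambda>x. iexp (u * ?G x)) - P.expectation (\<lambda>x. iexp (u * ?h x))) \<le> \<bar>u\<bar> * (C * \<delta>)"
    proof -
      have int: "integrable P (\<lambda>x. iexp (u * ?G x))" "integrable P (\<lambda>x. iexp (u * ?h x))"
        by (rule P.integrable_bounded[where B = 1];
            use P.iexp_measurable[OF sqint_measurable[OF sG]] P.iexp_measurable[OF sqint_measurable[OF sh']] in simp)+
      have "norm (P.expectation (\<lambda>x. iexp (u * ?G x)) - P.expectation (\<lambda>x. iexp (u * ?h x)))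
          = norm (P.expectation (\<lambda>x. iexp (u * ?G x) - iexp (u * ?h x)))"
        using int by simp
      also have "\<dots> \<le> P.expectation (\<lambda>x. norm (iexp (u * ?G x) - iexp (u * ?h x)))"
        by (rule integral_norm_bound)
      also have "\<dots> \<le> P.expectation (\<lambda>x. \<bar>u\<bar> * \<bar>?G x - ?h x\<bar>)"
      proof (rule integral_mono)
        show "integrable P (\<lambda>x. \<bar>u\<bar> * \<bar>?G x - ?h x\<bar>)"
          using P.sqint_integrable[OF sqint_diff[OF sG sh']] by simp
        show "norm (iexp (u * ?G x) - iexp (u * ?h x)) \<le> \<bar>u\<bar> * \<bar>?G x - ?h x\<bar>" for x
          using norm_iexp_diff[of "u * ?G x" "u * ?h x"] unfolding right_diff_distrib[symmetric] abs_mult .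
      qed (intro integrable_norm Bochner_Integration.integrable_diff int)
      also have "\<dots> = \<bar>u\<bar> * P.expectation (\<lambda>x. \<bar>?G x - ?h x\<bar>)"
        by simp
      also have "\<dots> \<le> \<bar>u\<bar> * (C * \<delta>)"
        using P.l2norm_integral_bound(2)[OF sqint_diff[OF sG sh']] l2 by (intro mult_left_mono) auto
      finally show ?thesis .
    qed
    have d2: "norm (P.expectation (\<lambda>x. iexp (u * ?h x)) - of_real (exp (- ?b\<^sup>2 * u\<^sup>2 / 2))) < \<delta>"
    proof (rule le_less_trans[OF _ elim(1)])
      show "norm (P.expectation (\<lambda>x. iexp (u * ?h x)) - of_real (exp (- ?b\<^sup>2 * u\<^sup>2 / 2)))
          \<le> rate (real (card (T n)))"
        unfolding rate_def
        by (rule linear_statistic_characteristic_function[OF h(2,1,3,4) B T(1)]) (use wn c in auto)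
    qed
    have d3: "norm (complex_of_real (exp (- ?b\<^sup>2 * u\<^sup>2 / 2)) - of_real (exp (- (u\<^sup>2) / 2)))
        \<le> 2 * ((C + 1) * \<delta>) * u\<^sup>2"
    proof -
      have "l2norm P ?G \<le> l2norm P (\<lambda>x. ?G x - ?h x) + ?b"
        using l2norm_triangle[OF sqint_diff[OF sG sh'] sh'] by simp
      moreover have "?b \<le> l2norm P (\<lambda>x. ?G x - ?h x) + l2norm P ?G"
        using l2norm_triangle[OF sqint_diff[OF sh' sG] sG]
        by (simp add: l2norm_minus_commute[of P ?h])
      ultimately have "\<bar>?b - 1\<bar> \<le> C * \<delta> + \<delta>"
        using l2 elim(2) by linarith
      then have b: "\<bar>?b - 1\<bar> \<le> (C + 1) * \<delta>"
        by (simp add: algebra_simps)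
      then have "\<bar>?b + 1\<bar> \<le> 3"
        using \<delta>(2) by linarith
      have "\<bar>?b\<^sup>2 - 1\<bar> = \<bar>?b - 1\<bar> * \<bar>?b + 1\<bar>"
        by (simp add: power2_eq_square algebra_simps flip: abs_mult)
      also have "\<dots> \<le> ((C + 1) * \<delta>) * 3"
        using b \<open>\<bar>?b + 1\<bar> \<le> 3\<close> by (intro mult_mono) auto
      finally have b2: "\<bar>?b\<^sup>2 - 1\<bar> \<le> ((C + 1) * \<delta>) * 3" .
      have "\<bar>exp (- (?b\<^sup>2 * u\<^sup>2 / 2)) - exp (- (u\<^sup>2 / 2))\<bar> \<le> \<bar>?b\<^sup>2 * u\<^sup>2 / 2 - u\<^sup>2 / 2\<bar>"
        by (rule exp_minus_Lipschitz) simp_all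
      also have "\<dots> = \<bar>?b\<^sup>2 - 1\<bar> * (u\<^sup>2 / 2)"
      proof -
        have "?b\<^sup>2 * u\<^sup>2 / 2 - u\<^sup>2 / 2 = (?b\<^sup>2 - 1) * (u\<^sup>2 / 2)"
          by (simp add: left_diff_distrib)
        then show ?thesis
          by (simp only: abs_mult) simp
      qed
      also have "\<dots> \<le> ((C + 1) * \<delta>) * 3 * (u\<^sup>2 / 2)"
        using b2 by (intro mult_right_mono) auto
      also have "\<dots> \<le> 2 * ((C + 1) * \<delta>) * u\<^sup>2"
        using C \<delta>(1) by (simp add: mult_nonneg_nonneg)
      finally show ?thesis
        by (simp flip: of_real_diff)
    qed
    have "norm (P.expectation (\<lambda>x. iexp (u * ?G x)) - of_real (exp (- (u\<^sup>2) / 2)))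
        < \<bar>u\<bar> * (C * \<delta>) + \<delta> + 2 * ((C + 1) * \<delta>) * u\<^sup>2"
      using norm_diff_triangle_le[OF norm_diff_triangle_le[OF d1 order.refl] d3] d2 by linarith
    also have "\<dots> = \<delta> * D"
      by (simp add: D_def algebra_simps)
    finally show ?case
      using \<delta>(3) by linarith
  qed
  then show "\<exists>no. \<forall>n\<ge>no. norm (P.expectation (\<lambda>x. iexp (u * linear_statistic (w n) (T n) G x))
      - of_real (exp (- (u\<^sup>2) / 2))) < e"
    unfolding eventually_sequentially .
qed

end

section \<open>Trigonometric sums over the grid\<close>

lemma fourier_freq_add: "fourier_freq d1 d2 (j + k) = fourier_freq d1 d2 j + fourier_freq d1 d2 k"
  by (simp add: fourier_freq_def add_divide_distrib distrib_left)

lemma fourier_freq_minus: "fourier_freq d1 d2 (- j) = - fourier_freq d1 d2 j"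
  by (simp add: fourier_freq_def)

lemma site_vec_add: "site_vec (s + t) = site_vec s + site_vec t"
  by (simp add: site_vec_def)

lemma finite_grid: "finite (grid d1 d2)"
  by (simp add: grid_def)

lemma card_grid: "card (grid d1 d2) = d1 * d2"
  by (simp add: grid_def card_cartesian_product)

text \<open>A geometric sum over all powers of a root of unity.\<close>

lemma sum_cis_period:
  assumes "0 < d"
  shows "(\<Sum>t\<in>{1..int d}. cis (2 * pi * of_int k / of_nat d * of_int t))
    = (if int d dvd k then of_nat d else 0)"
proof -
  define z where "z = cis (2 * pi * of_int k / of_nat d)"
  have "{1..int d} = int ` {1..d}"
    by (simp add: image_int_atLeastAtMost)
  moreover have "cis (2 * pi * of_int k / of_nat d * of_int (int t)) = z ^ t" for t :: nat
    unfolding z_def Complex.DeMoivre by (rule arg_cong[where f = cis]) simp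
  ultimately have eq: "(\<Sum>t\<in>{1..int d}. cis (2 * pi * of_int k / of_nat d * of_int t)) = (\<Sum>t\<in>{1..d}. z ^ t)"
    by (simp only: sum.reindex inj_on_of_nat comp_def)
  show ?thesis
  proof (cases "int d dvd k")
    case True
    then obtain m where "k = int d * m" ..
    then have "z = cis (2 * pi * of_int m)"
      unfolding z_def using assms by (intro arg_cong[where f = cis]) simp
    also have "\<dots> = 1"
      by (rule cis_multiple_2pi) simp
    finally have "z = 1" .
    then show ?thesis
      unfolding eq using True by simp
  next
    case False
    have "z \<noteq> 1"
    proof
      assume "z = 1"
      then have "cos (2 * pi * of_int k / of_nat d) = 1"
        by (simp add: z_def complex_eq_iff)
      then obtain m :: int where "2 * pi * of_int k / of_nat d = of_int m * 2 * pi"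
        using cos_one_2pi_int by blast
      then have "real_of_int k = real_of_int (int d * m)"
        using assms by (simp add: field_simps)
      then have "k = int d * m"
        by (simp only: of_int_eq_iff)
      with False show False by simp
    qed
    have "z ^ d = cis (2 * pi * of_int k)"
      unfolding z_def Complex.DeMoivre using assms by (intro arg_cong[where f = cis]) simp
    also have "\<dots> = 1"
      by (rule cis_multiple_2pi) simp
    finally have "z ^ d = 1" .
    have "(\<Sum>t\<in>{1..d}. z ^ t) = z * (\<Sum>t<d. z ^ t)"
      by (simp add: sum.atLeast1_atMost_eq sum_distrib_left)
    also have "\<dots> = 0"
      using \<open>z \<noteq> 1\<close> \<open>z ^ d = 1\<close> by (simp add: geometric_sum)
    finally show ?thesis
      unfolding eq using False by simp
  qed
qed

lemma sum_cos_grid: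
  assumes "0 < d1" "0 < d2"
  shows "(\<Sum>t\<in>grid d1 d2. cos (fourier_freq d1 d2 k \<bullet> site_vec t + \<phi>))
    = (if int d1 dvd fst k \<and> int d2 dvd snd k then real (d1 * d2) * cos \<phi> else 0)"
proof -
  let ?e = "\<lambda>d k t. cis (2 * pi * of_int k / of_nat d * of_int t)"
  have "cos (fourier_freq d1 d2 k \<bullet> site_vec t + \<phi>) = Re (cis \<phi> * (?e d1 (fst k) (fst t) * ?e d2 (snd k) (snd t)))"
    for t
    by (simp add: fourier_freq_def site_vec_def cis_mult add.commute)
  then have "(\<Sum>t\<in>grid d1 d2. cos (fourier_freq d1 d2 k \<bullet> site_vec t + \<phi>))
      = Re (cis \<phi> * (\<Sum>(t1, t2)\<in>{1..int d1} \<times> {1..int d2}. ?e d1 (fst k) t1 * ?e d2 (snd k) t2))"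
    by (simp add: grid_def sum_distrib_left case_prod_beta)
  also have "(\<Sum>(t1, t2)\<in>{1..int d1} \<times> {1..int d2}. ?e d1 (fst k) t1 * ?e d2 (snd k) t2)
      = (\<Sum>t1\<in>{1..int d1}. ?e d1 (fst k) t1) * (\<Sum>t2\<in>{1..int d2}. ?e d2 (snd k) t2)"
    by (simp add: sum_product sum.cartesian_product)
  finally show ?thesis
    unfolding sum_cis_period[OF assms(1)] sum_cis_period[OF assms(2)] by auto
qed

lemma freq_indices_subset_grid:
  assumes "0 < m" "0 < n"
  shows "freq_indices m n \<subseteq> grid m n"
  unfolding freq_indices_def grid_def Let_def using assms
  by (cases "even m"; cases "even n") (auto elim!: evenE oddE)

lemma dvd_sum_range:
  fixes x y :: int
  assumes "m dvd x + y" "1 \<le> x" "x \<le> m" "1 \<le> y" "y \<le> m"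
  shows "x + y = m \<or> x = m \<and> y = m"
proof -
  obtain q where q: "x + y = m * q"
    using assms(1) ..
  have "0 < m"
    using assms by linarith
  have "0 < m * q" "m * q \<le> m * 2"
    using q assms by linarith+
  then have "0 < q" "q \<le> 2"
    using \<open>0 < m\<close> by (simp_all add: zero_less_mult_iff)
  then have "q = 1 \<or> q = 2"
    by linarith
  then show ?thesis
    using q assms by auto
qed

text \<open>The purpose of the index set: it contains at most one of \<open>j\<close> and \<open>- j\<close> modulo \<open>(d1, d2)\<close>, and no
frequency that is its own negative. For entries between \<open>1\<close> and \<open>d\<close>, a sum divisible by \<open>d\<close> is \<open>d\<close>
or \<open>2 * d\<close>, and all cases of the definition exclude this.\<close>

lemma freq_indices_sum_nonzero:
  assumes "0 < m" "0 < n" and j: "j \<in> freq_indices m n" and k: "k \<in> freq_indices m n"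
  shows "\<not> (int m dvd fst (j + k) \<and> int n dvd snd (j + k))"
proof
  assume dvd: "int m dvd fst (j + k) \<and> int n dvd snd (j + k)"
  have "j \<in> grid m n" "k \<in> grid m n"
    using j k freq_indices_subset_grid[OF assms(1,2)] by auto
  then have "fst j + fst k = int m \<or> fst j = int m \<and> fst k = int m"
    and "snd j + snd k = int n \<or> snd j = int n \<and> snd k = int n"
    using dvd_sum_range[of "int m" "fst j" "fst k"] dvd_sum_range[of "int n" "snd j" "snd k"] dvd
    by (simp_all add: grid_def mem_Times_iff)
  then show False
    using j k unfolding freq_indices_def Let_def
    by (cases "even m"; cases "even n") (auto elim!: evenE oddE simp: mem_Times_iff)
qed

lemma freq_indices_diff_nonzero:
  assumes "0 < m" "0 < n" and j: "j \<in> freq_indices m n" and k: "k \<in> freq_indices m n" and "j \<noteq> k"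
  shows "\<not> (int m dvd fst (j - k) \<and> int n dvd snd (j - k))"
proof
  assume dvd: "int m dvd fst (j - k) \<and> int n dvd snd (j - k)"
  have *: "x = y" if "1 \<le> x" "x \<le> d" "1 \<le> y" "y \<le> d" "d dvd x - y" for x y d :: int
  proof (rule ccontr)
    assume "x \<noteq> y"
    then have "\<bar>d\<bar> \<le> \<bar>x - y\<bar>"
      using that(5) by (intro dvd_imp_le_int) auto
    then show False
      using that by linarith
  qed
  have "j \<in> grid m n" "k \<in> grid m n"
    using j k freq_indices_subset_grid[OF assms(1,2)] by auto
  then have "fst j = fst k" "snd j = snd k"
    using *[of "fst j" "int m" "fst k"] *[of "snd j" "int n" "snd k"] dvd
    by (simp_all add: grid_def mem_Times_iff)
  then show False
    using \<open>j \<noteq> k\<close> by (simp add: prod_eq_iff)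
qed

text \<open>Both kinds of coefficients are cosines, up to a phase: \<open>sin (- x) = cos (x + pi / 2)\<close>.\<close>

definition phase :: "nat \<Rightarrow> real" where
  "phase k = (if k = 1 then 0 else pi / 2)"

definition harmonic :: "nat \<Rightarrow> nat \<Rightarrow> site \<times> nat \<Rightarrow> site \<Rightarrow> real" where
  "harmonic d1 d2 a t = cos (fourier_freq d1 d2 (fst a) \<bullet> site_vec t + phase (snd a))"

lemma sum_harmonic:
  assumes "0 < d1" "0 < d2" "a \<in> coeff_indices d1 d2"
  shows "(\<Sum>t\<in>grid d1 d2. harmonic d1 d2 a t) = 0"
proof -
  have "fst a \<in> freq_indices d1 d2"
    using assms(3) by (auto simp: coeff_indices_def)
  from freq_indices_sum_nonzero[OF assms(1,2) this this]
  have "\<not> (int d1 dvd fst (fst a) \<and> int d2 dvd snd (fst a))"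
    by (auto intro: dvd_add)
  then show ?thesis
    unfolding harmonic_def using sum_cos_grid[OF assms(1,2)] by auto
qed

text \<open>The product of the two cosines is half the sum of a cosine of frequency \<open>j - k\<close> and one of
frequency \<open>j + k\<close>. The second always sums to zero, the first unless the frequencies agree.\<close>

lemma sum_harmonic_shift:
  assumes d: "0 < d1" "0 < d2" and a: "a \<in> coeff_indices d1 d2" and b: "b \<in> coeff_indices d1 d2"
  shows "(\<Sum>t\<in>grid d1 d2. harmonic d1 d2 a t * harmonic d1 d2 b (t + h))
    = (if fst a = fst b
       then real (d1 * d2) / 2 * cos (phase (snd a) - phase (snd b) - fourier_freq d1 d2 (fst b) \<bullet> site_vec h)
       else 0)"
proof -
  let ?fr = "fourier_freq d1 d2"
  let ?\<theta> = "?fr (fst b) \<bullet> site_vec h"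
  have j: "fst a \<in> freq_indices d1 d2" and k: "fst b \<in> freq_indices d1 d2"
    using a b by (auto simp: coeff_indices_def)
  have "harmonic d1 d2 a t * harmonic d1 d2 b (t + h)
      = (cos (?fr (fst a + - fst b) \<bullet> site_vec t + (phase (snd a) - phase (snd b) - ?\<theta>))
        + cos (?fr (fst a + fst b) \<bullet> site_vec t + (phase (snd a) + phase (snd b) + ?\<theta>))) / 2" for t
    unfolding harmonic_def cos_times_cos fourier_freq_add fourier_freq_minus site_vec_add
      inner_add_left inner_add_right inner_minus_left
    by (simp add: algebra_simps)
  then have "(\<Sum>t\<in>grid d1 d2. harmonic d1 d2 a t * harmonic d1 d2 b (t + h))
      = ((\<Sum>t\<in>grid d1 d2. cos (?fr (fst a + - fst b) \<bullet> site_vec t + (phase (snd a) - phase (snd b) - ?\<theta>)))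
        + (\<Sum>t\<in>grid d1 d2. cos (?fr (fst a + fst b) \<bullet> site_vec t + (phase (snd a) + phase (snd b) + ?\<theta>)))) / 2"
    by (simp only: sum_divide_distrib[symmetric] sum.distrib)
  also have "(\<Sum>t\<in>grid d1 d2. cos (?fr (fst a + fst b) \<bullet> site_vec t + (phase (snd a) + phase (snd b) + ?\<theta>))) = 0"
    unfolding sum_cos_grid[OF d] by (rule if_not_P) (rule freq_indices_sum_nonzero[OF d j k])
  also have "(\<Sum>t\<in>grid d1 d2. cos (?fr (fst a + - fst b) \<bullet> site_vec t + (phase (snd a) - phase (snd b) - ?\<theta>)))
      = (if fst a = fst b then real (d1 * d2) * cos (phase (snd a) - phase (snd b) - ?\<theta>) else 0)"
    unfolding sum_cos_grid[OF d] using freq_indices_diff_nonzero[OF d j k] by auto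
  finally show ?thesis
    by (simp split: if_splits)
qed

text \<open>A cosine and a sine coefficient of the same frequency are orthogonal without the shift \<open>h\<close>; with
it, their two cross terms are \<open>\<plusminus> sin (\<lambda> \<bullet> h)\<close> and cancel. This is seen by pairing the term \<open>(i, k)\<close>
of the double sum with \<open>(k, i)\<close>.\<close>

lemma harmonic_sum_autocorrelation:
  fixes a :: "'q::finite \<Rightarrow> site \<times> nat" and b :: "'q \<Rightarrow> real"
  assumes d: "0 < d1" "0 < d2" and a: "inj a" "range a \<subseteq> coeff_indices d1 d2"
  defines "u \<equiv> (\<lambda>t. \<Sum>i\<in>UNIV. b i * harmonic d1 d2 (a i) t)"
  shows "(\<Sum>t\<in>grid d1 d2. u t * u (t + h))
    = real (d1 * d2) / 2 * (\<Sum>i\<in>UNIV. (b i)\<^sup>2 * cos (fourier_freq d1 d2 (fst (a i)) \<bullet> site_vec h))"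
proof -
  define m where "m i k = (\<Sum>t\<in>grid d1 d2. harmonic d1 d2 (a i) t * harmonic d1 d2 (a k) (t + h))" for i k
  have mem: "a i \<in> coeff_indices d1 d2" for i
    using a(2) by auto
  have sym: "m i k + m k i
      = (if i = k then real (d1 * d2) * cos (fourier_freq d1 d2 (fst (a i)) \<bullet> site_vec h) else 0)" for i k
  proof (cases "fst (a i) = fst (a k)")
    case False
    then show ?thesis
      by (auto simp: m_def sum_harmonic_shift[OF d mem mem])
  next
    case True
    let ?\<theta> = "fourier_freq d1 d2 (fst (a i)) \<bullet> site_vec h"
    let ?\<Delta> = "phase (snd (a i)) - phase (snd (a k))"
    have "m i k + m k i = real (d1 * d2) / 2 * (cos (?\<Delta> - ?\<theta>) + cos (- ?\<Delta> - ?\<theta>))"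
      by (simp add: m_def sum_harmonic_shift[OF d mem mem] True distrib_left)
    also have "cos (?\<Delta> - ?\<theta>) + cos (- ?\<Delta> - ?\<theta>) = 2 * cos ?\<Delta> * cos ?\<theta>"
      using cos_add[of ?\<Delta> ?\<theta>] cos_diff[of ?\<Delta> ?\<theta>] cos_minus[of "?\<Delta> + ?\<theta>"] by simp
    also have "cos ?\<Delta> = (if i = k then 1 else 0)"
    proof (cases "i = k")
      case False
      then have "snd (a i) \<noteq> snd (a k)"
        using True a(1) by (auto simp: prod_eq_iff inj_def)
      moreover have "snd (a i) \<in> {1, 2}" "snd (a k) \<in> {1, 2}"
        using mem[of i] mem[of k] by (auto simp: coeff_indices_def)
      ultimately show ?thesis
        using False by (auto simp: phase_def)
    qed simp
    finally show ?thesis by simp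
  qed
  have "(\<Sum>t\<in>grid d1 d2. u t * u (t + h)) = (\<Sum>t\<in>grid d1 d2. \<Sum>i\<in>UNIV. \<Sum>k\<in>UNIV.
      b i * b k * (harmonic d1 d2 (a i) t * harmonic d1 d2 (a k) (t + h)))"
    unfolding u_def sum_product by (simp add: ac_simps)
  also have "\<dots> = (\<Sum>i\<in>UNIV. \<Sum>k\<in>UNIV. b i * b k * m i k)"
    unfolding m_def sum_distrib_left by (subst sum.swap, rule sum.cong[OF refl], rule sum.swap)
  finally have eq: "(\<Sum>t\<in>grid d1 d2. u t * u (t + h)) = (\<Sum>i\<in>UNIV. \<Sum>k\<in>UNIV. b i * b k * m i k)" .
  then have "2 * (\<Sum>t\<in>grid d1 d2. u t * u (t + h))
      = (\<Sum>i\<in>UNIV. \<Sum>k\<in>UNIV. b i * b k * m i k) + (\<Sum>i\<in>UNIV. \<Sum>k\<in>UNIV. b k * b i * m k i)"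
    by (subst (2) sum.swap) simp
  also have "\<dots> = (\<Sum>i\<in>UNIV. \<Sum>k\<in>UNIV. b i * b k * (m i k + m k i))"
    by (simp add: algebra_simps flip: sum.distrib)
  also have "\<dots> = (\<Sum>i\<in>UNIV. (b i)\<^sup>2 * (real (d1 * d2) * cos (fourier_freq d1 d2 (fst (a i)) \<bullet> site_vec h)))"
    unfolding sym by (simp add: if_distrib[of "\<lambda>x. _ * x"] power2_eq_square cong: if_cong)
  also have "\<dots> = real (d1 * d2) * (\<Sum>i\<in>UNIV. (b i)\<^sup>2 * cos (fourier_freq d1 d2 (fst (a i)) \<bullet> site_vec h))"
    by (simp add: sum_distrib_left ac_simps)
  finally show ?thesis by simp
qed

lemma spectral_density_cos_series:
  assumes "(\<lambda>j. \<bar>autocov M V j\<bar>) summable_on UNIV"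
  shows "(\<Sum>\<^sub>\<infinity>h\<in>UNIV. autocov M V h * cos (\<theta> \<bullet> site_vec h)) = 4 * pi\<^sup>2 * spectral_density M V \<theta>"
proof -
  let ?f = "\<lambda>j. exp (- \<i> * of_real (\<theta> \<bullet> site_vec j)) * complex_of_real (autocov M V j)"
  have exp_cis: "exp (- (\<i> * of_real r)) = cis (- r)" for r
    by (simp add: cis_conv_exp)
  have "(\<lambda>j. norm (?f j)) summable_on UNIV"
    using assms by (simp add: norm_mult exp_cis)
  then have "?f summable_on UNIV"
    by (rule abs_summable_summable)
  then have "Re (\<Sum>\<^sub>\<infinity>j. ?f j) = (\<Sum>\<^sub>\<infinity>j. Re (?f j))"
    by (rule infsum_Re[symmetric])
  also have "\<dots> = (\<Sum>\<^sub>\<infinity>h\<in>UNIV. autocov M V h * cos (\<theta> \<bullet> site_vec h))"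
    by (simp add: exp_cis mult.commute)
  finally have "Re (\<Sum>\<^sub>\<infinity>j. ?f j) = (\<Sum>\<^sub>\<infinity>h\<in>UNIV. autocov M V h * cos (\<theta> \<bullet> site_vec h))" .
  moreover have "spectral_density M V \<theta> = Re (of_real (1 / (4 * pi\<^sup>2)) * (\<Sum>\<^sub>\<infinity>j. ?f j))"
    by (simp add: spectral_density_def)
  ultimately show ?thesis
    by simp
qed

section \<open>The limiting variance\<close>

lemma card_escape_interval: "card {t \<in> {1..int d}. t + k \<notin> {1..int d}} \<le> nat \<bar>k\<bar>"
proof -
  have "{t \<in> {1..int d}. t + k \<notin> {1..int d}} \<subseteq> (if 0 \<le> k then {int d - k + 1..int d} else {1..- k})"
    by auto
  then have "card {t \<in> {1..int d}. t + k \<notin> {1..int d}} \<le> card (if 0 \<le> k then {int d - k + 1..int d} else {1..- k})"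
    by (intro card_mono) auto
  then show ?thesis
    by (auto split: if_splits)
qed

lemma card_escape_grid:
  "real (card {s \<in> grid d1 d2. s + h \<notin> grid d1 d2}) \<le> \<bar>real_of_int (fst h)\<bar> * real d2 + \<bar>real_of_int (snd h)\<bar> * real d1"
proof -
  let ?A = "{t \<in> {1..int d1}. t + fst h \<notin> {1..int d1}}" and ?B = "{t \<in> {1..int d2}. t + snd h \<notin> {1..int d2}}"
  have "{s \<in> grid d1 d2. s + h \<notin> grid d1 d2} \<subseteq> ?A \<times> {1..int d2} \<union> {1..int d1} \<times> ?B"
    by (auto simp: grid_def mem_Times_iff)
  then have "card {s \<in> grid d1 d2. s + h \<notin> grid d1 d2} \<le> card (?A \<times> {1..int d2} \<union> {1..int d1} \<times> ?B)"
    by (intro card_mono finite_UnI finite_cartesian_product) (auto intro: finite_subset[of _ "{1..int _}"])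
  also have "\<dots> \<le> card (?A \<times> {1..int d2}) + card ({1..int d1} \<times> ?B)"
    by (rule card_Un_le)
  also have "\<dots> = card ?A * d2 + d1 * card ?B"
    by (simp add: card_cartesian_product)
  also have "\<dots> \<le> nat \<bar>fst h\<bar> * d2 + d1 * nat \<bar>snd h\<bar>"
    by (intro add_mono mult_mono card_escape_interval) auto
  finally have "real (card {s \<in> grid d1 d2. s + h \<notin> grid d1 d2}) \<le> real (nat \<bar>fst h\<bar> * d2 + d1 * nat \<bar>snd h\<bar>)"
    by (rule of_nat_mono)
  then show ?thesis
    by (simp add: mult.commute)
qed

lemma infsum_split_bound:
  fixes \<gamma> r :: "'s \<Rightarrow> real"
  assumes \<gamma>: "(\<lambda>h. \<bar>\<gamma> h\<bar>) summable_on UNIV" and r: "\<And>h. \<bar>r h\<bar> \<le> C" and "finite F"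
  shows "\<bar>\<Sum>\<^sub>\<infinity>h. \<gamma> h * r h\<bar> \<le> (\<Sum>h\<in>F. \<bar>\<gamma> h\<bar> * \<bar>r h\<bar>) + C * (\<Sum>\<^sub>\<infinity>h\<in>- F. \<bar>\<gamma> h\<bar>)"
proof -
  have bound: "\<bar>\<gamma> h * r h\<bar> \<le> C * \<bar>\<gamma> h\<bar>" for h
    using mult_left_mono[OF r[of h] abs_ge_zero[of "\<gamma> h"]] by (simp add: abs_mult mult.commute)
  have C\<gamma>: "(\<lambda>h. C * \<bar>\<gamma> h\<bar>) summable_on A" for A
    by (rule summable_on_cmult_right) (rule summable_on_subset_banach[OF \<gamma>], simp)
  have abs: "(\<lambda>h. norm (\<gamma> h * r h)) summable_on A" for A
    by (rule summable_on_comparison_test[OF C\<gamma>[of A]]) (use bound in auto)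
  have "\<bar>\<Sum>\<^sub>\<infinity>h. \<gamma> h * r h\<bar> \<le> (\<Sum>\<^sub>\<infinity>h. \<bar>\<gamma> h * r h\<bar>)"
    using norm_infsum_bound[OF abs[of UNIV]] by simp
  also have "\<dots> = (\<Sum>\<^sub>\<infinity>h\<in>F \<union> - F. \<bar>\<gamma> h * r h\<bar>)"
    by simp
  also have "\<dots> = (\<Sum>\<^sub>\<infinity>h\<in>F. \<bar>\<gamma> h * r h\<bar>) + (\<Sum>\<^sub>\<infinity>h\<in>- F. \<bar>\<gamma> h * r h\<bar>)"
    using abs[of F] abs[of "- F"] by (intro infsum_Un_disjoint) auto
  also have "(\<Sum>\<^sub>\<infinity>h\<in>F. \<bar>\<gamma> h * r h\<bar>) = (\<Sum>h\<in>F. \<bar>\<gamma> h\<bar> * \<bar>r h\<bar>)"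
    using \<open>finite F\<close> by (simp add: abs_mult)
  also have "(\<Sum>\<^sub>\<infinity>h\<in>- F. \<bar>\<gamma> h * r h\<bar>) \<le> (\<Sum>\<^sub>\<infinity>h\<in>- F. C * \<bar>\<gamma> h\<bar>)"
    using abs[of "- F"] by (intro infsum_mono C\<gamma> bound) simp
  also have "\<dots> = C * (\<Sum>\<^sub>\<infinity>h\<in>- F. \<bar>\<gamma> h\<bar>)"
    by (rule infsum_cmult_right')
  finally show ?thesis by simp
qed

lemma infsum_tail_small:
  fixes \<gamma> :: "'s \<Rightarrow> real"
  assumes "(\<lambda>h. \<bar>\<gamma> h\<bar>) summable_on UNIV" "0 < e"
  obtains F where "finite F" "(\<Sum>\<^sub>\<infinity>h\<in>- F. \<bar>\<gamma> h\<bar>) \<le> e"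
proof -
  obtain F where F: "finite F" "dist (\<Sum>h\<in>F. \<bar>\<gamma> h\<bar>) (\<Sum>\<^sub>\<infinity>h. \<bar>\<gamma> h\<bar>) \<le> e"
    using infsum_finite_approximation[OF assms] by blast
  have "(\<Sum>\<^sub>\<infinity>h\<in>F \<union> - F. \<bar>\<gamma> h\<bar>) = (\<Sum>\<^sub>\<infinity>h\<in>F. \<bar>\<gamma> h\<bar>) + (\<Sum>\<^sub>\<infinity>h\<in>- F. \<bar>\<gamma> h\<bar>)"
    by (intro infsum_Un_disjoint summable_on_subset_banach[OF assms(1)]) auto
  then have "(\<Sum>\<^sub>\<infinity>h\<in>- F. \<bar>\<gamma> h\<bar>) \<le> e"
    using F by (simp add: dist_real_def)
  with F(1) show thesis by (rule that)
qed

lemma finite_sum_infsum: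
  fixes f :: "'s \<Rightarrow> 't \<Rightarrow> real"
  assumes "finite T" "\<And>s. s \<in> T \<Longrightarrow> (\<lambda>h. f h s) summable_on A"
  shows "(\<lambda>h. \<Sum>s\<in>T. f h s) summable_on A" "(\<Sum>\<^sub>\<infinity>h\<in>A. \<Sum>s\<in>T. f h s) = (\<Sum>s\<in>T. \<Sum>\<^sub>\<infinity>h\<in>A. f h s)"
proof -
  have "(\<lambda>h. \<Sum>s\<in>T. f h s) summable_on A \<and> (\<Sum>\<^sub>\<infinity>h\<in>A. \<Sum>s\<in>T. f h s) = (\<Sum>s\<in>T. \<Sum>\<^sub>\<infinity>h\<in>A. f h s)"
    using assms by (induction T rule: finite_induct) (auto simp: infsum_add intro: summable_on_add)
  then show "(\<lambda>h. \<Sum>s\<in>T. f h s) summable_on A" "(\<Sum>\<^sub>\<infinity>h\<in>A. \<Sum>s\<in>T. f h s) = (\<Sum>s\<in>T. \<Sum>\<^sub>\<infinity>h\<in>A. f h s)"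
    by auto
qed

text \<open>The circular form also counts the pairs \<open>(s, s + h)\<close> that leave the grid. For fixed \<open>h\<close> there are
at most \<open>\<bar>h1\<bar> * d2 + \<bar>h2\<bar> * d1\<close> of them, which settles the shifts in \<open>F\<close>; for the other shifts
the trivial bound \<open>d1 * d2\<close> is used.\<close>

lemma quadratic_form_minus_circular:
  fixes w :: "site \<Rightarrow> real" and d1 d2 :: nat
  assumes \<gamma>: "(\<lambda>h. \<bar>\<gamma> h\<bar>) summable_on UNIV" and d: "0 < d1" "0 < d2"
    and w: "\<And>t. \<bar>w t\<bar> \<le> C / sqrt (real (d1 * d2))" and F: "finite F"
  shows "\<bar>(\<Sum>\<^sub>\<infinity>h. \<gamma> h * (\<Sum>s\<in>grid d1 d2. w s * w (s + h)))
      - (\<Sum>s\<in>grid d1 d2. \<Sum>t\<in>grid d1 d2. w s * w t * \<gamma> (t - s))\<bar>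
    \<le> C\<^sup>2 * (\<Sum>h\<in>F. \<bar>\<gamma> h\<bar> * (\<bar>real_of_int (fst h)\<bar> / real d1 + \<bar>real_of_int (snd h)\<bar> / real d2))
      + C\<^sup>2 * (\<Sum>\<^sub>\<infinity>h\<in>- F. \<bar>\<gamma> h\<bar>)"
proof -
  let ?T = "grid d1 d2"
  \<comment> \<open>The actual quadratic form, indexed by the shift \<open>h = t - s\<close>; \<open>r h\<close> is what the circular form adds.\<close>
  define z where "z h s = (if s + h \<in> ?T then w s * w (s + h) else 0)" for h s
  define r where "r h = (\<Sum>s\<in>{s\<in>?T. s + h \<notin> ?T}. w s * w (s + h))" for h
  define N where "N h = real (card {s\<in>?T. s + h \<notin> ?T})" for h
  have ww: "\<bar>w s * w t\<bar> \<le> C\<^sup>2 / real (d1 * d2)" for s t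
  proof -
    have "\<bar>w s * w t\<bar> \<le> (C / sqrt (real (d1 * d2))) * (C / sqrt (real (d1 * d2)))"
      unfolding abs_mult using w order_trans[OF abs_ge_zero w] by (intro mult_mono) auto
    also have "\<dots> = C\<^sup>2 / real (d1 * d2)"
      by (simp add: power2_eq_square)
    finally show ?thesis .
  qed
  have r_bound: "\<bar>r h\<bar> \<le> N h * (C\<^sup>2 / real (d1 * d2))" for h
    unfolding r_def N_def using sum_norm_bound[of "{s\<in>?T. s + h \<notin> ?T}" "\<lambda>s. w s * w (s + h)" "C\<^sup>2 / real (d1 * d2)"] ww by simp
  have r_C: "\<bar>r h\<bar> \<le> C\<^sup>2" for h
  proof -
    have "N h \<le> real (d1 * d2)"
      unfolding N_def using card_mono[of ?T "{s\<in>?T. s + h \<notin> ?T}"]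
      by (simp add: finite_grid card_grid del: of_nat_mult)
    then have "N h * (C\<^sup>2 / real (d1 * d2)) \<le> real (d1 * d2) * (C\<^sup>2 / real (d1 * d2))"
      by (intro mult_right_mono) auto
    then show ?thesis
      using r_bound[of h] d by simp
  qed
  have z_support: "finite {h. z h s \<noteq> 0}" for s
  proof (rule finite_subset)
    show "{h. z h s \<noteq> 0} \<subseteq> (\<lambda>t. t - s) ` ?T"
      by (force simp: z_def image_iff split: if_splits)
  qed (simp add: finite_grid)
  have z_sum: "(\<lambda>h. \<gamma> h * z h s) summable_on UNIV" for s
    by (rule finite_nonzero_values_imp_summable_on) (use z_support[of s] in \<open>auto intro: finite_subset[rotated]\<close>)
  have z_inf: "(\<Sum>\<^sub>\<infinity>h. \<gamma> h * z h s) = (\<Sum>t\<in>?T. w s * w t * \<gamma> (t - s))" for s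
  proof -
    have "(\<Sum>\<^sub>\<infinity>h. \<gamma> h * z h s) = (\<Sum>\<^sub>\<infinity>h\<in>(\<lambda>t. t - s) ` ?T. \<gamma> h * z h s)"
      by (rule infsum_cong_neutral) (force simp: z_def image_iff)+
    also have "\<dots> = (\<Sum>h\<in>(\<lambda>t. t - s) ` ?T. \<gamma> h * z h s)"
      by (simp add: finite_grid)
    also have "\<dots> = (\<Sum>t\<in>?T. \<gamma> (t - s) * z (t - s) s)"
      by (subst sum.reindex) (auto simp: inj_on_def)
    also have "\<dots> = (\<Sum>t\<in>?T. w s * w t * \<gamma> (t - s))"
      by (intro sum.cong) (auto simp: z_def)
    finally show ?thesis .
  qed
  have "(\<Sum>s\<in>?T. \<Sum>t\<in>?T. w s * w t * \<gamma> (t - s)) = (\<Sum>\<^sub>\<infinity>h. \<Sum>s\<in>?T. \<gamma> h * z h s)"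
    unfolding z_inf[symmetric]
    by (rule finite_sum_infsum(2)[symmetric]) (use z_sum finite_grid in auto)
  also have "\<dots> = (\<Sum>\<^sub>\<infinity>h. \<gamma> h * (\<Sum>s\<in>?T. z h s))"
    by (simp add: sum_distrib_left)
  finally have V: "(\<Sum>s\<in>?T. \<Sum>t\<in>?T. w s * w t * \<gamma> (t - s)) = (\<Sum>\<^sub>\<infinity>h. \<gamma> h * (\<Sum>s\<in>?T. z h s))" .
  have split: "(\<Sum>s\<in>?T. w s * w (s + h)) = (\<Sum>s\<in>?T. z h s) + r h" for h
  proof -
    have "r h = (\<Sum>s\<in>?T. if s + h \<notin> ?T then w s * w (s + h) else 0)"
      unfolding r_def by (rule sum.inter_filter[OF finite_grid])
    then show ?thesis
      by (simp add: z_def flip: sum.distrib) (intro sum.cong; simp)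
  qed
  have zs: "(\<lambda>h. \<gamma> h * (\<Sum>s\<in>?T. z h s)) summable_on UNIV"
    unfolding sum_distrib_left by (rule finite_sum_infsum(1)) (use z_sum finite_grid in auto)
  have rs: "(\<lambda>h. \<gamma> h * r h) summable_on UNIV"
  proof (rule abs_summable_summable, rule summable_on_comparison_test)
    show "(\<lambda>h. C\<^sup>2 * \<bar>\<gamma> h\<bar>) summable_on UNIV"
      by (rule summable_on_cmult_right[OF \<gamma>])
    show "norm (\<gamma> h * r h) \<le> C\<^sup>2 * \<bar>\<gamma> h\<bar>" for h
      using mult_left_mono[OF r_C[of h], of "\<bar>\<gamma> h\<bar>"] by (simp add: abs_mult mult.commute)
  qed simp
  have "(\<Sum>\<^sub>\<infinity>h. \<gamma> h * (\<Sum>s\<in>?T. w s * w (s + h)))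
      = (\<Sum>\<^sub>\<infinity>h. \<gamma> h * (\<Sum>s\<in>?T. z h s)) + (\<Sum>\<^sub>\<infinity>h. \<gamma> h * r h)"
    unfolding split distrib_left by (rule infsum_add[OF zs rs])
  then have "\<bar>(\<Sum>\<^sub>\<infinity>h. \<gamma> h * (\<Sum>s\<in>?T. w s * w (s + h))) - (\<Sum>s\<in>?T. \<Sum>t\<in>?T. w s * w t * \<gamma> (t - s))\<bar>
      = \<bar>\<Sum>\<^sub>\<infinity>h. \<gamma> h * r h\<bar>"
    unfolding V by simp
  also have "\<dots> \<le> (\<Sum>h\<in>F. \<bar>\<gamma> h\<bar> * \<bar>r h\<bar>) + C\<^sup>2 * (\<Sum>\<^sub>\<infinity>h\<in>- F. \<bar>\<gamma> h\<bar>)"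
    by (rule infsum_split_bound[OF \<gamma> r_C F])
  also have "(\<Sum>h\<in>F. \<bar>\<gamma> h\<bar> * \<bar>r h\<bar>)
      \<le> (\<Sum>h\<in>F. \<bar>\<gamma> h\<bar> * (C\<^sup>2 * (\<bar>real_of_int (fst h)\<bar> / real d1 + \<bar>real_of_int (snd h)\<bar> / real d2)))"
  proof (intro sum_mono mult_left_mono abs_ge_zero)
    fix h
    have "\<bar>r h\<bar> \<le> (\<bar>real_of_int (fst h)\<bar> * real d2 + \<bar>real_of_int (snd h)\<bar> * real d1) * (C\<^sup>2 / real (d1 * d2))"
      using card_escape_grid[of d1 d2 h] unfolding N_def[symmetric]
      by (intro order_trans[OF r_bound] mult_right_mono) auto
    also have "\<dots> = C\<^sup>2 * (\<bar>real_of_int (fst h)\<bar> / real d1 + \<bar>real_of_int (snd h)\<bar> / real d2)"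
      using d by (simp add: field_simps)
    finally show "\<bar>r h\<bar> \<le> C\<^sup>2 * (\<bar>real_of_int (fst h)\<bar> / real d1 + \<bar>real_of_int (snd h)\<bar> / real d2)" .
  qed
  finally show ?thesis
    by (simp add: sum_distrib_left ac_simps)
qed

lemma quadratic_form_circular_limit:
  fixes w :: "nat \<Rightarrow> site \<Rightarrow> real" and d1 d2 :: "nat \<Rightarrow> nat"
  assumes \<gamma>: "(\<lambda>h. \<bar>\<gamma> h\<bar>) summable_on UNIV"
    and d: "filterlim d1 at_top sequentially" "filterlim d2 at_top sequentially"
    and w: "\<forall>\<^sub>F n in sequentially. \<forall>t. \<bar>w n t\<bar> \<le> C / sqrt (real (d1 n * d2 n))"
  shows "(\<lambda>n. (\<Sum>\<^sub>\<infinity>h. \<gamma> h * (\<Sum>s\<in>grid (d1 n) (d2 n). w n s * w n (s + h)))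
      - (\<Sum>s\<in>grid (d1 n) (d2 n). \<Sum>t\<in>grid (d1 n) (d2 n). w n s * w n t * \<gamma> (t - s))) \<longlonglongrightarrow> 0"
proof (rule LIMSEQ_I, simp only: diff_0_right)
  fix e :: real assume "0 < e"
  then have "0 < e / (2 * (C\<^sup>2 + 1))"
    by (simp add: add_nonneg_pos)
  then obtain F where F: "finite F" "(\<Sum>\<^sub>\<infinity>h\<in>- F. \<bar>\<gamma> h\<bar>) \<le> e / (2 * (C\<^sup>2 + 1))"
    using infsum_tail_small[OF \<gamma>] by metis
  have tail: "C\<^sup>2 * (\<Sum>\<^sub>\<infinity>h\<in>- F. \<bar>\<gamma> h\<bar>) \<le> e / 2"
  proof -
    have "C\<^sup>2 * (\<Sum>\<^sub>\<infinity>h\<in>- F. \<bar>\<gamma> h\<bar>) \<le> (C\<^sup>2 + 1) * (e / (2 * (C\<^sup>2 + 1)))"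
      using F(2) by (intro mult_mono infsum_nonneg) auto
    also have "\<dots> = e / 2"
      using add_nonneg_pos[of "C\<^sup>2" 1] by (simp add: field_simps)
    finally show ?thesis .
  qed
  have real_d: "filterlim (\<lambda>n. real (d1 n)) at_infinity sequentially" "filterlim (\<lambda>n. real (d2 n)) at_infinity sequentially"
    by (intro filterlim_at_top_imp_at_infinity filterlim_compose[OF filterlim_real_sequentially] d)+
  have "(\<lambda>n. C\<^sup>2 * (\<Sum>h\<in>F. \<bar>\<gamma> h\<bar> * (\<bar>real_of_int (fst h)\<bar> / real (d1 n) + \<bar>real_of_int (snd h)\<bar> / real (d2 n))))
      \<longlonglongrightarrow> C\<^sup>2 * (\<Sum>h\<in>F. \<bar>\<gamma> h\<bar> * (0 + 0))"
    by (intro tendsto_intros tendsto_divide_0[OF tendsto_const] real_d)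
  then have "\<forall>\<^sub>F n in sequentially. C\<^sup>2 * (\<Sum>h\<in>F. \<bar>\<gamma> h\<bar>
      * (\<bar>real_of_int (fst h)\<bar> / real (d1 n) + \<bar>real_of_int (snd h)\<bar> / real (d2 n))) < e / 2"
    using \<open>0 < e\<close> by (intro order_tendstoD(2)[where y = "C\<^sup>2 * (\<Sum>h\<in>F. \<bar>\<gamma> h\<bar> * (0 + 0))"]) auto
  moreover have "\<forall>\<^sub>F n in sequentially. 0 < d1 n" "\<forall>\<^sub>F n in sequentially. 0 < d2 n"
    using d by (auto simp: filterlim_at_top Suc_le_eq dest!: spec[of _ "Suc 0"])
  ultimately have "\<forall>\<^sub>F n in sequentially.
      norm ((\<Sum>\<^sub>\<infinity>h. \<gamma> h * (\<Sum>s\<in>grid (d1 n) (d2 n). w n s * w n (s + h)))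
        - (\<Sum>s\<in>grid (d1 n) (d2 n). \<Sum>t\<in>grid (d1 n) (d2 n). w n s * w n t * \<gamma> (t - s))) < e"
    using w
  proof eventually_elim
    case (elim n)
    then show ?case
      using quadratic_form_minus_circular[OF \<gamma> elim(2,3) _ F(1), of "w n" C] tail by fastforce
  qed
  then show "\<exists>no. \<forall>n\<ge>no. norm ((\<Sum>\<^sub>\<infinity>h. \<gamma> h * (\<Sum>s\<in>grid (d1 n) (d2 n). w n s * w n (s + h)))
        - (\<Sum>s\<in>grid (d1 n) (d2 n). \<Sum>t\<in>grid (d1 n) (d2 n). w n s * w n t * \<gamma> (t - s))) < e"
    unfolding eventually_sequentially .
qed

section \<open>Uniform convergence of distribution functions\<close>

lemma (in real_distribution) cdf_surj:
  assumes cont: "\<And>x. isCont (cdf M) x" and q: "0 < q" "q < 1"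
  obtains x where "cdf M x = q"
proof -
  have "\<forall>\<^sub>F x in at_bot. cdf M x < q"
    using cdf_lim_at_bot q(1) by (rule order_tendstoD(2))
  then obtain a where a: "\<And>x. x \<le> a \<Longrightarrow> cdf M x < q"
    by (auto simp: eventually_at_bot_linorder)
  have "\<forall>\<^sub>F x in at_top. q < cdf M x"
    using cdf_lim_at_top_prob q(2) by (rule order_tendstoD(1))
  then obtain b where b: "\<And>x. b \<le> x \<Longrightarrow> q < cdf M x"
    by (auto simp: eventually_at_top_linorder)
  have "\<exists>x. min a b \<le> x \<and> x \<le> max a b \<and> cdf M x = q"
    by (rule IVT) (use a[of "min a b"] b[of "max a b"] cont in auto)
  then show thesis
    using that by blast
qed

text \<open>Polya's theorem: by monotonicity it suffices to have convergence at the \<open>m\<close>-quantiles of the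
limit, up to an error of \<open>3 / m\<close>.\<close>

lemma weak_conv_cdf_uniform:
  fixes N :: "nat \<Rightarrow> real measure"
  assumes N: "\<And>n. real_distribution (N n)" and L: "real_distribution L"
    and conv: "weak_conv_m N L" and cont: "\<And>x. isCont (cdf L) x" and "0 < e"
  shows "\<forall>\<^sub>F n in sequentially. \<forall>z. \<bar>cdf (N n) z - cdf L z\<bar> < e"
proof -
  interpret L: real_distribution L by fact
  obtain m :: nat where m: "3 / e < real m"
    using reals_Archimedean2 by blast
  have "0 < 3 / e"
    using \<open>0 < e\<close> by simp
  then have m0: "0 < real m"
    using m by linarith
  have me: "3 / real m < e"
    using m m0 \<open>0 < e\<close> by (simp add: field_simps)
  have "\<exists>x. cdf L x = real k / real m" if "k \<in> {1..<m}" for k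
    using L.cdf_surj[OF cont, of "real k / real m"] that by auto
  then obtain x where x: "\<And>k. k \<in> {1..<m} \<Longrightarrow> cdf L (x k) = real k / real m"
    by metis
  have "\<forall>\<^sub>F n in sequentially. \<forall>k\<in>{1..<m}. dist (cdf (N n) (x k)) (cdf L (x k)) < 1 / real m"
  proof (intro eventually_ball_finite ballI)
    show "\<forall>\<^sub>F n in sequentially. dist (cdf (N n) (x k)) (cdf L (x k)) < 1 / real m" for k
      by (rule tendstoD) (use conv cont m0 in \<open>auto simp: weak_conv_m_def weak_conv_def\<close>)
  qed simp
  then show ?thesis
  proof eventually_elim
    case (elim n)
    interpret N: real_distribution "N n" by (rule N)
    have close: "\<bar>cdf (N n) (x k) - real k / real m\<bar> < 1 / real m" if "k \<in> {1..<m}" for k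
      using bspec[OF elim that] unfolding dist_real_def x[OF that] .
    show ?case
    proof
      fix z
      define k where "k = nat \<lfloor>real m * cdf L z\<rfloor>"
      have F: "0 \<le> cdf L z" "cdf L z \<le> 1"
        by (auto simp: L.cdf_nonneg L.cdf_bounded_prob)
      have "real k = of_int \<lfloor>real m * cdf L z\<rfloor>"
        unfolding k_def using F m0 by simp
      then have "real k \<le> real m * cdf L z" "real m * cdf L z < real k + 1"
        by linarith+
      then have k: "real k / real m \<le> cdf L z" "cdf L z < real (k + 1) / real m"
        using m0 by (auto simp: field_simps)
      have "cdf (N n) z \<le> cdf L z + 2 / real m"
      proof (cases "k + 1 < m")
        case True
        have "cdf L z < cdf L (x (k + 1))"
          using x[of "k + 1"] True k by simp
        then have "z \<le> x (k + 1)"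
          using L.cdf_nondecreasing[of "x (k + 1)" z] by linarith
        then have "cdf (N n) z \<le> cdf (N n) (x (k + 1))"
          by (rule N.cdf_nondecreasing)
        also have "\<dots> < real (k + 1) / real m + 1 / real m"
          using close[of "k + 1"] True by (simp add: abs_less_iff)
        also have "\<dots> = real k / real m + 2 / real m"
          by (simp add: add_divide_distrib)
        finally show ?thesis
          using k(1) by linarith
      next
        case False
        then have "1 \<le> (real k + 1) / real m"
          using m0 by (simp add: pos_le_divide_eq)
        then have "1 \<le> real k / real m + 1 / real m"
          by (simp add: add_divide_distrib)
        moreover have "1 / real m \<le> 2 / real m"
          by (simp add: divide_right_mono)
        ultimately show ?thesis
          using N.cdf_bounded_prob[of z] k(1) by linarith
      qed
      moreover have "cdf L z - 3 / real m \<le> cdf (N n) z"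
      \<comment> \<open>One step is lost by using \<open>k - 1\<close>: the quantile \<open>x k\<close> may exceed \<open>z\<close> if the limit is flat there.\<close>
      proof (cases "2 \<le> k")
        case True
        have "real k \<le> real m"
        proof -
          have "real k / real m \<le> 1"
            using k(1) F(2) by linarith
          then show ?thesis
            using m0 by (simp add: pos_divide_le_eq)
        qed
        then have mem: "k - 1 \<in> {1..<m}"
          using True by auto
        have pred: "real (k - 1) / real m = real k / real m - 1 / real m"
          using True by (simp add: of_nat_diff diff_divide_distrib)
        have "0 < 1 / real m"
          using m0 by simp
        then have "cdf L (x (k - 1)) < cdf L z"
          using x[OF mem] pred k(1) by linarith
        then have "x (k - 1) \<le> z"
          using L.cdf_nondecreasing[of z "x (k - 1)"] by linarith
        then have "cdf (N n) (x (k - 1)) \<le> cdf (N n) z"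
          by (rule N.cdf_nondecreasing)
        moreover have "real k / real m - 2 / real m < cdf (N n) (x (k - 1))"
          using close[OF mem] pred by (simp add: abs_less_iff)
        moreover have "cdf L z < real k / real m + 1 / real m"
          using k(2) by (simp add: add_divide_distrib)
        moreover have "3 / real m = 2 / real m + 1 / real m"
          by simp
        ultimately show ?thesis by linarith
      next
        case False
        then have "real (k + 1) / real m \<le> 3 / real m"
          by (intro divide_right_mono) auto
        then show ?thesis
          using k(2) N.cdf_nonneg[of z] by linarith
      qed
      moreover have "2 / real m \<le> 3 / real m"
        by (simp add: divide_right_mono)
      ultimately show "\<bar>cdf (N n) z - cdf L z\<bar> < e"
        using me by linarith
    qed
  qed
qed

lemma isCont_cdf_std_normal: "isCont (cdf std_normal_distribution) x"
proof -
  interpret real_distribution std_normal_distribution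
    by (rule real_dist_normal_dist)
  have "{x} \<in> null_sets (density lborel (\<lambda>x. ennreal (std_normal_density x)))"
  proof (subst null_sets_density_iff, safe)
    show "AE y in lborel. y \<in> {x} \<longrightarrow> ennreal (std_normal_density y) = 0"
      using AE_lborel_singleton[of x] by eventually_elim simp
  qed auto
  then show ?thesis
    unfolding isCont_cdf by (simp add: null_sets_def measure_def)
qed

section \<open>Lebesgue norms\<close>

lemma powr_diff_le:
  fixes a b p :: real
  assumes "0 \<le> p"
  shows "\<bar>a - b\<bar> powr p \<le> 2 powr p * (\<bar>a\<bar> powr p + \<bar>b\<bar> powr p)"
proof -
  have "\<bar>a - b\<bar> powr p \<le> (2 * max \<bar>a\<bar> \<bar>b\<bar>) powr p"
    using assms by (intro powr_mono2) auto
  also have "\<dots> = 2 powr p * max \<bar>a\<bar> \<bar>b\<bar> powr p"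
    by (intro powr_mult)
  also have "\<dots> \<le> 2 powr p * (\<bar>a\<bar> powr p + \<bar>b\<bar> powr p)"
    by (intro mult_left_mono) (auto simp: max_def)
  finally show ?thesis .
qed

text \<open>Young's inequality between \<open>t powr p\<close> and \<open>1\<close>; with \<open>t = \<bar>f x\<bar> / \<parallel>f\<parallel>\<^sub>p\<close> it gives that the \<open>L\<^sup>2\<close>
norm is at most the \<open>L\<^sup>p\<close> norm.\<close>

lemma power2_le_powr:
  fixes t p :: real
  assumes "2 \<le> p" "0 \<le> t"
  shows "t\<^sup>2 \<le> 2 / p * t powr p + (1 - 2 / p)"
proof (cases "t = 0")
  case False
  have "(t powr p) powr (2 / p) * 1 powr (1 - 2 / p) \<le> 2 / p * t powr p + (1 - 2 / p) * 1"
    using assms False by (intro Youngs_inequality_0) auto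
  then show ?thesis
    using assms False by (simp add: powr_powr)
next
  case True
  have "2 / p \<le> 1"
    using assms by (simp add: pos_divide_le_eq)
  moreover have "t\<^sup>2 = 0" "t powr p = 0"
    using True by auto
  ultimately show ?thesis
    by (simp only: mult_zero_right)
qed

lemma (in prob_space) l2norm_le_Lp_norm:
  assumes p: "2 \<le> p" and f: "in_Lp M p f"
  shows "sqint M f" "l2norm M f \<le> Lp_norm M p f"
proof -
  have meas: "f \<in> borel_measurable M" and int: "integrable M (\<lambda>x. \<bar>f x\<bar> powr p)"
    using f by (auto simp: in_Lp_def)
  have int_scaled: "integrable M (\<lambda>x. r * \<bar>f x\<bar> powr p + s)" for r s
    using int by simp
  show sq: "sqint M f"
    unfolding sqint_def
  proof
    show "integrable M (\<lambda>x. (f x)\<^sup>2)"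
    proof (rule Bochner_Integration.integrable_bound[OF int_scaled[of "2 / p" "1 - 2 / p"]])
      show "AE x in M. norm ((f x)\<^sup>2) \<le> norm (2 / p * \<bar>f x\<bar> powr p + (1 - 2 / p))"
      proof (rule AE_I2)
        fix x
        have "(f x)\<^sup>2 \<le> 2 / p * \<bar>f x\<bar> powr p + (1 - 2 / p)"
          using power2_le_powr[OF p abs_ge_zero, of "f x"] by simp
        then show "norm ((f x)\<^sup>2) \<le> norm (2 / p * \<bar>f x\<bar> powr p + (1 - 2 / p))"
          unfolding real_norm_def abs_of_nonneg[OF zero_le_power2] by (rule order_trans[OF _ abs_ge_self])
      qed
    qed (use meas in measurable)
  qed (rule meas)
  define A where "A = Lp_norm M p f"
  have A0: "0 \<le> A"
    by (simp add: A_def Lp_norm_def)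
  have Ap: "A powr p = (\<integral>x. \<bar>f x\<bar> powr p \<partial>M)"
    using p by (simp add: A_def Lp_norm_def powr_powr)
  show "l2norm M f \<le> Lp_norm M p f"
  proof (cases "A = 0")
    case True
    then have "(\<integral>x. \<bar>f x\<bar> powr p \<partial>M) = 0"
      using Ap by simp
    then have "AE x in M. \<bar>f x\<bar> powr p = 0"
      using int by (subst (asm) integral_nonneg_eq_0_iff_AE) auto
    then have "AE x in M. (f x)\<^sup>2 = 0"
      by eventually_elim simp
    then have "(\<integral>x. (f x)\<^sup>2 \<partial>M) = (\<integral>x. 0 \<partial>M)"
      by (intro integral_cong_AE) (use meas in auto)
    then show ?thesis
      using True by (simp add: l2norm_def A_def)
  next
    case False
    then have A: "0 < A"
      using A0 by simp
    have "(\<integral>x. (f x)\<^sup>2 \<partial>M) \<le> (\<integral>x. A\<^sup>2 * (2 / p * (\<bar>f x\<bar> powr p / A powr p) + (1 - 2 / p)) \<partial>M)"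
    proof (rule integral_mono)
      show "integrable M (\<lambda>x. A\<^sup>2 * (2 / p * (\<bar>f x\<bar> powr p / A powr p) + (1 - 2 / p)))"
        using int by simp
      show "(f x)\<^sup>2 \<le> A\<^sup>2 * (2 / p * (\<bar>f x\<bar> powr p / A powr p) + (1 - 2 / p))" for x
      proof -
        have "(\<bar>f x\<bar> / A)\<^sup>2 \<le> 2 / p * (\<bar>f x\<bar> / A) powr p + (1 - 2 / p)"
          using A by (intro power2_le_powr p) simp
        also have "(\<bar>f x\<bar> / A) powr p = \<bar>f x\<bar> powr p / A powr p"
          using A by (simp add: powr_divide)
        finally have "A\<^sup>2 * (\<bar>f x\<bar> / A)\<^sup>2 \<le> A\<^sup>2 * (2 / p * (\<bar>f x\<bar> powr p / A powr p) + (1 - 2 / p))"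
          by (rule mult_left_mono) simp
        then show ?thesis
          using A by (simp add: power_divide)
      qed
    qed (use sq in \<open>simp add: sqint_def\<close>)
    also have "\<dots> = A\<^sup>2 * (2 / p * (A powr p / A powr p) + (1 - 2 / p))"
      using int by (simp add: Ap prob_space)
    also have "\<dots> = A\<^sup>2"
      using A by simp
    finally have "(l2norm M f)\<^sup>2 \<le> A\<^sup>2"
      by (simp add: l2norm_power2)
    then show ?thesis
      unfolding A_def[symmetric] using A0 by (rule power2_le_imp_le)
  qed
qed

lemma in_Lp_diff:
  assumes "0 \<le> p" "in_Lp M p f" "in_Lp M p g"
  shows "in_Lp M p (\<lambda>x. f x - g x)"
  unfolding in_Lp_def
proof
  show meas: "(\<lambda>x. f x - g x) \<in> borel_measurable M"
    using assms by (auto simp: in_Lp_def)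
  show "integrable M (\<lambda>x. \<bar>f x - g x\<bar> powr p)"
  proof (rule Bochner_Integration.integrable_bound)
    show "integrable M (\<lambda>x. 2 powr p * (\<bar>f x\<bar> powr p + \<bar>g x\<bar> powr p))"
      using assms by (simp add: in_Lp_def)
    show "AE x in M. norm (\<bar>f x - g x\<bar> powr p) \<le> norm (2 powr p * (\<bar>f x\<bar> powr p + \<bar>g x\<bar> powr p))"
      using powr_diff_le[OF assms(1)] by (intro AE_I2) simp
  qed (use meas in measurable)
qed

lemma in_Lp_distr:
  assumes "\<phi> \<in> measurable N N'" "f \<in> borel_measurable N'" "distr N N' \<phi> = N'"
  shows "in_Lp N p (\<lambda>x. f (\<phi> x)) \<longleftrightarrow> in_Lp N' p f"
proof -
  have m: "(\<lambda>x. f (\<phi> x)) \<in> borel_measurable N"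
    by (rule measurable_compose[OF assms(1,2)])
  have m': "(\<lambda>x. \<bar>f x\<bar> powr p) \<in> borel_measurable N'"
    using assms(2) by measurable
  have "integrable (distr N N' \<phi>) (\<lambda>x. \<bar>f x\<bar> powr p) \<longleftrightarrow> integrable N (\<lambda>x. \<bar>f (\<phi> x)\<bar> powr p)"
    by (rule integrable_distr_eq[OF assms(1) m'])
  then show ?thesis
    using assms m by (simp add: in_Lp_def)
qed

lemma Lp_norm_distr:
  assumes "\<phi> \<in> measurable N N'" "f \<in> borel_measurable N'" "distr N N' \<phi> = N'"
  shows "Lp_norm N p (\<lambda>x. f (\<phi> x)) = Lp_norm N' p f"
proof -
  have "(\<lambda>x. \<bar>f x\<bar> powr p) \<in> borel_measurable N'"
    using assms(2) by measurable
  then have "(\<integral>x. \<bar>f x\<bar> powr p \<partial>distr N N' \<phi>) = (\<integral>x. \<bar>f (\<phi> x)\<bar> powr p \<partial>N)"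
    by (rule integral_distr[OF assms(1)])
  then show ?thesis
    using assms by (simp add: Lp_norm_def)
qed

lemma Lp_norm_cong_AE:
  assumes "AE x in N. f x = g x" "f \<in> borel_measurable N" "g \<in> borel_measurable N"
  shows "Lp_norm N p f = Lp_norm N p g"
proof -
  have "(\<integral>x. \<bar>f x\<bar> powr p \<partial>N) = (\<integral>x. \<bar>g x\<bar> powr p \<partial>N)"
  proof (rule integral_cong_AE)
    show "AE x in N. \<bar>f x\<bar> powr p = \<bar>g x\<bar> powr p"
      using assms(1) by eventually_elim simp
  qed (use assms(2,3) in measurable)
  then show ?thesis
    by (simp add: Lp_norm_def)
qed

lemma in_Lp_cong_AE:
  assumes "AE x in N. f x = g x" "f \<in> borel_measurable N" "g \<in> borel_measurable N"
  shows "in_Lp N p f \<longleftrightarrow> in_Lp N p g"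
proof -
  have "integrable N (\<lambda>x. \<bar>f x\<bar> powr p) \<longleftrightarrow> integrable N (\<lambda>x. \<bar>g x\<bar> powr p)"
  proof (rule integrable_cong_AE)
    show "AE x in N. \<bar>f x\<bar> powr p = \<bar>g x\<bar> powr p"
      using assms(1) by eventually_elim simp
  qed (use assms(2,3) in measurable)
  then show ?thesis
    using assms by (simp add: in_Lp_def)
qed

lemma (in prob_space) in_Lp_const: "in_Lp M p (\<lambda>_. c)"
  by (simp add: in_Lp_def)

section \<open>Moving averages of an independent field\<close>

lemma (in prob_space) iid_field_law:
  assumes "iid_field M \<epsilon>"
  defines "\<nu> \<equiv> distr M borel (\<epsilon> 0)"
  shows "real_distribution \<nu>" "(\<lambda>\<omega> i. \<epsilon> i \<omega>) \<in> measurable M (Pi\<^sub>M UNIV (\<lambda>_::site. \<nu>))"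
    "distr M (Pi\<^sub>M UNIV (\<lambda>_::site. \<nu>)) (\<lambda>\<omega> i. \<epsilon> i \<omega>) = Pi\<^sub>M UNIV (\<lambda>_. \<nu>)"
proof -
  have ind: "indep_vars (\<lambda>_. borel) \<epsilon> UNIV" and id: "\<And>i. distr M borel (\<epsilon> i) = \<nu>"
    using assms(1) by (auto simp: iid_field_def \<nu>_def)
  have rv: "\<epsilon> i \<in> borel_measurable M" for i
    using ind unfolding indep_vars_def2 by blast
  show "real_distribution \<nu>"
    unfolding \<nu>_def by (rule real_distribution_distr[OF rv])
  have sets: "sets (Pi\<^sub>M UNIV (\<lambda>_::site. \<nu>)) = sets (Pi\<^sub>M UNIV (\<lambda>_. borel))"
    by (rule sets_PiM_cong) (simp_all add: \<nu>_def)
  have "(\<lambda>\<omega> i. \<epsilon> i \<omega>) \<in> measurable M (Pi\<^sub>M UNIV (\<lambda>_::site. borel))"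
    by (rule measurable_PiM_single') (use rv in \<open>auto simp: space_PiM\<close>)
  then show "(\<lambda>\<omega> i. \<epsilon> i \<omega>) \<in> measurable M (Pi\<^sub>M UNIV (\<lambda>_::site. \<nu>))"
    by (simp cong: measurable_cong_sets add: sets)
  have "distr M (Pi\<^sub>M UNIV (\<lambda>_::site. borel)) (\<lambda>\<omega>. \<lambda>i\<in>UNIV. \<epsilon> i \<omega>) = Pi\<^sub>M UNIV (\<lambda>i. distr M borel (\<epsilon> i))"
    using ind by (subst (asm) indep_vars_iff_distr_eq_PiM) (auto simp: rv)
  then show "distr M (Pi\<^sub>M UNIV (\<lambda>_::site. \<nu>)) (\<lambda>\<omega> i. \<epsilon> i \<omega>) = Pi\<^sub>M UNIV (\<lambda>_. \<nu>)"
    by (simp add: id restrict_UNIV cong: distr_cong[OF refl sets])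
qed

text \<open>The field \<open>V\<close> lives on an arbitrary probability space \<open>M\<close>; all computations are done with \<open>G\<close> on
the product space \<open>P\<close> and transferred along \<open>E\<close>, whose law is \<open>P\<close>.\<close>

locale moving_average = M: prob_space M + lattice_noise \<nu> "TYPE(site)"
  for M :: "'a measure" and \<nu> :: "real measure" +
  fixes E :: "'a \<Rightarrow> site \<Rightarrow> real" and G :: "(site \<Rightarrow> real) \<Rightarrow> real"
    and V :: "site \<Rightarrow> 'a \<Rightarrow> real" and \<mu> :: real
  assumes E_measurable: "E \<in> measurable M P" and E_law: "distr M P E = P"
    and G_measurable: "G \<in> borel_measurable P"
    and V_measurable: "\<And>j. V j \<in> borel_measurable M"
    and V_eq: "\<And>j. AE \<omega> in M. V j \<omega> - \<mu> = G (reflect_shift j (E \<omega>))"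
begin

lemma G_shift_measurable: "(\<lambda>x. G (reflect_shift j x)) \<in> borel_measurable P"
  by (rule measurable_compose[OF measurable_reflect_shift G_measurable])

lemma GE_measurable: "(\<lambda>\<omega>. G (reflect_shift j (E \<omega>))) \<in> borel_measurable M"
  by (rule measurable_compose[OF E_measurable G_shift_measurable])

lemma expectation_E:
  fixes f :: "(site \<Rightarrow> real) \<Rightarrow> 'c::{banach, second_countable_topology}"
  assumes "f \<in> borel_measurable P"
  shows "M.expectation (\<lambda>\<omega>. f (E \<omega>)) = P.expectation f"
  using integral_distr[OF E_measurable assms] by (simp add: E_law)

lemma in_Lp_G:
  assumes "0 \<le> p" "in_Lp M p (V 0)"
  shows "in_Lp P p G"
proof -
  have "in_Lp M p (\<lambda>\<omega>. V 0 \<omega> - \<mu>)"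
    by (intro in_Lp_diff assms M.in_Lp_const)
  then have "in_Lp M p (\<lambda>\<omega>. G (reflect_shift 0 (E \<omega>)))"
    by (subst (asm) in_Lp_cong_AE[OF V_eq])
       (intro borel_measurable_diff V_measurable borel_measurable_const, rule GE_measurable)
  then have "in_Lp P p (\<lambda>x. G (reflect_shift 0 x))"
    by (simp only: in_Lp_distr[OF E_measurable G_shift_measurable E_law])
  then show ?thesis
    by (simp only: in_Lp_distr[OF measurable_reflect_shift G_measurable distr_reflect_shift])
qed

lemma expectation_G:
  assumes "integrable M (V 0)" "M.expectation (V 0) = \<mu>"
  shows "P.expectation G = 0"
proof -
  have "P.expectation G = M.expectation (\<lambda>\<omega>. G (reflect_shift 0 (E \<omega>)))"
    unfolding expectation_E[OF G_shift_measurable] by (rule expectation_reflect_shift[OF G_measurable, symmetric])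
  also have "\<dots> = M.expectation (\<lambda>\<omega>. V 0 \<omega> - \<mu>)"
    by (rule integral_cong_AE[symmetric])
       (intro borel_measurable_diff V_measurable borel_measurable_const, rule GE_measurable, rule V_eq)
  also have "\<dots> = 0"
    using assms by (simp add: M.prob_space)
  finally show ?thesis .
qed

text \<open>Both sides are second moments of \<open>G\<close> at two points at distance \<open>t - s\<close>; translating the noise
by \<open>s\<close> identifies them.\<close>

lemma autocov_eq:
  assumes mean: "\<And>j. M.expectation (V j) = \<mu>"
  shows "autocov M V (t - s) = P.expectation (\<lambda>x. G (reflect_shift s x) * G (reflect_shift t x))"
proof -
  let ?K = "\<lambda>x. G (reflect_shift 0 x) * G (reflect_shift (t - s) x)"
  have K: "?K \<in> borel_measurable P"
    by (intro borel_measurable_times G_shift_measurable)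
  have "autocov M V (t - s) = M.expectation (\<lambda>\<omega>. (V 0 \<omega> - \<mu>) * (V (t - s) \<omega> - \<mu>))"
    by (simp add: autocov_def covariance_def mean)
  also have "\<dots> = M.expectation (\<lambda>\<omega>. ?K (E \<omega>))"
  proof (rule integral_cong_AE)
    show "AE \<omega> in M. (V 0 \<omega> - \<mu>) * (V (t - s) \<omega> - \<mu>) = ?K (E \<omega>)"
      using V_eq[of 0] V_eq[of "t - s"] by eventually_elim simp
  qed (intro borel_measurable_times borel_measurable_diff V_measurable borel_measurable_const GE_measurable)+
  also have "\<dots> = P.expectation ?K"
    by (rule expectation_E[OF K])
  also have "\<dots> = P.expectation (\<lambda>x. ?K (\<lambda>i. x (s + i)))"
    using integral_distr[OF measurable_reindex K, of "\<lambda>i. s + i"]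
    by (simp add: distr_reindex[of "\<lambda>i. s + i"] inj_on_def)
  also have "\<dots> = P.expectation (\<lambda>x. G (reflect_shift s x) * G (reflect_shift t x))"
    by (simp add: reflect_shift_def algebra_simps)
  finally show ?thesis .
qed

lemma l2norm_linear_statistic_autocov:
  assumes mean: "\<And>j. M.expectation (V j) = \<mu>" and G: "sqint P G"
  shows "(l2norm P (linear_statistic w T G))\<^sup>2 = (\<Sum>s\<in>T. \<Sum>t\<in>T. w s * w t * autocov M V (t - s))"
proof -
  note int = sqint_integrable_mult[OF sqint_reflect_shift[OF G] sqint_reflect_shift[OF G]]
  have "(l2norm P (linear_statistic w T G))\<^sup>2
      = P.expectation (\<lambda>x. \<Sum>s\<in>T. \<Sum>t\<in>T. w s * w t * (G (reflect_shift s x) * G (reflect_shift t x)))"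
    unfolding l2norm_power2 linear_statistic_def by (simp add: power2_eq_square sum_product ac_simps)
  also have "\<dots> = (\<Sum>s\<in>T. \<Sum>t\<in>T. w s * w t * autocov M V (t - s))"
    unfolding autocov_eq[OF mean] using int
    by (subst Bochner_Integration.integral_sum; simp)
  finally show ?thesis .
qed

text \<open>The right-hand side is the norm in the definition of \<open>p\<close>-stability. The noise at the origin is
the coordinate \<open>j\<close> of the argument of \<open>G\<close> in \<open>V j\<close>.\<close>

lemma influence_le_Lp_norm:
  assumes p: "2 \<le> p" and G: "in_Lp P p G"
  shows "influence G j \<le> Lp_norm (M \<Otimes>\<^sub>M M) p
    (\<lambda>w. V j (fst w) - (\<mu> + G (reflect_shift j (override_on (E (fst w)) (E (snd w)) {0}))))"
proof -
  interpret MM: pair_prob_space M M ..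
  let ?g = "\<lambda>x. G (reflect_shift j x)"
  let ?k = "\<lambda>w. change ?g {0} w"
  let ?EE = "\<lambda>w. (E (fst w), E (snd w))"
  have EE: "?EE \<in> measurable (M \<Otimes>\<^sub>M M) PP"
    by (intro measurable_Pair measurable_compose[OF measurable_fst E_measurable]
        measurable_compose[OF measurable_snd E_measurable])
  have "sigma_finite_measure (distr M P E)"
    unfolding E_law by unfold_locales
  from pair_measure_distr[OF E_measurable E_measurable this]
  have EE_law: "distr (M \<Otimes>\<^sub>M M) PP ?EE = PP"
    unfolding E_law case_prod_unfold by (rule sym)
  have g: "in_Lp P p ?g"
    using G by (simp only: in_Lp_distr[OF measurable_reflect_shift G_measurable distr_reflect_shift])
  have gA: "in_Lp PP p (mixed ?g A)" for A
    using g by (simp only: in_Lp_distr[OF measurable_override_on_PP G_shift_measurable distr_override_on])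
  have k: "in_Lp PP p ?k"
    by (rule in_Lp_diff[OF _ gA gA]) (use p in simp)
  have k_meas: "?k \<in> borel_measurable PP"
    by (intro borel_measurable_diff measurable_mixed G_shift_measurable)
  have "influence G j = influence ?g 0"
    using influence_reflect_shift[OF G_measurable, of j 0] by simp
  also have "\<dots> \<le> Lp_norm PP p ?k"
    unfolding influence_def by (rule PP.l2norm_le_Lp_norm(2)[OF p k])
  also have "\<dots> = Lp_norm (M \<Otimes>\<^sub>M M) p (\<lambda>w. ?k (?EE w))"
    by (rule Lp_norm_distr[OF EE k_meas EE_law, symmetric])
  also have "\<dots> = Lp_norm (M \<Otimes>\<^sub>M M) p
    (\<lambda>w. V j (fst w) - (\<mu> + G (reflect_shift j (override_on (E (fst w)) (E (snd w)) {0}))))"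
  proof (rule Lp_norm_cong_AE)
    have "AE w in M \<Otimes>\<^sub>M M. V j (fst w) - \<mu> = G (reflect_shift j (E (fst w)))"
      by (rule AE_distrD[OF measurable_fst]) (unfold M.distr_pair_fst, rule V_eq)
    then show "AE w in M \<Otimes>\<^sub>M M. ?k (?EE w)
        = V j (fst w) - (\<mu> + G (reflect_shift j (override_on (E (fst w)) (E (snd w)) {0})))"
      by eventually_elim simp
    show "(\<lambda>w. ?k (?EE w)) \<in> borel_measurable (M \<Otimes>\<^sub>M M)"
      by (rule measurable_compose[OF EE k_meas])
    have "(\<lambda>w. mixed ?g {0} (?EE w)) \<in> borel_measurable (M \<Otimes>\<^sub>M M)"
      by (rule measurable_compose[OF EE measurable_mixed[OF G_shift_measurable]])
    then show "(\<lambda>w. V j (fst w) - (\<mu> + G (reflect_shift j (override_on (E (fst w)) (E (snd w)) {0}))))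
        \<in> borel_measurable (M \<Otimes>\<^sub>M M)"
      by (intro borel_measurable_diff borel_measurable_add borel_measurable_const
          measurable_compose[OF measurable_fst V_measurable]) simp
  qed
  finally show ?thesis .
qed

lemma expectation_iexp_statistic:
  assumes "finite T" "(\<Sum>t\<in>T. w t) = 0"
  shows "M.expectation (\<lambda>\<omega>. iexp (u * (\<Sum>t\<in>T. w t * V t \<omega>)))
    = P.expectation (\<lambda>x. iexp (u * linear_statistic w T G x))"
proof -
  have "AE \<omega> in M. \<forall>t\<in>T. V t \<omega> - \<mu> = G (reflect_shift t (E \<omega>))"
    by (rule AE_finite_allI[OF assms(1)]) (rule V_eq)
  then have "AE \<omega> in M. iexp (u * (\<Sum>t\<in>T. w t * V t \<omega>)) = iexp (u * linear_statistic w T G (E \<omega>))"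
  proof eventually_elim
    case (elim \<omega>)
    have "linear_statistic w T G (E \<omega>) = (\<Sum>t\<in>T. w t * (V t \<omega> - \<mu>))"
      unfolding linear_statistic_def using elim by simp
    also have "\<dots> = (\<Sum>t\<in>T. w t * V t \<omega>)"
      using assms(2) by (simp add: right_diff_distrib sum_subtractf flip: sum_distrib_right)
    finally show ?case by simp
  qed
  then have "M.expectation (\<lambda>\<omega>. iexp (u * (\<Sum>t\<in>T. w t * V t \<omega>)))
      = M.expectation (\<lambda>\<omega>. iexp (u * linear_statistic w T G (E \<omega>)))"
    by (intro integral_cong_AE M.iexp_measurable borel_measurable_sum borel_measurable_times
        borel_measurable_const V_measurable measurable_compose[OF E_measurable measurable_linear_statistic[OF G_measurable]])
  also have "\<dots> = P.expectation (\<lambda>x. iexp (u * linear_statistic w T G x))"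
    by (rule expectation_E[OF P.iexp_measurable[OF measurable_linear_statistic[OF G_measurable]]])
  finally show ?thesis .
qed

end

section \<open>Linear combinations of normalised Fourier coefficients\<close>

abbreviation density_at :: "'a measure \<Rightarrow> (site \<Rightarrow> 'a \<Rightarrow> real) \<Rightarrow> nat \<Rightarrow> nat \<Rightarrow> site \<times> nat \<Rightarrow> real" where
  "density_at M V d1 d2 a \<equiv> spectral_density M V (fourier_freq d1 d2 (fst a))"

definition fourier_weight ::
    "'a measure \<Rightarrow> (site \<Rightarrow> 'a \<Rightarrow> real) \<Rightarrow> nat \<Rightarrow> nat \<Rightarrow> ('q::finite \<Rightarrow> site \<times> nat) \<Rightarrow> real ^ 'q \<Rightarrow> site \<Rightarrow> real" where
  "fourier_weight M V d1 d2 a c t =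
     (\<Sum>i\<in>UNIV. c $ i / sqrt (2 * pi\<^sup>2 * density_at M V d1 d2 (a i))
        / sqrt (real (d1 * d2)) * harmonic d1 d2 (a i) t)"

lemma norm_coeff_eq_sum:
  "norm_coeff M V d1 d2 a \<omega> = (\<Sum>t\<in>grid d1 d2. 1 / sqrt (2 * pi\<^sup>2 * density_at M V d1 d2 a)
      / sqrt (real (d1 * d2)) * harmonic d1 d2 a t * V t \<omega>)"
  unfolding norm_coeff_def fourier_cos_def fourier_sin_def harmonic_def
  by (cases "snd a = 1") (simp_all add: phase_def cos_add sum_distrib_left sum_divide_distrib ac_simps)

lemma inner_norm_coeff:
  fixes a :: "'q::finite \<Rightarrow> site \<times> nat" and c :: "real ^ 'q"
  shows "(\<chi> i. norm_coeff M V d1 d2 (a i) \<omega>) \<bullet> c = (\<Sum>t\<in>grid d1 d2. fourier_weight M V d1 d2 a c t * V t \<omega>)"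
proof -
  have "(\<chi> i. norm_coeff M V d1 d2 (a i) \<omega>) \<bullet> c = (\<Sum>i\<in>UNIV. norm_coeff M V d1 d2 (a i) \<omega> * c $ i)"
    by (simp add: inner_vec_def)
  also have "\<dots> = (\<Sum>t\<in>grid d1 d2. fourier_weight M V d1 d2 a c t * V t \<omega>)"
    unfolding norm_coeff_eq_sum fourier_weight_def sum_distrib_right by (subst sum.swap) (simp add: ac_simps)
  finally show ?thesis .
qed

lemma sum_fourier_weight:
  fixes a :: "'q::finite \<Rightarrow> site \<times> nat"
  assumes "0 < d1" "0 < d2" "range a \<subseteq> coeff_indices d1 d2"
  shows "(\<Sum>t\<in>grid d1 d2. fourier_weight M V d1 d2 a c t) = 0"
proof -
  have "(\<Sum>t\<in>grid d1 d2. harmonic d1 d2 (a i) t) = 0" for i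
    by (rule sum_harmonic) (use assms in auto)
  then show ?thesis
    unfolding fourier_weight_def 
    by (subst sum.swap) (simp only: sum_distrib_left[symmetric] mult_zero_right sum.neutral_const)
qed

lemma coeff_indices_freq_range:
  assumes "0 < d1" "0 < d2" "a \<in> coeff_indices d1 d2"
  shows "fourier_freq d1 d2 (fst a) \<in> {0..2 * pi} \<times> {0..2 * pi}"
proof -
  have "fst a \<in> grid d1 d2"
    using assms freq_indices_subset_grid[OF assms(1,2)] by (auto simp: coeff_indices_def)
  then have "0 \<le> fst (fst a)" "fst (fst a) \<le> int d1" "0 \<le> snd (fst a)" "snd (fst a) \<le> int d2"
    by (auto simp: grid_def)
  moreover have "2 * pi * of_int k / real d \<in> {0..2 * pi}" if "0 \<le> k" "k \<le> int d" "0 < d" for k d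
  proof -
    have "real_of_int k \<le> real d"
      using that(2) by linarith
    then show ?thesis
      using that by (simp add: pos_divide_le_eq)
  qed
  ultimately show ?thesis
    using assms by (simp add: fourier_freq_def)
qed

lemma fourier_weight_bound:
  fixes a :: "'q::finite \<Rightarrow> site \<times> nat"
  assumes d: "0 < d1" "0 < d2" and a: "range a \<subseteq> coeff_indices d1 d2" and c: "norm c = 1"
    and f: "0 < f0" "\<And>\<theta>. \<theta> \<in> {0..2 * pi} \<times> {0..2 * pi} \<Longrightarrow> f0 \<le> spectral_density M V \<theta>"
  shows "\<bar>fourier_weight M V d1 d2 a c t\<bar> \<le> (real CARD('q) / sqrt (2 * pi\<^sup>2 * f0)) / sqrt (real (d1 * d2))"
proof -
  have "\<bar>c $ i / sqrt (2 * pi\<^sup>2 * density_at M V d1 d2 (a i))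
        / sqrt (real (d1 * d2)) * harmonic d1 d2 (a i) t\<bar> \<le> 1 / sqrt (2 * pi\<^sup>2 * f0) / sqrt (real (d1 * d2))" for i
  proof -
    have "f0 \<le> density_at M V d1 d2 (a i)"
      using a by (intro f coeff_indices_freq_range d) auto
    then have le: "sqrt (2 * pi\<^sup>2 * f0) \<le> sqrt (2 * pi\<^sup>2 * density_at M V d1 d2 (a i))"
      by (intro real_sqrt_le_mono mult_left_mono) auto
    have pos: "0 < sqrt (2 * pi\<^sup>2 * f0)"
      using f(1) by simp
    have c1: "\<bar>c $ i\<bar> \<le> 1"
      using component_le_norm_cart[of c i] c by simp
    have "\<bar>c $ i\<bar> / \<bar>sqrt (2 * pi\<^sup>2 * density_at M V d1 d2 (a i))\<bar> \<le> 1 / sqrt (2 * pi\<^sup>2 * f0)"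
      by (rule frac_le[OF _ c1 pos order_trans[OF le abs_ge_self]]) simp
    moreover have "\<bar>harmonic d1 d2 (a i) t\<bar> \<le> 1"
      by (simp add: harmonic_def)
    ultimately have "\<bar>c $ i\<bar> / \<bar>sqrt (2 * pi\<^sup>2 * density_at M V d1 d2 (a i))\<bar>
        / \<bar>sqrt (real (d1 * d2))\<bar> * \<bar>harmonic d1 d2 (a i) t\<bar> \<le> 1 / sqrt (2 * pi\<^sup>2 * f0) / \<bar>sqrt (real (d1 * d2))\<bar> * 1"
      using f(1) by (intro mult_mono divide_right_mono) auto
    then show ?thesis
      by (simp add: abs_mult)
  qed
  then have "\<bar>fourier_weight M V d1 d2 a c t\<bar> \<le> (\<Sum>i\<in>(UNIV :: 'q set). 1 / sqrt (2 * pi\<^sup>2 * f0) / sqrt (real (d1 * d2)))"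
    unfolding fourier_weight_def by (intro order_trans[OF sum_abs] sum_mono)
  then show ?thesis by simp
qed

text \<open>By the orthogonality relations the coefficient of \<open>\<gamma> h\<close> is a combination of the
\<open>cos (\<lambda>\<^sub>i \<bullet> h)\<close>, whose sum against \<open>\<gamma>\<close> is \<open>4 * pi\<^sup>2\<close> times the spectral density; the normalisation by
\<open>sqrt (2 * pi\<^sup>2 * f)\<close> is what makes the result \<open>(norm c)\<^sup>2\<close>.\<close>

lemma fourier_weight_circular_variance:
  fixes a :: "'q::finite \<Rightarrow> site \<times> nat"
  assumes \<gamma>: "(\<lambda>j. \<bar>autocov M V j\<bar>) summable_on UNIV"
    and d: "0 < d1" "0 < d2" and a: "inj a" "range a \<subseteq> coeff_indices d1 d2" and c: "norm c = 1"
    and f: "\<And>\<theta>. \<theta> \<in> {0..2 * pi} \<times> {0..2 * pi} \<Longrightarrow> 0 < spectral_density M V \<theta>"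
  shows "(\<Sum>\<^sub>\<infinity>h. autocov M V h
      * (\<Sum>s\<in>grid d1 d2. fourier_weight M V d1 d2 a c s * fourier_weight M V d1 d2 a c (s + h))) = 1"
proof -
  define f where "f i = density_at M V d1 d2 (a i)" for i
  have f_pos: "0 < f i" for i
    unfolding f_def using a by (intro assms(7) coeff_indices_freq_range d) auto
  have corr: "(\<Sum>s\<in>grid d1 d2. fourier_weight M V d1 d2 a c s * fourier_weight M V d1 d2 a c (s + h))
      = (\<Sum>i\<in>UNIV. (c $ i)\<^sup>2 / (4 * pi\<^sup>2 * f i) * cos (fourier_freq d1 d2 (fst (a i)) \<bullet> site_vec h))" for h
  proof -
    have "(\<Sum>s\<in>grid d1 d2. fourier_weight M V d1 d2 a c s * fourier_weight M V d1 d2 a c (s + h))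
        = (\<Sum>i\<in>UNIV. real (d1 * d2) / 2 * ((c $ i / sqrt (2 * pi\<^sup>2 * f i) / sqrt (real (d1 * d2)))\<^sup>2
            * cos (fourier_freq d1 d2 (fst (a i)) \<bullet> site_vec h)))"
      unfolding fourier_weight_def f_def sum_distrib_left[symmetric] by (rule harmonic_sum_autocorrelation[OF d a])
    moreover have "real (d1 * d2) / 2 * ((c $ i / sqrt (2 * pi\<^sup>2 * f i) / sqrt (real (d1 * d2)))\<^sup>2 * r)
        = (c $ i)\<^sup>2 / (4 * pi\<^sup>2 * f i) * r" for i r
      using d f_pos[of i] by (simp add: power_divide power_mult_distrib less_imp_le[OF f_pos])
    ultimately show ?thesis
      by (simp only:)
  qed
  have summ: "(\<lambda>h. autocov M V h * cos (\<theta> \<bullet> site_vec h)) summable_on UNIV" for \<theta>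
  proof (rule abs_summable_summable, rule summable_on_comparison_test[OF \<gamma>])
    show "norm (autocov M V h * cos (\<theta> \<bullet> site_vec h)) \<le> \<bar>autocov M V h\<bar>" for h
      using mult_left_mono[OF abs_cos_le_one abs_ge_zero[of "autocov M V h"], of "\<theta> \<bullet> site_vec h"] by (simp add: abs_mult)
  qed simp
  have "(\<Sum>\<^sub>\<infinity>h. autocov M V h
      * (\<Sum>s\<in>grid d1 d2. fourier_weight M V d1 d2 a c s * fourier_weight M V d1 d2 a c (s + h)))
      = (\<Sum>\<^sub>\<infinity>h. \<Sum>i\<in>UNIV. (c $ i)\<^sup>2 / (4 * pi\<^sup>2 * f i)
          * (autocov M V h * cos (fourier_freq d1 d2 (fst (a i)) \<bullet> site_vec h)))"
    unfolding corr sum_distrib_left by (simp add: ac_simps)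
  also have "\<dots> = (\<Sum>i\<in>UNIV. \<Sum>\<^sub>\<infinity>h. (c $ i)\<^sup>2 / (4 * pi\<^sup>2 * f i)
          * (autocov M V h * cos (fourier_freq d1 d2 (fst (a i)) \<bullet> site_vec h)))"
    by (rule finite_sum_infsum(2)) (rule finite, rule summable_on_cmult_right, rule summ)
  also have "\<dots> = (\<Sum>i\<in>UNIV. (c $ i)\<^sup>2 / (4 * pi\<^sup>2 * f i) * (4 * pi\<^sup>2 * f i))"
    unfolding infsum_cmult_right' spectral_density_cos_series[OF \<gamma>] f_def ..
  also have "\<dots> = (\<Sum>i\<in>UNIV. (c $ i)\<^sup>2)"
  proof (rule sum.cong[OF refl])
    fix i
    show "(c $ i)\<^sup>2 / (4 * pi\<^sup>2 * f i) * (4 * pi\<^sup>2 * f i) = (c $ i)\<^sup>2"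
      using f_pos[of i] by simp
  qed
  also have "\<dots> = (norm c)\<^sup>2"
    unfolding power2_norm_eq_inner inner_vec_def by (simp add: power2_eq_square)
  finally show ?thesis
    by (simp add: c)
qed

text \<open>The coefficients and the unit vector may vary with \<open>n\<close>; this is the source of the uniformity in
the theorem.\<close>

lemma (in moving_average) norm_coeff_CLT:
  fixes d1 d2 :: "nat \<Rightarrow> nat" and a :: "nat \<Rightarrow> 'q::finite \<Rightarrow> site \<times> nat" and c :: "nat \<Rightarrow> real ^ 'q"
  assumes mean: "\<And>j. M.expectation (V j) = \<mu>" "integrable M (V 0)"
    and G: "sqint P G" and summable: "\<And>A. finite A \<Longrightarrow> (\<Sum>j\<in>A. influence G j) \<le> \<Delta>"
    and d: "filterlim d1 at_top sequentially" "filterlim d2 at_top sequentially"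
    and \<gamma>: "(\<lambda>j. \<bar>autocov M V j\<bar>) summable_on UNIV"
    and f: "0 < f0" "\<And>\<theta>. \<theta> \<in> {0..2 * pi} \<times> {0..2 * pi} \<Longrightarrow> f0 \<le> spectral_density M V \<theta>"
    and admissible: "\<forall>\<^sub>F n in sequentially. inj (a n) \<and> range (a n) \<subseteq> coeff_indices (d1 n) (d2 n) \<and> norm (c n) = 1"
  shows "weak_conv_m (\<lambda>n. distr M borel (\<lambda>\<omega>. (\<chi> i. norm_coeff M V (d1 n) (d2 n) (a n i) \<omega>) \<bullet> c n))
    std_normal_distribution"
proof (rule levy_continuity)
  define w where "w n = fourier_weight M V (d1 n) (d2 n) (a n) (c n)" for n
  define T where "T n = grid (d1 n) (d2 n)" for n
  define C where "C = real CARD('q) / sqrt (2 * pi\<^sup>2 * f0)"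
  have stat: "(\<chi> i. norm_coeff M V (d1 n) (d2 n) (a n i) \<omega>) \<bullet> c n = (\<Sum>t\<in>T n. w n t * V t \<omega>)" for n \<omega>
    by (simp add: inner_norm_coeff w_def T_def)
  have X: "(\<lambda>\<omega>. \<Sum>t\<in>T n. w n t * V t \<omega>) \<in> borel_measurable M" for n
    by (intro borel_measurable_sum borel_measurable_times borel_measurable_const V_measurable)
  show "real_distribution (distr M borel (\<lambda>\<omega>. (\<chi> i. norm_coeff M V (d1 n) (d2 n) (a n i) \<omega>) \<bullet> c n))" for n
    unfolding stat by (rule M.real_distribution_distr[OF X])
  show "real_distribution std_normal_distribution"
    by (rule real_dist_normal_dist)
  have d_pos: "\<forall>\<^sub>F n in sequentially. 0 < d1 n" "\<forall>\<^sub>F n in sequentially. 0 < d2 n"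
    using d by (auto simp: filterlim_at_top Suc_le_eq dest!: spec[of _ "Suc 0"])
  have C0: "0 \<le> C"
    using f(1) by (simp add: C_def)
  have w_bound: "\<forall>\<^sub>F n in sequentially. \<forall>t. \<bar>w n t\<bar> \<le> C / sqrt (real (d1 n * d2 n))"
    using d_pos admissible
  proof eventually_elim
    case (elim n)
    then show ?case
      unfolding w_def C_def using fourier_weight_bound[OF elim(1,2) _ _ f] by blast
  qed
  have "(\<lambda>n. (\<Sum>\<^sub>\<infinity>h. autocov M V h * (\<Sum>s\<in>T n. w n s * w n (s + h)))
      - (\<Sum>s\<in>T n. \<Sum>t\<in>T n. w n s * w n t * autocov M V (t - s))) \<longlonglongrightarrow> 0"
    unfolding T_def by (rule quadratic_form_circular_limit[OF \<gamma> d w_bound])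
  moreover have "\<forall>\<^sub>F n in sequentially. (\<Sum>\<^sub>\<infinity>h. autocov M V h * (\<Sum>s\<in>T n. w n s * w n (s + h)))
      - (\<Sum>s\<in>T n. \<Sum>t\<in>T n. w n s * w n t * autocov M V (t - s))
      = 1 - (\<Sum>s\<in>T n. \<Sum>t\<in>T n. w n s * w n t * autocov M V (t - s))"
    using d_pos admissible
  proof eventually_elim
    case (elim n)
    have "0 < spectral_density M V \<theta>" if "\<theta> \<in> {0..2 * pi} \<times> {0..2 * pi}" for \<theta>
      using f(1) f(2)[OF that] by linarith
    then have "(\<Sum>\<^sub>\<infinity>h. autocov M V h * (\<Sum>s\<in>T n. w n s * w n (s + h))) = 1"
      unfolding w_def T_def using fourier_weight_circular_variance[OF \<gamma> elim(1,2)] elim(3) by blast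
    then show ?case by simp
  qed
  ultimately have "(\<lambda>n. 1 - (l2norm P (linear_statistic (w n) (T n) G))\<^sup>2) \<longlonglongrightarrow> 0"
    unfolding l2norm_linear_statistic_autocov[OF mean(1) G]
    by (rule Lim_transform_eventually)
  then have "(\<lambda>n. 1 - (1 - (l2norm P (linear_statistic (w n) (T n) G))\<^sup>2)) \<longlonglongrightarrow> 1 - 0"
    by (intro tendsto_diff tendsto_const)
  then have "(\<lambda>n. sqrt ((l2norm P (linear_statistic (w n) (T n) G))\<^sup>2)) \<longlonglongrightarrow> sqrt 1"
    by (intro tendsto_real_sqrt) simp
  then have var: "(\<lambda>n. l2norm P (linear_statistic (w n) (T n) G)) \<longlonglongrightarrow> 1"
    by (simp add: l2norm_nonneg)
  have card: "filterlim (\<lambda>n. card (T n)) at_top sequentially"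
  proof (rule filterlim_at_top_mono[OF d(1)])
    show "\<forall>\<^sub>F n in sequentially. d1 n \<le> card (T n)"
      using d_pos(2) by eventually_elim (simp add: T_def card_grid)
  qed
  have bound: "\<forall>\<^sub>F n in sequentially. \<forall>t\<in>T n. \<bar>w n t\<bar> \<le> C / sqrt (real (card (T n)))"
    using w_bound unfolding T_def card_grid by eventually_elim blast
  have clt: "(\<lambda>n. P.expectation (\<lambda>x. iexp (u * linear_statistic (w n) (T n) G x))) \<longlonglongrightarrow> of_real (exp (- (u\<^sup>2) / 2))" for u
    by (rule linear_statistic_CLT[OF G expectation_G[OF mean(2,1)] summable _ card bound C0 var])
       (simp_all add: T_def finite_grid)
  show "(\<lambda>n. char (distr M borel (\<lambda>\<omega>. (\<chi> i. norm_coeff M V (d1 n) (d2 n) (a n i) \<omega>) \<bullet> c n)) u)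
      \<longlonglongrightarrow> char std_normal_distribution u" for u
    unfolding char_std_normal_distribution stat
  proof (rule Lim_transform_eventually[OF clt])
    show "\<forall>\<^sub>F n in sequentially. P.expectation (\<lambda>x. iexp (u * linear_statistic (w n) (T n) G x))
        = char (distr M borel (\<lambda>\<omega>. \<Sum>t\<in>T n. w n t * V t \<omega>)) u"
      using d_pos admissible
    proof eventually_elim
      case (elim n)
      have "char (distr M borel (\<lambda>\<omega>. \<Sum>t\<in>T n. w n t * V t \<omega>)) u
          = M.expectation (\<lambda>\<omega>. iexp (u * (\<Sum>t\<in>T n. w n t * V t \<omega>)))"
        unfolding char_def by (rule integral_distr[OF X]) measurable
      also have "\<dots> = P.expectation (\<lambda>x. iexp (u * linear_statistic (w n) (T n) G x))"
        by (rule expectation_iexp_statistic)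
           (use elim in \<open>auto simp: T_def w_def finite_grid intro!: sum_fourier_weight\<close>)
      finally show ?case ..
    qed
  qed
qed

text \<open>Ensures that the supremum in the theorem is eventually over a nonempty set. All four cases of the
definition of the index set contain the beginning of the row \<open>j2 = 1\<close>.\<close>

lemma coeff_indices_large:
  assumes "4 \<le> d2" "2 * k + 2 \<le> d1"
  shows "(\<lambda>i. ((int i + 1, 1), 1)) ` {..<k} \<subseteq> coeff_indices d1 d2"
proof -
  have "(int i + 1, 1) \<in> freq_indices d1 d2" if "i < k" for i
    using that assms unfolding freq_indices_def Let_def
    by (cases "even d1"; cases "even d2") (auto elim!: evenE oddE)
  then show ?thesis
    by (auto simp: coeff_indices_def)
qed

theorem theorem4p1:
  fixes M :: "'a measure"
    and V :: "site \<Rightarrow> 'a \<Rightarrow> real"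
    and \<mu> \<xi> c1 c2 p :: real
    and d1 d2 :: "nat \<Rightarrow> nat"
  assumes "prob_space M"
    and "stationary_field M V"
    and "has_mean M V \<mu>"
    and "filterlim d1 at_top sequentially"
    and "filterlim d2 at_top sequentially"
    and "0 < \<xi>" and "\<xi> \<le> 1 / 2" and "0 < c1" and "0 < c2"
    and "\<forall>\<^sub>F n in sequentially.
           real (d1 n) > c1 * real (d1 n * d2 n) powr \<xi> \<and>
           real (d2 n) > c2 * real (d1 n * d2 n) powr \<xi>"
    and "(\<lambda>j. \<bar>autocov M V j\<bar>) summable_on UNIV"
    and "\<exists>c>0. \<forall>\<theta>\<in>{0..2 * pi} \<times> {0..2 * pi}. c \<le> spectral_density M V \<theta>"
    and "2 \<le> p" and "p_stable M \<mu> p V"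
  shows "(\<lambda>n. SUP (a, c, z) \<in> {(a :: 'q::finite \<Rightarrow> site \<times> nat, c :: real ^ 'q, z :: real).
                 inj a \<and> range a \<subseteq> coeff_indices (d1 n) (d2 n) \<and> norm c = 1}.
           \<bar>measure M {\<omega> \<in> space M. (\<chi> i. norm_coeff M V (d1 n) (d2 n) (a i) \<omega>) \<bullet> c \<le> z}
             - cdf std_normal_distribution z\<bar>)
         \<longlonglongrightarrow> 0"
proof -
  interpret M: prob_space M by fact
  note d = assms(4,5) and \<gamma> = assms(11) and p = assms(13)
  have V: "V j \<in> borel_measurable M" for j
    using assms(2) unfolding stationary_field_def by blast
  have mean: "integrable M (V j)" "M.expectation (V j) = \<mu>" for j
    using assms(3) unfolding has_mean_def by blast+
  obtain f0 where f: "0 < f0" "\<And>\<theta>. \<theta> \<in> {0..2 * pi} \<times> {0..2 * pi} \<Longrightarrow> f0 \<le> spectral_density M V \<theta>"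
    using assms(12) by blast
  obtain \<epsilon> G where iid: "iid_field M \<epsilon>" and G: "G \<in> borel_measurable (Pi\<^sub>M UNIV (\<lambda>_. borel))"
    and VG: "\<And>j. AE \<omega> in M. V j \<omega> - \<mu> = G (\<lambda>s. \<epsilon> (j - s) \<omega>)"
    and stable: "(\<lambda>j. Lp_norm (M \<Otimes>\<^sub>M M) p
        (\<lambda>w. V j (fst w) - (\<mu> + G (\<lambda>s. coupled_noise \<epsilon> (j - s) w)))) summable_on UNIV"
    and Lp: "\<And>j. in_Lp M p (V j)"
    using assms(14) unfolding p_stable_def by blast
  define \<nu> where "\<nu> = distr M borel (\<epsilon> 0)"
  define E where "E \<omega> = (\<lambda>i. \<epsilon> i \<omega>)" for \<omega>
  note law = M.iid_field_law[OF iid, folded \<nu>_def]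
  interpret \<nu>: real_distribution \<nu> by (rule law(1))
  interpret moving_average M \<nu> E G V \<mu>
  proof
    show "E \<in> measurable M (Pi\<^sub>M UNIV (\<lambda>_. \<nu>))" "distr M (Pi\<^sub>M UNIV (\<lambda>_. \<nu>)) E = Pi\<^sub>M UNIV (\<lambda>_. \<nu>)"
      using law(2,3) by (simp_all add: E_def[abs_def])
    have "sets (Pi\<^sub>M UNIV (\<lambda>_::site. \<nu>)) = sets (Pi\<^sub>M UNIV (\<lambda>_. borel))"
      by (rule sets_PiM_cong) (simp_all add: \<nu>_def)
    then show "G \<in> borel_measurable (Pi\<^sub>M UNIV (\<lambda>_. \<nu>))"
      using G measurable_cong_sets by blast
    show "AE \<omega> in M. V j \<omega> - \<mu> = G (reflect_shift j (E \<omega>))" for j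
      using VG[of j] by (simp add: reflect_shift_def E_def)
  qed (rule V)
  have GLp: "in_Lp P p G"
    by (rule in_Lp_G[OF _ Lp]) (use p in simp)
  have sG: "sqint P G"
    by (rule P.l2norm_le_Lp_norm(1)[OF p GLp])
  define \<delta> where "\<delta> j = Lp_norm (M \<Otimes>\<^sub>M M) p
      (\<lambda>w. V j (fst w) - (\<mu> + G (\<lambda>s. coupled_noise \<epsilon> (j - s) w)))" for j
  have "influence G j \<le> \<delta> j" for j
  proof -
    have "(\<lambda>s. coupled_noise \<epsilon> (j - s) w) = reflect_shift j (override_on (E (fst w)) (E (snd w)) {0})" for w
      by (auto simp: coupled_noise_def reflect_shift_def override_on_def E_def)
    then show ?thesis
      using influence_le_Lp_norm[OF p GLp, of j] by (simp add: \<delta>_def)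
  qed
  moreover have "(\<Sum>j\<in>A. \<delta> j) \<le> (\<Sum>\<^sub>\<infinity>j. \<delta> j)" if "finite A" for A
    by (rule finite_sum_le_infsum[OF _ that]) (use stable in \<open>simp_all add: \<delta>_def[abs_def] Lp_norm_def\<close>)
  ultimately have summable: "(\<Sum>j\<in>A. influence G j) \<le> (\<Sum>\<^sub>\<infinity>j. \<delta> j)" if "finite A" for A
    using sum_mono[of A "influence G" \<delta>] that by (meson order_trans)
  define admissible where "admissible n = {(a :: 'q \<Rightarrow> site \<times> nat, c :: real ^ 'q, z :: real).
      inj a \<and> range a \<subseteq> coeff_indices (d1 n) (d2 n) \<and> norm c = 1}" for n
  define X where "X n a c \<omega> = (\<chi> i. norm_coeff M V (d1 n) (d2 n) (a i) \<omega>) \<bullet> c"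
    for n and a :: "'q \<Rightarrow> site \<times> nat" and c \<omega>
  define gap where "gap n = (\<lambda>(a, c, z).
      \<bar>measure M {\<omega> \<in> space M. X n a c \<omega> \<le> z} - cdf std_normal_distribution z\<bar>)" for n
  have X_meas: "X n a c \<in> borel_measurable M" for n a c
    unfolding X_def[abs_def] inner_norm_coeff
    by (intro borel_measurable_sum borel_measurable_times borel_measurable_const V)
  have cdf_X: "measure M {\<omega> \<in> space M. X n a c \<omega> \<le> z} = cdf (distr M borel (X n a c)) z" for n a c z
    unfolding cdf_def by (subst measure_distr[OF X_meas]) (auto intro: arg_cong[where f = "measure M"])
  have nonempty: "\<forall>\<^sub>F n in sequentially. admissible n \<noteq> {}"
  proof -
    have "\<forall>\<^sub>F n in sequentially. 2 * CARD('q) + 2 \<le> d1 n" "\<forall>\<^sub>F n in sequentially. 4 \<le> d2 n"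
      using d by (auto simp: filterlim_at_top)
    then show ?thesis
    proof eventually_elim
      case (elim n)
      obtain \<iota> :: "'q \<Rightarrow> nat" where \<iota>: "bij_betw \<iota> UNIV {..<CARD('q)}"
        using ex_bij_betw_finite_nat[of "UNIV :: 'q set"] by (auto simp: atLeast0LessThan)
      define a where "a i = ((int (\<iota> i) + 1, 1 :: int), 1 :: nat)" for i
      have "inj a"
        using \<iota> by (auto simp: inj_def a_def bij_betw_def)
      moreover have "range a \<subseteq> coeff_indices (d1 n) (d2 n)"
        using coeff_indices_large[OF elim(2,1)] bij_betw_apply[OF \<iota>] by (auto simp: a_def)
      moreover have "norm (axis undefined 1 :: real ^ 'q) = 1"
        by simp
      ultimately have "(a, axis undefined 1, 0) \<in> admissible n"
        by (simp add: admissible_def)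
      then show ?case by blast
    qed
  qed
  have gap_small: "\<forall>\<^sub>F n in sequentially. \<forall>x\<in>admissible n. gap n x < e" if "0 < e" for e
  proof -
    \<comment> \<open>A triple violating the bound is selected whenever there is one, so that the limit theorem along
          the selected sequence bounds the gap at all admissible triples.\<close>
    define good where "good n x \<longleftrightarrow> x \<in> admissible n \<and> ((\<exists>y\<in>admissible n. e \<le> gap n y) \<longrightarrow> e \<le> gap n x)" for n x
    define sel where "sel n = (SOME x. good n x)" for n
    have good: "good n (sel n)" if "admissible n \<noteq> {}" for n
      unfolding sel_def
    proof (rule someI_ex, cases "\<exists>y\<in>admissible n. e \<le> gap n y")
      case True
      then show "\<exists>x. good n x"
        unfolding good_def by blast
    next
      case False
      then show "\<exists>x. good n x"
        unfolding good_def using that by blast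
    qed
    define a c z where "a n = fst (sel n)" and "c n = fst (snd (sel n))" and "z n = snd (snd (sel n))" for n
    have sel_eq: "sel n = (a n, c n, z n)" for n
      by (simp add: a_def c_def z_def)
    have adm: "\<forall>\<^sub>F n in sequentially.
        inj (a n) \<and> range (a n) \<subseteq> coeff_indices (d1 n) (d2 n) \<and> norm (c n) = 1"
      using nonempty
    proof eventually_elim
      case (elim n)
      then show ?case
        using good[OF elim] by (simp add: good_def sel_eq admissible_def)
    qed
    have "weak_conv_m (\<lambda>n. distr M borel (X n (a n) (c n))) std_normal_distribution"
      unfolding X_def[abs_def] by (rule norm_coeff_CLT[OF mean(2,1) sG summable d \<gamma> f adm])
    then have "\<forall>\<^sub>F n in sequentially. \<forall>z.
        \<bar>cdf (distr M borel (X n (a n) (c n))) z - cdf std_normal_distribution z\<bar> < e"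
      by (intro weak_conv_cdf_uniform M.real_distribution_distr X_meas real_dist_normal_dist
          isCont_cdf_std_normal that)
    then show ?thesis
      using nonempty
    proof eventually_elim
      case (elim n)
      then have "gap n (sel n) < e"
        by (simp add: sel_eq gap_def cdf_X)
      then show ?case
        using good[OF elim(2)] unfolding good_def not_le[symmetric] by blast
    qed
  qed
  have "(\<lambda>n. SUP x\<in>admissible n. gap n x) \<longlonglongrightarrow> 0"
  proof (rule tendstoI)
    fix e :: real assume "0 < e"
    then have "0 < e / 2" by simp
    from gap_small[OF this] nonempty
    show "\<forall>\<^sub>F n in sequentially. dist (SUP x\<in>admissible n. gap n x) 0 < e"
    proof eventually_elim
      case (elim n)
      have le: "gap n x \<le> e / 2" if "x \<in> admissible n" for x
        using elim(1) that by (simp add: less_imp_le)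
      have "(SUP x\<in>admissible n. gap n x) \<le> e / 2"
        by (rule cSUP_least[OF elim(2) le])
      moreover obtain x where x: "x \<in> admissible n"
        using elim(2) by blast
      have "bdd_above (gap n ` admissible n)"
        by (rule bdd_aboveI2) (rule le)
      then have "gap n x \<le> (SUP x\<in>admissible n. gap n x)"
        by (rule cSUP_upper[OF x])
      moreover have "0 \<le> gap n x"
        by (simp add: gap_def case_prod_beta)
      ultimately show ?case
        using \<open>0 < e\<close> by (simp add: dist_real_def)
    qed
  qed
  then show ?thesis
    unfolding gap_def admissible_def X_def .
qed

end
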